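(* Let $X$ and $Y$ be two (not necessarily bounded) self-adjoint operators on a Hilbert space $H$ that are monotonically independent (in this order) w.r.t. a unit vector $\Omega\in H$. Assume furthermore that $\Omega$ is cyclic, i.e. that $$\overline{\mathrm{alg}\{h(X),h(Y);\,h\in C_b(\mathbb{R})\}\,\Omega}=H.$$ Then $X+Y$ is essentially self-adjoint, and the distribution w.r.t. $\Omega$ of its closure is equal to the additive monotone convolution of the distributions of $X$ and $Y$ w.r.t. $\Omega$, i.e. $$\mathcal{L}(X+Y,\Omega)=\mathcal{L}(X,\Omega)\triangleright\mathcal{L}(Y,\Omega).$$
   Context: Inner products are linear in the second argument. $X+Y$ is defined on $\mathrm{Dom}\,X\cap\mathrm{Dom}\,Y$. For a self-adjoint operator $X$ and a unit vector $\Omega$, $\mathcal{L}(X,\Omega)$ is the probability measure $\mu$ on $\mathbb{R}$ with $\langle\Omega,h(X)\Omega\rangle=\int h\,\mathrm{d}\mu$ for all bounded continuous $h$; for an essentially self-adjoint operator, $\mathcal{L}$ refers to the closure. $\mathrm{alg}\{\cdots\}$ is the algebra generated by the listed operators. Monotone independence: let $\mathbb{A}_k$ be the set of $(\varepsilon_1,\dots,\varepsilon_k)\in\{1,2\}^k$ with adjacent entries distinct. Two (not necessarily unital) $*$-algebras $\mathcal{A}_1,\mathcal{A}_2\subset\mathcal{B}(H)$ are monotonically independent w.r.t. a unit vector $\Omega$ if $$\langle\Omega,X_1X_2\cdots X_k\Omega\rangle=\Big\langle\Omega,\prod_{\kappa:\varepsilon_\kappa=1}X_\kappa\,\Omega\Big\rangle\prod_{\kappa:\varepsilon_\kappa=2}\langle\Omega,X_\kappa\Omega\rangle$$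 for all $k\in\mathbb{N}$, $\varepsilon\in\mathbb{A}_k$, $X_1\in\mathcal{A}_{\varepsilon_1},\dots,X_k\in\mathcal{A}_{\varepsilon_k}$ (operator product in the order of the indices). Two normal operators $X,Y$ are monotonically independent w.r.t. $\Omega$ if $\mathrm{alg}_0(X)=\{h(X);h\in C_b(\mathbb{C}),h(0)=0\}$ and $\mathrm{alg}_0(Y)=\{h(Y);h\in C_b(\mathbb{C}),h(0)=0\}$ are (in this order). Additive monotone convolution: for a probability measure $\mu$ on $\mathbb{R}$ and $z\in\mathbb{C}^+=\{\mathrm{Im}\,z>0\}$ put $G_\mu(z)=\int_{\mathbb{R}}\frac{1}{z-x}\,\mathrm{d}\mu(x)$ and $F_\mu(z)=1/G_\mu(z)$. The map $\mu\mapsto F_\mu$ is a bijection from the probability measures on $\mathbb{R}$ onto the holomorphic maps $F:\mathbb{C}^+\to\mathbb{C}^+$ with $\inf_{z\in\mathbb{C}^+}\mathrm{Im}F(z)/\mathrm{Im}z=1$. $\mu\triangleright\nu$ is the unique probability measure on $\mathbb{R}$ with $F_{\mu\triangleright\nu}=F_\mu\circ F_\nu$. *)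

theory Defs
  imports "HOL-Probability.Probability"
begin

section \<open>Complex Hilbert spaces and operators\<close>

text \<open>The norm, the topology and completeness come from \<^class>\<open>banach\<close>; the axioms tie the norm to
  the complex inner product, which is linear in the second argument.\<close>

class complex_hilbert_space = banach +
  fixes scaleC :: "complex \<Rightarrow> 'a \<Rightarrow> 'a" (infixr "*\<^sub>C" 75)
    and cinner :: "'a \<Rightarrow> 'a \<Rightarrow> complex"
  assumes scaleC_add_right: "c *\<^sub>C (x + y) = c *\<^sub>C x + c *\<^sub>C y"
    and scaleC_add_left: "(c + d) *\<^sub>C x = c *\<^sub>C x + d *\<^sub>C x"
    and scaleC_scaleC: "c *\<^sub>C d *\<^sub>C x = (c * d) *\<^sub>C x"
    and scaleC_of_real: "complex_of_real r *\<^sub>C x = r *\<^sub>R x"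
    and cinner_commute: "cinner x y = cnj (cinner y x)"
    and cinner_add_right: "cinner x (y + z) = cinner x y + cinner x z"
    and cinner_scaleC_right: "cinner x (c *\<^sub>C y) = c * cinner x y"
    and cinner_self: "cinner x x = complex_of_real ((norm x)\<^sup>2)"

text \<open>Everywhere defined bounded operators are functions; possibly unbounded operators are
  identified with their graphs, so that the operator closure is the topological closure of the
  graph and the domain is \<^const>\<open>Domain\<close>.\<close>

definition bounded_clinear :: "('a::complex_hilbert_space \<Rightarrow> 'a) \<Rightarrow> bool" where
  "bounded_clinear T \<longleftrightarrow> bounded_linear T \<and> (\<forall>c x. T (c *\<^sub>C x) = c *\<^sub>C T x)"

definition linear_operator :: "('a::complex_hilbert_space \<times> 'a) set \<Rightarrow> bool" where
  "linear_operator T \<longleftrightarrow> single_valued T \<and> (0, 0) \<in> T \<and>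
     (\<forall>x y x' y'. (x, y) \<in> T \<longrightarrow> (x', y') \<in> T \<longrightarrow> (x + x', y + y') \<in> T) \<and>
     (\<forall>c x y. (x, y) \<in> T \<longrightarrow> (c *\<^sub>C x, c *\<^sub>C y) \<in> T)"

definition densely_defined :: "('a::complex_hilbert_space \<times> 'a) set \<Rightarrow> bool" where
  "densely_defined T \<longleftrightarrow> linear_operator T \<and> closure (Domain T) = UNIV"

definition adjoint_op :: "('a::complex_hilbert_space \<times> 'a) set \<Rightarrow> ('a \<times> 'a) set" where
  "adjoint_op T = {(y, z). \<forall>(x, w)\<in>T. cinner y w = cinner z x}"

definition symmetric_op :: "('a::complex_hilbert_space \<times> 'a) set \<Rightarrow> bool" where
  "symmetric_op T \<longleftrightarrow> densely_defined T \<and> T \<subseteq> adjoint_op T"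

definition self_adjoint :: "('a::complex_hilbert_space \<times> 'a) set \<Rightarrow> bool" where
  "self_adjoint T \<longleftrightarrow> densely_defined T \<and> adjoint_op T = T"

definition essentially_self_adjoint :: "('a::complex_hilbert_space \<times> 'a) set \<Rightarrow> bool" where
  "essentially_self_adjoint T \<longleftrightarrow> symmetric_op T \<and> self_adjoint (closure T)"

definition op_sum ::
  "('a::complex_hilbert_space \<times> 'a) set \<Rightarrow> ('a \<times> 'a) set \<Rightarrow> ('a \<times> 'a) set" where
  "op_sum X Y = {(x, y + z) | x y z. (x, y) \<in> X \<and> (x, z) \<in> Y}"


section \<open>Functional calculus\<close>

definition orth_projection :: "('a::complex_hilbert_space \<Rightarrow> 'a) \<Rightarrow> bool" where
  "orth_projection P \<longleftrightarrow> bounded_clinear P \<and> (\<forall>x. P (P x) = P x) \<and>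
     (\<forall>x y. cinner x (P y) = cinner (P x) y)"

definition projection_valued_measure :: "(real set \<Rightarrow> 'a::complex_hilbert_space \<Rightarrow> 'a) \<Rightarrow> bool" where
  "projection_valued_measure E \<longleftrightarrow> (\<forall>A\<in>sets borel. orth_projection (E A)) \<and>
     (\<forall>x. E UNIV x = x) \<and>
     (\<forall>A. range A \<subseteq> sets borel \<longrightarrow> disjoint_family A \<longrightarrow>
        (\<forall>x. (\<lambda>n::nat. E (A n) x) sums E (\<Union>n. A n) x))"

text \<open>The finite measure \<open>A \<mapsto> \<langle>x, E(A) x\<rangle>\<close>.\<close>

definition diag_measure ::
  "(real set \<Rightarrow> 'a::complex_hilbert_space \<Rightarrow> 'a) \<Rightarrow> 'a \<Rightarrow> real measure" where
  "diag_measure E x = measure_of UNIV (sets borel) (\<lambda>A. ennreal (Re (cinner x (E A x))))"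

text \<open>\<open>X = \<integral> t dE(t)\<close>, including the equality of domains. By polarization the diagonal matrix
  elements determine the linear operator \<open>X\<close>.\<close>

definition spectral_measure ::
  "('a::complex_hilbert_space \<times> 'a) set \<Rightarrow> (real set \<Rightarrow> 'a \<Rightarrow> 'a) \<Rightarrow> bool" where
  "spectral_measure X E \<longleftrightarrow> projection_valued_measure E \<and>
     Domain X = {x. (\<integral>\<^sup>+ t. ennreal (t\<^sup>2) \<partial>diag_measure E x) < \<infinity>} \<and>
     (\<forall>(x, y)\<in>X. cinner x y = complex_of_real (\<integral> t. t \<partial>diag_measure E x))"

text \<open>\<open>h(X) = \<integral> h dE\<close> for self-adjoint \<open>X\<close> with spectral measure \<open>E\<close> and bounded Borel \<open>h\<close>.\<close>

definition fun_calc ::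
  "('a::complex_hilbert_space \<times> 'a) set \<Rightarrow> (real \<Rightarrow> complex) \<Rightarrow> 'a \<Rightarrow> 'a" where
  "fun_calc X h = (THE T. bounded_clinear T \<and>
     (\<exists>E. spectral_measure X E \<and> (\<forall>x. cinner x (T x) = (\<integral> t. h t \<partial>diag_measure E x))))"

definition distribution ::
  "('a::complex_hilbert_space \<times> 'a) set \<Rightarrow> 'a \<Rightarrow> real measure" where
  "distribution X \<Omega> = (THE \<mu>. real_distribution \<mu> \<and>
     (\<forall>h\<in>bcontfun. cinner \<Omega> (fun_calc X h \<Omega>) = (\<integral> t. h t \<partial>\<mu>)))"


section \<open>Generated algebras and monotone independence\<close>

text \<open>The generated algebra is not assumed to be unital.\<close>

inductive_set alg :: "('a::complex_hilbert_space \<Rightarrow> 'a) set \<Rightarrow> ('a \<Rightarrow> 'a) set"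
  for S :: "('a \<Rightarrow> 'a) set" where
  zero: "(\<lambda>x. 0) \<in> alg S"
| generator: "T \<in> S \<Longrightarrow> T \<in> alg S"
| add: "T \<in> alg S \<Longrightarrow> U \<in> alg S \<Longrightarrow> (\<lambda>x. T x + U x) \<in> alg S"
| scale: "T \<in> alg S \<Longrightarrow> (\<lambda>x. c *\<^sub>C T x) \<in> alg S"
| mult: "T \<in> alg S \<Longrightarrow> U \<in> alg S \<Longrightarrow> T \<circ> U \<in> alg S"

definition cyclic_vector ::
  "('a::complex_hilbert_space \<times> 'a) set \<Rightarrow> ('a \<times> 'a) set \<Rightarrow> 'a \<Rightarrow> bool" where
  "cyclic_vector X Y \<Omega> \<longleftrightarrow>
     closure ((\<lambda>T. T \<Omega>) ` alg {T. \<exists>h\<in>bcontfun. T = fun_calc X h \<or> T = fun_calc Y h}) = UNIV"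

text \<open>Members of \<open>A\<close> and \<open>B\<close> are operators; \<open>\<epsilon> i = 1\<close> selects \<open>A\<close> and \<open>\<epsilon> i = 2\<close> selects \<open>B\<close>.\<close>

definition op_prod :: "('a \<Rightarrow> 'a) list \<Rightarrow> 'a \<Rightarrow> 'a" where
  "op_prod Ts = foldr (\<circ>) Ts id"

definition alternating :: "nat \<Rightarrow> (nat \<Rightarrow> nat) \<Rightarrow> bool" where
  "alternating k \<epsilon> \<longleftrightarrow> (\<forall>i\<in>{1..k}. \<epsilon> i \<in> {1, 2}) \<and> (\<forall>i\<in>{1..<k}. \<epsilon> i \<noteq> \<epsilon> (Suc i))"

definition monotone_indep_alg ::
  "('a::complex_hilbert_space \<Rightarrow> 'a) set \<Rightarrow> ('a \<Rightarrow> 'a) set \<Rightarrow> 'a \<Rightarrow> bool" where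
  "monotone_indep_alg A B \<Omega> \<longleftrightarrow>
     (\<forall>k\<ge>1. \<forall>\<epsilon> X. alternating k \<epsilon> \<longrightarrow>
        (\<forall>i\<in>{1..k}. X i \<in> (if \<epsilon> i = 1 then A else B)) \<longrightarrow>
        cinner \<Omega> (op_prod (map X [1..<Suc k]) \<Omega>) =
          cinner \<Omega> (op_prod (map X (filter (\<lambda>i. \<epsilon> i = 1) [1..<Suc k])) \<Omega>) *
          (\<Prod>i | i \<in> {1..k} \<and> \<epsilon> i = 2. cinner \<Omega> (X i \<Omega>)))"

text \<open>For self-adjoint \<open>X\<close>, regarded as a normal operator, \<open>h(X)\<close> with \<open>h\<close> on the complex plane
  only involves the restriction of \<open>h\<close> to the real line, which carries the spectrum.\<close>

definition alg0 :: "('a::complex_hilbert_space \<times> 'a) set \<Rightarrow> ('a \<Rightarrow> 'a) set" where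
  "alg0 X = {fun_calc X (\<lambda>t. h (complex_of_real t)) | h :: complex \<Rightarrow> complex.
     h \<in> bcontfun \<and> h 0 = 0}"

definition monotone_indep ::
  "('a::complex_hilbert_space \<times> 'a) set \<Rightarrow> ('a \<times> 'a) set \<Rightarrow> 'a \<Rightarrow> bool" where
  "monotone_indep X Y \<Omega> \<longleftrightarrow> monotone_indep_alg (alg0 X) (alg0 Y) \<Omega>"


section \<open>Additive monotone convolution\<close>

definition cauchy_transform :: "real measure \<Rightarrow> complex \<Rightarrow> complex" where
  "cauchy_transform \<mu> z = (\<integral> x. 1 / (z - complex_of_real x) \<partial>\<mu>)"

definition recip_cauchy_transform :: "real measure \<Rightarrow> complex \<Rightarrow> complex" where
  "recip_cauchy_transform \<mu> z = 1 / cauchy_transform \<mu> z"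

definition monotone_conv :: "real measure \<Rightarrow> real measure \<Rightarrow> real measure" (infixl "\<rhd>" 65) where
  "\<mu> \<rhd> \<nu> = (THE \<rho>. real_distribution \<rho> \<and>
     (\<forall>z. Im z > 0 \<longrightarrow> recip_cauchy_transform \<rho> z =
        recip_cauchy_transform \<mu> (recip_cauchy_transform \<nu> z)))"

end

theory Submission
  imports Defs "HOL-Real_Asymp.Real_Asymp"
begin

text \<open>
  Fix a nonreal \<open>z\<close> and let \<open>G = \<langle>\<Omega>, (z - Y)\<^sup>-\<^sup>1 \<Omega>\<rangle>\<close>, the Cauchy transform at \<open>z\<close> of the distribution
  of \<open>Y\<close>.  Monotone independence turns a bounded function of \<open>Y\<close> that stands to the right of a
  bounded function \<open>f\<close> of \<open>X\<close> into a scalar: if \<open>f 0 = 0\<close>, then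
  \<open>f(X) h(Y) g(X) \<Omega> = \<langle>\<Omega>, h(Y) \<Omega>\<rangle> f(X) g(X) \<Omega>\<close> (lemma \<open>factorize\<close>), because the difference of the
  two sides has norm zero.  Hence the span of the vectors \<open>h(Y) g(X) \<Omega>\<close> is invariant under all
  bounded functions of \<open>X\<close> and of \<open>Y\<close>, and as \<open>\<Omega>\<close> is cyclic it is dense (\<open>elementary_total\<close>).

  These vectors behave like the functions \<open>g(x) h(y)\<close> in \<open>L\<^sup>2(\<mu> \<otimes> \<nu>)\<close>, where \<open>Y\<close> is multiplication
  by \<open>y\<close> and \<open>X\<close> is integration over \<open>y\<close> followed by multiplication by \<open>x\<close>.  In this picture
  \<open>(z - X - Y) \<psi> = g h\<close> reads \<open>(z - y) \<psi>(x, y) = g(x) h(y) + x c(x)\<close> with \<open>c(x) = \<integral> \<psi>(x, y) d\<nu>(y)\<close>.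
  Dividing by \<open>z - y\<close> and integrating gives \<open>c = H g / (1 - G x)\<close>, where
  \<open>H = \<langle>\<Omega>, (z - Y)\<^sup>-\<^sup>1 h(Y) \<Omega>\<rangle>\<close>, and so
  \<open>\<psi> = (z - Y)\<^sup>-\<^sup>1 (h(Y) + H k(X)) g(X) \<Omega>\<close> with \<open>k x = x / (1 - G x)\<close>.  Since \<open>G\<close> is not real, \<open>k\<close>
  is bounded and continuous, and the rule above, with \<open>x / (\<i> - x)\<close> in the role of \<open>f\<close>, shows
  that this \<open>\<psi>\<close> is a solution in the given Hilbert space (\<open>resolvent_vector_in_sum\<close>).  Therefore
  \<open>z - X - Y\<close> has dense range for every nonreal \<open>z\<close>, and the densely defined symmetric operator
  \<open>X + Y\<close> is essentially self-adjoint.  For \<open>g = h = 1\<close> the vector \<open>\<psi>\<close> is the resolvent of the closure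
  applied to \<open>\<Omega>\<close>.  As \<open>k 0 = 0\<close>, monotone independence factorizes
  \<open>\<langle>\<Omega>, (z - Y)\<^sup>-\<^sup>1 k(X) \<Omega>\<rangle>\<close> too, and \<open>\<langle>\<Omega>, \<psi>\<rangle> = G + G\<^sup>2 \<integral> k d\<mu> = \<integral> 1 / (1 / G - x) d\<mu>(x)\<close> is the
  equation \<open>F = F\<^sub>\<mu> \<circ> F\<^sub>\<nu>\<close> that defines the monotone convolution.

  All of this speaks about functions of unbounded operators, so the larger part of the text proves
  the spectral theorem.  A complex measure is treated as a functional on the bounded Borel functions
  that is continuous under bounded pointwise convergence; by Stieltjes inversion it is determined by
  its values on the Cauchy kernels \<open>1 / (z - t)\<close> (\<open>determining_Cauchy_kernels\<close>).  A self-adjoint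
  operator has bounded resolvents, and for every vector \<open>x\<close> there is a measure whose Cauchy transform
  is \<open>\<langle>x, (z - T)\<^sup>-\<^sup>1 x\<rangle>\<close>: the weak limit of Fejer densities for the powers of the Cayley transform,
  carried from the circle to the line (\<open>Herglotz_isometry\<close>, \<open>spectral_distribution_unit\<close>).
  Uniqueness makes these measures depend on \<open>x\<close> as a quadratic form, and polarization and the
  Riesz representation theorem turn them into a multiplicative functional calculus (locale
  \<open>operator_calculus\<close>).  The same locale applied to an arbitrary spectral measure of \<open>T\<close> shows that
  it has the same resolvents, so that functional calculus and distribution are well defined
  (\<open>fun_calc_eq_opr\<close>, \<open>distribution_eq\<close>).
\<close>

section \<open>Geometry of a complex Hilbert space\<close>

lemma cinner_add_left: "cinner (x + y) z = cinner x z + cinner y z"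
  by (metis cinner_commute cinner_add_right complex_cnj_add)

lemma cinner_scaleC_left: "cinner (c *\<^sub>C x) y = cnj c * cinner x y"
  by (metis cinner_commute cinner_scaleC_right complex_cnj_mult)

lemma scaleC_one [simp]: "1 *\<^sub>C x = x"
  using scaleC_of_real[of 1 x] by simp

lemma scaleC_zero_left [simp]: "0 *\<^sub>C x = 0"
  using scaleC_of_real[of 0 x] by simp

lemma scaleC_minus1: "(-1) *\<^sub>C x = - x"
  using scaleC_of_real[of "-1" x] by simp

lemma scaleC_minus_left: "(- c) *\<^sub>C x = - (c *\<^sub>C x)"
  using scaleC_scaleC[of "-1" c x] by (simp add: scaleC_minus1)

lemma scaleC_minus_right: "c *\<^sub>C (- x) = - (c *\<^sub>C x)"
  using scaleC_scaleC[of c "-1" x] by (simp add: scaleC_minus1 scaleC_minus_left)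

lemma scaleC_zero_right [simp]: "c *\<^sub>C 0 = 0"
  using scaleC_add_right[of c 0 0] by simp

lemma scaleC_diff_right: "c *\<^sub>C (x - y) = c *\<^sub>C x - c *\<^sub>C y"
  using scaleC_add_right[of c x "- y"] by (simp add: scaleC_minus_right)

lemma scaleC_diff_left: "(c - d) *\<^sub>C x = c *\<^sub>C x - d *\<^sub>C x"
  using scaleC_add_left[of c "- d" x] by (simp add: scaleC_minus_left)

lemma cinner_zero_right [simp]: "cinner x 0 = 0"
  using cinner_scaleC_right[of x 0 0] by simp

lemma cinner_zero_left [simp]: "cinner 0 x = 0"
  using cinner_scaleC_left[of 0 0 x] by simp

lemma cinner_minus_right: "cinner x (- y) = - cinner x y"
  using cinner_scaleC_right[of x "-1" y] by (simp add: scaleC_minus1)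

lemma cinner_minus_left: "cinner (- x) y = - cinner x y"
  using cinner_scaleC_left[of "-1" x y] by (simp add: scaleC_minus1)

lemma cinner_diff_right: "cinner x (y - z) = cinner x y - cinner x z"
  using cinner_add_right[of x y "- z"] by (simp add: cinner_minus_right)

lemma cinner_diff_left: "cinner (x - y) z = cinner x z - cinner y z"
  using cinner_add_left[of x "- y" z] by (simp add: cinner_minus_left)

lemmas cinner_simps = cinner_add_left cinner_add_right cinner_diff_left cinner_diff_right
  cinner_scaleC_left cinner_scaleC_right cinner_minus_left cinner_minus_right

lemmas scaleC_simps = scaleC_add_left scaleC_add_right scaleC_diff_left scaleC_diff_right
  scaleC_scaleC scaleC_minus_left scaleC_minus_right

lemma cinner_self_eq_zero: "cinner x x = 0 \<longleftrightarrow> x = 0"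
  by (simp add: cinner_self)

lemma cinner_sum_right: "cinner x (\<Sum>i\<in>A. f i) = (\<Sum>i\<in>A. cinner x (f i))"
  by (induction A rule: infinite_finite_induct) (auto simp: cinner_add_right)

lemma cinner_sum_left: "cinner (\<Sum>i\<in>A. f i) x = (\<Sum>i\<in>A. cinner (f i) x)"
  by (induction A rule: infinite_finite_induct) (auto simp: cinner_add_left)

lemma norm_sq_cinner: "(norm x)\<^sup>2 = Re (cinner x x)"
  by (simp add: cinner_self)

lemma norm_eq_if_cinner_eq: "cinner u u = cinner v v \<Longrightarrow> norm u = norm v"
  using norm_sq_cinner[of u] norm_sq_cinner[of v] by (metis norm_ge_zero power2_eq_iff_nonneg)

lemma norm_scaleC: "norm (c *\<^sub>C x) = cmod c * norm x"
proof -
  have "complex_of_real ((norm (c *\<^sub>C x))\<^sup>2) = cnj c * (c * complex_of_real ((norm x)\<^sup>2))"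
    by (simp add: cinner_self[symmetric] cinner_scaleC_left cinner_scaleC_right mult.assoc del: of_real_power)
  also have "\<dots> = complex_of_real ((cmod c * norm x)\<^sup>2)"
    using complex_norm_square[of c] by (simp add: power_mult_distrib mult_ac)
  finally have "(norm (c *\<^sub>C x))\<^sup>2 = (cmod c * norm x)\<^sup>2"
    using of_real_eq_iff by blast
  then show ?thesis by (simp add: power2_eq_iff_nonneg)
qed

lemma norm_diff_sq: "(norm (x - y))\<^sup>2 = (norm x)\<^sup>2 + (norm y)\<^sup>2 - 2 * Re (cinner x y)"
  unfolding norm_sq_cinner cinner_simps using cinner_commute[of y x] by simp

lemma norm_add_sq: "(norm (x + y))\<^sup>2 = (norm x)\<^sup>2 + (norm y)\<^sup>2 + 2 * Re (cinner x y)"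
  unfolding norm_sq_cinner cinner_simps using cinner_commute[of y x] by simp

lemma Cauchy_Schwarz: "cmod (cinner x y) \<le> norm x * norm y"
proof (cases "y = 0")
  case False
  define c where "c = cinner y x / complex_of_real ((norm y)\<^sup>2)"
  have n: "norm y > 0" using False by simp
  have "Re (cinner x (c *\<^sub>C y)) = (cmod (cinner x y))\<^sup>2 / (norm y)\<^sup>2"
  proof -
    have "cinner x (c *\<^sub>C y) = complex_of_real ((cmod (cinner x y))\<^sup>2 / (norm y)\<^sup>2)"
      using complex_norm_square[of "cinner x y"] cinner_commute[of y x]
      by (simp add: c_def cinner_scaleC_right mult_ac)
    then show ?thesis by (metis Re_complex_of_real)
  qed
  moreover have "(norm (c *\<^sub>C y))\<^sup>2 = (cmod (cinner x y))\<^sup>2 / (norm y)\<^sup>2"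
  proof -
    have "cmod (cinner y x) = cmod (cinner x y)"
      by (metis cinner_commute complex_mod_cnj)
    then show ?thesis using n
      by (simp add: norm_scaleC c_def norm_divide power_divide power_mult_distrib power2_eq_square norm_mult)
  qed
  ultimately have "0 \<le> (norm x)\<^sup>2 - (cmod (cinner x y))\<^sup>2 / (norm y)\<^sup>2"
    using norm_diff_sq[of x "c *\<^sub>C y"] zero_le_power2[of "norm (x - c *\<^sub>C y)"] by linarith
  then have "(cmod (cinner x y))\<^sup>2 \<le> (norm x * norm y)\<^sup>2"
    using n by (simp add: field_simps power_mult_distrib)
  then show ?thesis by (rule power2_le_imp_le) simp
qed simp

lemma bounded_bilinear_cinner: "bounded_bilinear (cinner :: 'a::complex_hilbert_space \<Rightarrow> 'a \<Rightarrow> complex)"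
proof
  fix a a' b b' :: 'a and r :: real
  show "cinner (a + a') b = cinner a b + cinner a' b" by (rule cinner_add_left)
  show "cinner a (b + b') = cinner a b + cinner a b'" by (rule cinner_add_right)
  show "cinner (r *\<^sub>R a) b = r *\<^sub>R cinner a b"
    by (simp add: scaleC_of_real[symmetric] cinner_scaleC_left scaleR_conv_of_real)
  show "cinner a (r *\<^sub>R b) = r *\<^sub>R cinner a b"
    by (simp add: scaleC_of_real[symmetric] cinner_scaleC_right scaleR_conv_of_real)
  show "\<exists>K. \<forall>a b. norm (cinner a b) \<le> norm a * norm b * K"
    by (rule exI[of _ 1]) (simp add: Cauchy_Schwarz)
qed

lemma bounded_bilinear_scaleC: "bounded_bilinear (scaleC :: complex \<Rightarrow> 'a \<Rightarrow> 'a::complex_hilbert_space)"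
proof
  fix a a' :: complex and b b' :: 'a and r :: real
  show "(a + a') *\<^sub>C b = a *\<^sub>C b + a' *\<^sub>C b" by (rule scaleC_add_left)
  show "a *\<^sub>C (b + b') = a *\<^sub>C b + a *\<^sub>C b'" by (rule scaleC_add_right)
  show "(r *\<^sub>R a) *\<^sub>C b = r *\<^sub>R (a *\<^sub>C b)"
    by (simp add: scaleC_of_real[symmetric] scaleC_scaleC scaleR_conv_of_real)
  show "a *\<^sub>C (r *\<^sub>R b) = r *\<^sub>R (a *\<^sub>C b)"
    by (simp add: scaleC_of_real[symmetric] scaleC_scaleC mult.commute)
  show "\<exists>K. \<forall>a b. norm (a *\<^sub>C (b::'a)) \<le> norm a * norm b * K"
    by (rule exI[of _ 1]) (simp add: norm_scaleC)
qed

lemmas tendsto_cinner = bounded_bilinear.tendsto[OF bounded_bilinear_cinner]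
lemmas tendsto_scaleC = bounded_bilinear.tendsto[OF bounded_bilinear_scaleC]

lemma bounded_clinearD:
  assumes "bounded_clinear T"
  shows "T (x + y) = T x + T y" "T (c *\<^sub>C x) = c *\<^sub>C T x" "T 0 = 0" "T (x - y) = T x - T y"
    "T (- x) = - T x"
  using assms bounded_linear.linear[of T]
  by (auto simp: bounded_clinear_def linear_add linear_0 linear_diff linear_neg)

lemma bounded_clinearI:
  assumes "\<And>x y. T (x + y) = T x + T y" and "\<And>c x. T (c *\<^sub>C x) = c *\<^sub>C T x"
    and "\<And>x. norm (T x) \<le> norm x * B"
  shows "bounded_clinear T"
  unfolding bounded_clinear_def
  by (auto intro!: bounded_linear_intro[of T B] simp: assms scaleC_of_real[symmetric])

lemma bounded_clinear_tendsto:
  "bounded_clinear T \<Longrightarrow> (f \<longlongrightarrow> l) F \<Longrightarrow> ((\<lambda>x. T (f x)) \<longlongrightarrow> T l) F"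
  unfolding bounded_clinear_def using bounded_linear.tendsto by blast

lemma bounded_clinear_add:
  "bounded_clinear S \<Longrightarrow> bounded_clinear T \<Longrightarrow> bounded_clinear (\<lambda>x. S x + T x)"
  unfolding bounded_clinear_def by (auto simp: scaleC_add_right bounded_linear_add)

lemma bounded_clinear_scaleC:
  "bounded_clinear T \<Longrightarrow> bounded_clinear (\<lambda>x. c *\<^sub>C T x)"
  unfolding bounded_clinear_def
  by (auto simp: scaleC_scaleC mult.commute
      intro: bounded_linear_compose[OF bounded_bilinear.bounded_linear_right[OF bounded_bilinear_scaleC]])

lemma bounded_clinear_compose:
  "bounded_clinear S \<Longrightarrow> bounded_clinear T \<Longrightarrow> bounded_clinear (\<lambda>x. S (T x))"
  unfolding bounded_clinear_def by (auto intro: bounded_linear_compose)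

lemma bounded_clinear_id: "bounded_clinear (\<lambda>x. x)"
  by (rule bounded_clinearI[where B = 1]) auto

lemma cinner_ext: "(\<And>v. cinner v x = cinner v y) \<Longrightarrow> x = y"
  using cinner_self_eq_zero[of "x - y"] by (simp add: cinner_diff_right)


subsection \<open>Polarization\<close>

text \<open>Recovers \<open>\<langle>x, T y\<rangle>\<close> from the quadratic form \<open>q x = \<langle>x, T x\<rangle>\<close>; with this order of the
  arguments the powers of \<open>\<i>\<close> in front of \<open>q\<close> are conjugated.\<close>

definition polar :: "('a::complex_hilbert_space \<Rightarrow> complex) \<Rightarrow> 'a \<Rightarrow> 'a \<Rightarrow> complex" where
  "polar q x y = (q (x + y) - q (x - y) - \<i> * q (x + \<i> *\<^sub>C y) + \<i> * q (x - \<i> *\<^sub>C y)) / 4"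

lemma polar_bounded_clinear:
  assumes "bounded_clinear T"
  shows "polar (\<lambda>x. cinner x (T x)) x y = cinner x (T y)"
  unfolding polar_def
  by (simp add: bounded_clinearD[OF assms] cinner_simps algebra_simps)

locale sesquilinear =
  fixes b :: "'a::complex_hilbert_space \<Rightarrow> 'a \<Rightarrow> complex"
  assumes add_left: "b (x + y) z = b x z + b y z"
    and add_right: "b x (y + z) = b x y + b x z"
    and scale_left: "b (c *\<^sub>C x) y = cnj c * b x y"
    and scale_right: "b x (c *\<^sub>C y) = c * b x y"
begin

text \<open>The diagonal at \<open>x + y\<close> gives \<open>b x y + b y x = 0\<close>, and at \<open>x + \<i> y\<close> it gives
  \<open>b x y = b y x\<close>.\<close>

lemma zero_if_diagonal_zero:
  assumes "\<And>x. b x x = 0"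
  shows "b x y = 0"
proof -
  have "b x y + b y x = 0"
    using assms[of "x + y"] assms[of x] assms[of y] by (simp add: add_left add_right add.commute)
  moreover have "\<i> * b x y - \<i> * b y x = 0"
    using assms[of "x + \<i> *\<^sub>C y"] assms[of x] assms[of y]
    by (simp add: add_left add_right scale_left scale_right)
  then have "b x y = b y x" by simp
  ultimately show ?thesis by simp
qed

end


subsection \<open>The Riesz representation theorem\<close>

lemma parallelogram: "(norm (x + y))\<^sup>2 + (norm (x - y))\<^sup>2 = 2 * (norm x)\<^sup>2 + 2 * (norm (y::'a::complex_hilbert_space))\<^sup>2"
  using norm_add_sq[of x y] norm_diff_sq[of x y] by simp

definition complex_subspace :: "'a::complex_hilbert_space set \<Rightarrow> bool" where
  "complex_subspace S \<longleftrightarrow> 0 \<in> S \<and> (\<forall>x\<in>S. \<forall>y\<in>S. x + y \<in> S) \<and> (\<forall>c. \<forall>x\<in>S. c *\<^sub>C x \<in> S)"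

text \<open>Otherwise adding the component of \<open>x - p\<close> along \<open>s\<close>, whose coefficient is \<open>c\<close>, would move \<open>p\<close>
  closer to \<open>x\<close>.\<close>

lemma nearest_point_orthogonal:
  assumes S: "complex_subspace S" and p: "p \<in> S" and min: "\<And>s. s \<in> S \<Longrightarrow> norm (x - p) \<le> norm (x - s)"
    and s: "s \<in> S"
  shows "cinner s (x - p) = 0"
proof (cases "s = 0")
  case False
  define c where "c = cinner s (x - p) / complex_of_real ((norm s)\<^sup>2)"
  have n: "(norm s)\<^sup>2 > 0" using False by simp
  have "p + c *\<^sub>C s \<in> S" using S p s by (auto simp: complex_subspace_def)
  then have "(norm (x - p))\<^sup>2 \<le> (norm ((x - p) - c *\<^sub>C s))\<^sup>2"
    using min[of "p + c *\<^sub>C s"] by (simp add: diff_diff_eq)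
  moreover have "Re (cinner (x - p) (c *\<^sub>C s)) = (cmod (cinner s (x - p)))\<^sup>2 / (norm s)\<^sup>2"
  proof -
    have "cinner (x - p) (c *\<^sub>C s) = complex_of_real ((cmod (cinner s (x - p)))\<^sup>2 / (norm s)\<^sup>2)"
      unfolding c_def cinner_scaleC_right
      using complex_norm_square[of "cinner s (x - p)"] cinner_commute[of "x - p" s]
      by (simp add: mult_ac)
    then show ?thesis by (metis Re_complex_of_real)
  qed
  moreover have "(norm (c *\<^sub>C s))\<^sup>2 = (cmod (cinner s (x - p)))\<^sup>2 / (norm s)\<^sup>2"
    using n by (simp add: norm_scaleC c_def norm_divide power_divide power_mult_distrib norm_mult power2_eq_square)
  ultimately have "(cmod (cinner s (x - p)))\<^sup>2 / (norm s)\<^sup>2 \<le> 0"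
    using norm_diff_sq[of "x - p" "c *\<^sub>C s"] by linarith
  then have "(cmod (cinner s (x - p)))\<^sup>2 \<le> 0"
    using n by (simp add: divide_le_0_iff)
  then show ?thesis by simp
qed simp

text \<open>A sequence in \<open>S\<close> that minimizes the distance to \<open>x\<close> is Cauchy: by the parallelogram law two
  nearly optimal points that are far apart would have a midpoint closer to \<open>x\<close> than the infimum.
  Its limit is a nearest point.\<close>

lemma orthogonal_decomposition:
  fixes S :: "'a::complex_hilbert_space set"
  assumes S: "complex_subspace S" and "closed S"
  shows "\<exists>p\<in>S. \<forall>s\<in>S. cinner s (x - p) = 0"
proof -
  define d where "d = infdist x S"
  have ne: "S \<noteq> {}" using S by (auto simp: complex_subspace_def)
  have d0: "d \<ge> 0" by (simp add: d_def infdist_nonneg)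
  have dle: "d \<le> norm (x - s)" if "s \<in> S" for s
    using infdist_le[OF that, of x] by (simp add: d_def dist_norm)
  have "\<exists>s\<in>S. norm (x - s) < d + 1 / Suc n" for n
  proof -
    have "infdist x S < d + 1 / Suc n" by (simp add: d_def)
    moreover have "infdist x S \<ge> d + 1 / Suc n" if "\<forall>s\<in>S. norm (x - s) \<ge> d + 1 / Suc n"
      using ne that by (auto simp: infdist_def dist_norm intro!: cINF_greatest)
    ultimately show ?thesis by force
  qed
  then obtain f where f: "\<And>n. f n \<in> S" "\<And>n. norm (x - f n) < d + 1 / Suc n"
    by metis
  have nf: "(\<lambda>n. norm (x - f n)) \<longlonglongrightarrow> d"
  proof (rule tendsto_sandwich)
    show "\<forall>\<^sub>F n in sequentially. d \<le> norm (x - f n)" using dle f by auto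
    show "\<forall>\<^sub>F n in sequentially. norm (x - f n) \<le> d + 1 / Suc n"
      using f(2) by (auto intro!: always_eventually less_imp_le)
    show "(\<lambda>n. d + 1 / Suc n) \<longlonglongrightarrow> d"
      using tendsto_add[OF tendsto_const LIMSEQ_inverse_real_of_nat] by (simp add: inverse_eq_divide)
  qed simp
  have key: "(norm (f m - f n))\<^sup>2 \<le> 2 * (norm (x - f m))\<^sup>2 + 2 * (norm (x - f n))\<^sup>2 - 4 * d\<^sup>2" for m n
  proof -
    have "(1/2) *\<^sub>C (f m + f n) \<in> S" using S f by (auto simp: complex_subspace_def)
    then have "d \<le> norm (x - (1/2) *\<^sub>C (f m + f n))" by (rule dle)
    then have "d\<^sup>2 \<le> (norm (x - (1/2) *\<^sub>C (f m + f n)))\<^sup>2" using d0 by (simp add: power_mono)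
    moreover have "(x - f m) + (x - f n) = 2 *\<^sub>C (x - (1/2) *\<^sub>C (f m + f n))"
      using scaleC_add_left[of 1 1 x] by (simp add: scaleC_simps algebra_simps)
    then have "norm ((x - f m) + (x - f n)) = 2 * norm (x - (1/2) *\<^sub>C (f m + f n))"
      by (simp add: norm_scaleC)
    then have "(norm ((x - f m) + (x - f n)))\<^sup>2 = 4 * (norm (x - (1/2) *\<^sub>C (f m + f n)))\<^sup>2"
      by (simp add: power_mult_distrib)
    moreover have "norm ((x - f m) - (x - f n)) = norm (f m - f n)"
      by (simp add: norm_minus_commute)
    ultimately show ?thesis using parallelogram[of "x - f m" "x - f n"] by simp
  qed
  have "Cauchy f"
  proof (rule metric_CauchyI)
    fix e :: real assume e: "e > 0"
    have "(\<lambda>n. (norm (x - f n))\<^sup>2) \<longlonglongrightarrow> d\<^sup>2" using nf by (rule tendsto_power)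
    then have "\<forall>\<^sub>F n in sequentially. (norm (x - f n))\<^sup>2 < d\<^sup>2 + e\<^sup>2/4"
      using e by (auto intro: order_tendstoD)
    then obtain N where N: "\<And>n. n \<ge> N \<Longrightarrow> (norm (x - f n))\<^sup>2 < d\<^sup>2 + e\<^sup>2/4"
      by (auto simp: eventually_sequentially)
    show "\<exists>M. \<forall>m\<ge>M. \<forall>n\<ge>M. dist (f m) (f n) < e"
    proof (intro exI[of _ N] allI impI)
      fix m n assume "m \<ge> N" "n \<ge> N"
      then have "(norm (f m - f n))\<^sup>2 < e\<^sup>2" using key[of m n] N[of m] N[of n] by linarith
      then show "dist (f m) (f n) < e" using e by (simp add: dist_norm power_less_imp_less_base)
    qed
  qed
  then obtain p where p: "f \<longlonglongrightarrow> p" using Cauchy_convergent_iff convergent_def by blast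
  have pS: "p \<in> S" using \<open>closed S\<close> f(1) p closed_sequentially by blast
  have "(\<lambda>n. norm (x - f n)) \<longlonglongrightarrow> norm (x - p)" by (intro tendsto_intros p)
  then have "norm (x - p) = d" using nf LIMSEQ_unique by blast
  then show ?thesis using nearest_point_orthogonal[OF S pS] dle pS by metis
qed

lemma closure_complex_subspace:
  fixes S :: "'a::complex_hilbert_space set"
  assumes "complex_subspace S"
  shows "complex_subspace (closure S)"
  unfolding complex_subspace_def
proof (intro conjI ballI allI)
  show "0 \<in> closure S" using assms closure_subset by (auto simp: complex_subspace_def)
next
  fix x y assume "x \<in> closure S" "y \<in> closure S"
  then obtain f g where "\<And>n::nat. f n \<in> S" "f \<longlonglongrightarrow> x" "\<And>n::nat. g n \<in> S" "g \<longlonglongrightarrow> y"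
    by (metis closure_sequential)
  then show "x + y \<in> closure S"
    using assms unfolding closure_sequential complex_subspace_def
    by (intro exI[of _ "\<lambda>n. f n + g n"]) (auto intro: tendsto_add)
next
  fix c x assume "x \<in> closure S"
  then obtain f where "\<And>n::nat. f n \<in> S" "f \<longlonglongrightarrow> x"
    by (metis closure_sequential)
  then show "c *\<^sub>C x \<in> closure S"
    using assms unfolding closure_sequential complex_subspace_def
    by (intro exI[of _ "\<lambda>n. c *\<^sub>C f n"]) (auto intro: tendsto_scaleC)
qed

lemma dense_if_orthogonal_trivial:
  fixes S :: "'a::complex_hilbert_space set"
  assumes S: "complex_subspace S" and "\<And>v. (\<And>s. s \<in> S \<Longrightarrow> cinner s v = 0) \<Longrightarrow> v = 0"
  shows "closure S = UNIV"
proof -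
  have "x \<in> closure S" for x
  proof -
    obtain p where p: "p \<in> closure S" "\<forall>s\<in>closure S. cinner s (x - p) = 0"
      using orthogonal_decomposition[OF closure_complex_subspace[OF S]] by auto
    then have "x - p = 0" using assms(2) closure_subset by blast
    then show ?thesis using p by simp
  qed
  then show ?thesis by auto
qed

lemma orthogonal_dense_zero:
  assumes "closure S = UNIV" and "\<And>s. s \<in> S \<Longrightarrow> cinner s v = 0"
  shows "v = 0"
proof -
  have "v \<in> closure S" using assms by simp
  then obtain f where f: "\<And>n::nat. f n \<in> S" "f \<longlonglongrightarrow> v" by (metis closure_sequential)
  have "(\<lambda>n. cinner (f n) v) \<longlonglongrightarrow> cinner v v" by (intro tendsto_cinner f tendsto_const)
  then have "cinner v v = 0" using assms(2) f(1) LIMSEQ_unique[of "\<lambda>n. 0" 0] by simp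
  then show ?thesis by (simp add: cinner_self_eq_zero)
qed

text \<open>The orthogonal complement of the kernel of a nonzero functional \<open>\<phi>\<close> is spanned by one vector \<open>u\<close>,
  and the representing vector is the multiple of \<open>u\<close> that has the right value at \<open>u\<close>.\<close>

lemma riesz_representation:
  fixes \<phi> :: "'a::complex_hilbert_space \<Rightarrow> complex"
  assumes add: "\<And>x y. \<phi> (x + y) = \<phi> x + \<phi> y" and scale: "\<And>c x. \<phi> (c *\<^sub>C x) = c * \<phi> x"
    and bound: "\<And>x. cmod (\<phi> x) \<le> B * norm x"
  shows "\<exists>v. \<forall>x. \<phi> x = cinner v x"
proof (cases "\<forall>x. \<phi> x = 0")
  case True
  then show ?thesis by (intro exI[of _ 0]) simp
next
  case False
  then obtain x where x: "\<phi> x \<noteq> 0" by auto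
  have bl: "bounded_linear \<phi>"
    by (rule bounded_linear_intro[of _ B])
      (use add scale bound in \<open>auto simp: scaleC_of_real[symmetric] scaleR_conv_of_real mult.commute\<close>)
  define S where "S = {x. \<phi> x = 0}"
  have "closed S" unfolding S_def
    by (intro closed_Collect_eq continuous_on_const linear_continuous_on bl)
  moreover have S: "complex_subspace S"
    unfolding complex_subspace_def S_def using add scale linear_0[OF bounded_linear.linear[OF bl]] by simp
  ultimately obtain p where p: "p \<in> S" "\<And>s. s \<in> S \<Longrightarrow> cinner s (x - p) = 0"
    using orthogonal_decomposition by metis
  define u where "u = x - p"
  have pu: "\<phi> u \<noteq> 0"
    using p(1) x linear_diff[OF bounded_linear.linear[OF bl]] by (auto simp: u_def S_def)
  then have u0: "u \<noteq> 0" using linear_0[OF bounded_linear.linear[OF bl]] by auto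
  have orth: "cinner u s = 0" if "s \<in> S" for s
    using p(2)[OF that] cinner_commute[of u s] by (simp add: u_def)
  define v where "v = (cnj (\<phi> u) / complex_of_real ((norm u)\<^sup>2)) *\<^sub>C u"
  have "\<phi> y = cinner v y" for y
  proof -
    have "\<phi> (y - (\<phi> y / \<phi> u) *\<^sub>C u) = 0"
      using pu by (simp add: linear_diff[OF bounded_linear.linear[OF bl]] scale)
    then have "cinner u (y - (\<phi> y / \<phi> u) *\<^sub>C u) = 0" by (intro orth) (simp add: S_def)
    then have "cinner u y = \<phi> y / \<phi> u * complex_of_real ((norm u)\<^sup>2)"
      by (simp add: cinner_simps cinner_self)
    then show ?thesis using pu u0 by (simp add: v_def cinner_scaleC_left)
  qed
  then show ?thesis by blast
qed

lemma (in sesquilinear) bounded_operator: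
  assumes bound: "\<And>x y. norm x = 1 \<Longrightarrow> norm y = 1 \<Longrightarrow> cmod (b x y) \<le> C"
  shows "\<exists>T. bounded_clinear T \<and> (\<forall>x y. b x y = cinner x (T y))"
proof -
  have z: "b 0 y = 0" "b x 0 = 0" for x y
    using scale_left[of 0 0 y] scale_right[of x 0 0] by auto
  have bd: "cmod (b x y) \<le> C * norm x * norm y" for x y
  proof (cases "x = 0 \<or> y = 0")
    case False
    define x' where "x' = complex_of_real (1 / norm x) *\<^sub>C x"
    define y' where "y' = complex_of_real (1 / norm y) *\<^sub>C y"
    have n: "norm x' = 1" "norm y' = 1" using False by (auto simp: x'_def y'_def norm_scaleC norm_divide)
    have "x = complex_of_real (norm x) *\<^sub>C x'" "y = complex_of_real (norm y) *\<^sub>C y'"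
      using False by (auto simp: x'_def y'_def scaleC_scaleC)
    then have "b x y = complex_of_real (norm x) * (complex_of_real (norm y) * b x' y')"
      by (metis scale_left scale_right complex_cnj_complex_of_real)
    then have "cmod (b x y) = norm x * norm y * cmod (b x' y')" by (simp add: norm_mult)
    also have "\<dots> \<le> norm x * norm y * C" by (intro mult_left_mono bound n) simp
    finally show ?thesis by (simp add: mult_ac)
  qed (auto simp: z)
  have "\<exists>v. \<forall>x. cnj (b x y) = cinner v x" for y
    by (rule riesz_representation[where B = "C * norm y"])
      (use bd[of _ y] in \<open>auto simp: add_left scale_left mult_ac\<close>)
  then obtain T where T: "\<And>x y. cnj (b x y) = cinner (T y) x" by metis
  have T: "b x y = cinner x (T y)" for x y
    using T[of x y] cinner_commute[of x "T y"] by (metis complex_cnj_cnj)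
  have "bounded_clinear T"
  proof (rule bounded_clinearI[where B = C])
    show "T (x + y) = T x + T y" for x y
      by (rule cinner_ext) (simp add: cinner_add_right T[symmetric] add_right)
    show "T (c *\<^sub>C x) = c *\<^sub>C T x" for c x
      by (rule cinner_ext) (simp add: cinner_scaleC_right T[symmetric] scale_right)
    show "norm (T y) \<le> norm y * C" for y
    proof (cases "T y = 0")
      case True
      have "0 \<le> C * norm y * norm y" using bd[of y y] norm_ge_zero order_trans by blast
      then show ?thesis using True 
        by (cases "norm y = 0") (auto simp: zero_le_mult_iff mult_less_0_iff)
    next
      case False
      have "(norm (T y))\<^sup>2 = cmod (b (T y) y)"
        by (simp add: T cinner_self norm_power)
      also have "\<dots> \<le> C * norm (T y) * norm y" by (rule bd)
      finally show ?thesis using False by (simp add: power2_eq_square mult_ac)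
    qed
  qed
  then show ?thesis using T by blast
qed


section \<open>Complex measures as functionals on bounded Borel functions\<close>

definition bounded_borel :: "(real \<Rightarrow> complex) \<Rightarrow> bool" where
  "bounded_borel h \<longleftrightarrow> h \<in> borel_measurable borel \<and> bounded (range h)"

lemma bounded_borelI:
  "h \<in> borel_measurable borel \<Longrightarrow> (\<And>t. cmod (h t) \<le> C) \<Longrightarrow> bounded_borel h"
  unfolding bounded_borel_def bounded_iff by auto

lemma bounded_borel_measurable [measurable_dest]: "bounded_borel h \<Longrightarrow> h \<in> borel_measurable borel"
  by (simp add: bounded_borel_def)

lemma bounded_borelE:
  assumes "bounded_borel h" obtains C where "C \<ge> 0" "\<And>t. cmod (h t) \<le> C"
proof -
  obtain C where "\<And>t. cmod (h t) \<le> C" using assms unfolding bounded_borel_def bounded_iff by auto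
  then show ?thesis using that[of C] norm_ge_zero order_trans by blast
qed

lemma bounded_borel_const: "bounded_borel (\<lambda>t. c)"
  by (rule bounded_borelI[of _ "cmod c"]) auto

lemma bounded_borel_add:
  assumes "bounded_borel f" "bounded_borel g" shows "bounded_borel (\<lambda>t. f t + g t)"
proof -
  obtain C D where "\<And>t. cmod (f t) \<le> C" "\<And>t. cmod (g t) \<le> D"
    using assms by (metis bounded_borelE)
  moreover note [measurable] = assms
  ultimately show ?thesis
    by (intro bounded_borelI[of _ "C + D"]) (auto intro: norm_triangle_mono)
qed

lemma bounded_borel_mult:
  assumes "bounded_borel f" "bounded_borel g" shows "bounded_borel (\<lambda>t. f t * g t)"
proof -
  obtain C D where "C \<ge> 0" "\<And>t. cmod (f t) \<le> C" "\<And>t. cmod (g t) \<le> D"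
    using assms by (metis bounded_borelE)
  moreover note [measurable] = assms
  ultimately show ?thesis
    by (intro bounded_borelI[of _ "C * D"]) (auto simp: norm_mult intro!: mult_mono)
qed

lemma bounded_borel_scale: "bounded_borel f \<Longrightarrow> bounded_borel (\<lambda>t. c * f t)"
  by (intro bounded_borel_mult bounded_borel_const)

lemma bounded_borel_diff:
  "bounded_borel f \<Longrightarrow> bounded_borel g \<Longrightarrow> bounded_borel (\<lambda>t. f t - g t)"
  using bounded_borel_add[of f "\<lambda>t. (-1) * g t"] bounded_borel_scale[of g "-1"] by simp

lemma bounded_borel_cnj: "bounded_borel f \<Longrightarrow> bounded_borel (\<lambda>t. cnj (f t))"
  unfolding bounded_borel_def bounded_iff
  by (auto intro: borel_measurable_continuous_on[OF continuous_on_cnj[OF continuous_on_id]])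

lemma bounded_borel_indicator: "A \<in> sets borel \<Longrightarrow> bounded_borel (indicator A)"
  by (rule bounded_borelI[of _ 1]) (auto simp: indicator_def)

lemma bounded_borel_sum:
  "(\<And>i. i \<in> I \<Longrightarrow> bounded_borel (f i)) \<Longrightarrow> bounded_borel (\<lambda>t. \<Sum>i\<in>I. f i t)"
  by (induction I rule: infinite_finite_induct)
    (auto intro: bounded_borel_add bounded_borel_const)

lemma bounded_borel_bcontfun: "h \<in> bcontfun \<Longrightarrow> bounded_borel h"
  unfolding bounded_borel_def bcontfun_def by (auto intro: borel_measurable_continuous_onI)

text \<open>The integrals against complex Borel measures, seen as functionals: countable additivity
  becomes continuity under bounded pointwise convergence.  In this form the complex linear
  combinations of measures that polarization produces are simply linear combinations of functionals.\<close>

definition sigma_functional :: "((real \<Rightarrow> complex) \<Rightarrow> complex) \<Rightarrow> bool" where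
  "sigma_functional L \<longleftrightarrow>
     (\<forall>f g. bounded_borel f \<longrightarrow> bounded_borel g \<longrightarrow> L (\<lambda>t. f t + g t) = L f + L g) \<and>
     (\<forall>c f. bounded_borel f \<longrightarrow> L (\<lambda>t. c * f t) = c * L f) \<and>
     (\<forall>F f C. (\<forall>n. F n \<in> borel_measurable borel) \<longrightarrow> (\<forall>n::nat. \<forall>t. cmod (F n t) \<le> C) \<longrightarrow>
        (\<forall>t. (\<lambda>n. F n t) \<longlonglongrightarrow> f t) \<longrightarrow> (\<lambda>n. L (F n)) \<longlonglongrightarrow> L f)"

lemma sigma_functionalD:
  assumes "sigma_functional L"
  shows "bounded_borel f \<Longrightarrow> bounded_borel g \<Longrightarrow> L (\<lambda>t. f t + g t) = L f + L g"
    and "bounded_borel f \<Longrightarrow> L (\<lambda>t. c * f t) = c * L f"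
    and "(\<And>n. F n \<in> borel_measurable borel) \<Longrightarrow> (\<And>n::nat. \<And>t. cmod (F n t) \<le> C) \<Longrightarrow>
      (\<And>t. (\<lambda>n. F n t) \<longlonglongrightarrow> f t) \<Longrightarrow> (\<lambda>n. L (F n)) \<longlonglongrightarrow> L f"
  using assms[unfolded sigma_functional_def, THEN conjunct1, rule_format, of f g]
    assms[unfolded sigma_functional_def, THEN conjunct2, THEN conjunct1, rule_format, of f c]
    assms[unfolded sigma_functional_def, THEN conjunct2, THEN conjunct2, rule_format, of F C f]
  by simp_all

lemma sigma_functional_diff:
  assumes "sigma_functional L" "bounded_borel f" "bounded_borel g"
  shows "L (\<lambda>t. f t - g t) = L f - L g"
  using sigma_functionalD(1)[OF assms(1,2) bounded_borel_scale[OF assms(3), of "-1"]]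
    sigma_functionalD(2)[OF assms(1,3), of "-1"] by simp

lemma sigma_functional_sum:
  assumes L: "sigma_functional L" and "\<And>i. i \<in> I \<Longrightarrow> bounded_borel (f i)"
  shows "L (\<lambda>t. \<Sum>i\<in>I. f i t) = (\<Sum>i\<in>I. L (f i))"
  using assms(2)
proof (induction I rule: infinite_finite_induct)
  case (insert i I)
  then show ?case
    by (simp add: sigma_functionalD(1)[OF L] bounded_borel_sum)
qed (use sigma_functionalD(2)[OF L bounded_borel_const, of 0] in auto)

lemma sigma_functional_integral:
  assumes [measurable_cong]: "sets M = sets borel" and "finite_measure M"
  shows "sigma_functional (\<lambda>h. \<integral>t. h t \<partial>M)"
proof -
  interpret finite_measure M by fact
  have int: "integrable M f" if "bounded_borel f" for f
  proof -
    obtain C where "\<And>t. cmod (f t) \<le> C" using \<open>bounded_borel f\<close> by (metis bounded_borelE)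
    then show ?thesis using that by (intro integrable_const_bound[of _ C]) auto
  qed
  show ?thesis
    unfolding sigma_functional_def
  proof (intro conjI allI impI)
    fix F :: "nat \<Rightarrow> real \<Rightarrow> complex" and f C
    assume meas [measurable]: "\<forall>n. F n \<in> borel_measurable borel"
      and C: "\<forall>n t. cmod (F n t) \<le> C" and lim: "\<forall>t. (\<lambda>n. F n t) \<longlonglongrightarrow> f t"
    have [measurable]: "f \<in> borel_measurable borel"
      by (rule borel_measurable_LIMSEQ_metric[of F]) (use lim meas in auto)
    show "(\<lambda>n. \<integral>t. F n t \<partial>M) \<longlonglongrightarrow> (\<integral>t. f t \<partial>M)"
      by (rule integral_dominated_convergence[where w = "\<lambda>_. C"])
        (use C lim meas in \<open>auto simp: measurable_cong_sets[OF assms(1) refl]\<close>)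
  qed (simp_all add: int)
qed

lemma sigma_functional_add:
  assumes "sigma_functional L" "sigma_functional L'"
  shows "sigma_functional (\<lambda>h. L h + L' h)"
  unfolding sigma_functional_def
proof (intro conjI allI impI)
  fix F :: "nat \<Rightarrow> real \<Rightarrow> complex" and f C
  assume "\<forall>n. F n \<in> borel_measurable borel" "\<forall>n t. cmod (F n t) \<le> C" "\<forall>t. (\<lambda>n. F n t) \<longlonglongrightarrow> f t"
  then show "(\<lambda>n. L (F n) + L' (F n)) \<longlonglongrightarrow> L f + L' f"
    by (intro tendsto_add sigma_functionalD(3)[OF assms(1)] sigma_functionalD(3)[OF assms(2)]) auto
qed (simp_all add: sigma_functionalD(1,2)[OF assms(1)] sigma_functionalD(1,2)[OF assms(2)] algebra_simps)

lemma sigma_functional_scale: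
  assumes "sigma_functional L"
  shows "sigma_functional (\<lambda>h. c * L h)"
  unfolding sigma_functional_def
proof (intro conjI allI impI)
  fix F :: "nat \<Rightarrow> real \<Rightarrow> complex" and f C
  assume "\<forall>n. F n \<in> borel_measurable borel" "\<forall>n t. cmod (F n t) \<le> C" "\<forall>t. (\<lambda>n. F n t) \<longlonglongrightarrow> f t"
  then show "(\<lambda>n. c * L (F n)) \<longlonglongrightarrow> c * L f"
    by (intro tendsto_mult_left sigma_functionalD(3)[OF assms]) auto
qed (simp_all add: sigma_functionalD(1,2)[OF assms] algebra_simps)

lemma sigma_functional_minus:
  assumes "sigma_functional L" "sigma_functional L'"
  shows "sigma_functional (\<lambda>h. L h - L' h)"
  using sigma_functional_add[OF assms(1) sigma_functional_scale[OF assms(2), of "-1"]] by simp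

text \<open>The complex measure with density \<open>g\<close> with respect to that of \<open>L\<close>.\<close>

lemma sigma_functional_times:
  assumes L: "sigma_functional L" and g: "bounded_borel g"
  shows "sigma_functional (\<lambda>h. L (\<lambda>t. h t * g t))"
  unfolding sigma_functional_def
proof (intro conjI allI impI)
  fix f h assume "bounded_borel f" "bounded_borel h"
  then show "L (\<lambda>t. (f t + h t) * g t) = L (\<lambda>t. f t * g t) + L (\<lambda>t. h t * g t)"
    using sigma_functionalD(1)[OF L bounded_borel_mult bounded_borel_mult, of f g h g] g
    by (simp add: algebra_simps)
next
  fix c f assume "bounded_borel f"
  then show "L (\<lambda>t. c * f t * g t) = c * L (\<lambda>t. f t * g t)"
    using sigma_functionalD(2)[OF L bounded_borel_mult, of f g c] g
    by (simp add: algebra_simps)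
next
  fix F :: "nat \<Rightarrow> real \<Rightarrow> complex" and f C
  assume meas: "\<forall>n. F n \<in> borel_measurable borel"
    and C: "\<forall>n t. cmod (F n t) \<le> C" and lim: "\<forall>t. (\<lambda>n. F n t) \<longlonglongrightarrow> f t"
  obtain D where D: "D \<ge> 0" "\<And>t. cmod (g t) \<le> D" using g by (metis bounded_borelE)
  note [measurable] = g
  have C0: "C \<ge> 0" using C norm_ge_zero order_trans by blast
  show "(\<lambda>n. L (\<lambda>t. F n t * g t)) \<longlonglongrightarrow> L (\<lambda>t. f t * g t)"
    by (rule sigma_functionalD(3)[OF L, where C = "C * D"])
      (use C D C0 lim in \<open>auto simp: norm_mult intro!: mult_mono tendsto_mult_right borel_measurable_times meas[rule_format]\<close>)
qed

lemma complex_integral_indicator: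
  assumes "A \<in> sets M"
  shows "(\<integral>t. indicator A t \<partial>M) = complex_of_real (measure M A)"
proof -
  have "(\<integral>t. (indicator A t :: complex) \<partial>M) = (\<integral>t. complex_of_real (indicator A t) \<partial>M)"
    by (intro Bochner_Integration.integral_cong) (auto simp: indicator_def)
  also have "\<dots> = complex_of_real (\<integral>t. indicator A t \<partial>M)" by simp
  finally show ?thesis using assms sets.sets_into_space[OF assms] by (simp add: Int_absorb2)
qed

text \<open>Test functions whose integrals determine a complex measure.\<close>

definition determining :: "(real \<Rightarrow> complex) set \<Rightarrow> bool" where
  "determining S \<longleftrightarrow> (\<forall>f\<in>S. bounded_borel f) \<and>
     (\<forall>L. sigma_functional L \<longrightarrow> (\<forall>f\<in>S. L f = 0) \<longrightarrow> (\<forall>h. bounded_borel h \<longrightarrow> L h = 0))"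

lemma determiningD:
  assumes "determining S" "sigma_functional L" "\<And>f. f \<in> S \<Longrightarrow> L f = 0" "bounded_borel h"
  shows "L h = 0"
  using assms unfolding determining_def by blast

lemma determining_eq:
  assumes "determining S" "sigma_functional L" "sigma_functional L'" "\<And>f. f \<in> S \<Longrightarrow> L f = L' f"
    "bounded_borel h"
  shows "L h = L' h"
  using determiningD[OF assms(1) sigma_functional_minus[OF assms(2,3)] _ assms(5)] assms(4) by simp

lemma determining_superset:
  assumes "determining S" "S \<subseteq> S'" "\<And>f. f \<in> S' \<Longrightarrow> bounded_borel f"
  shows "determining S'"
  using assms unfolding determining_def by (meson subsetD)

text \<open>Every bounded Borel function is the pointwise limit of a bounded sequence of simple functions.\<close>

lemma determining_indicators: "determining {indicator A | A. A \<in> sets borel}"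
  unfolding determining_def
proof (intro conjI ballI allI impI)
  fix f :: "real \<Rightarrow> complex" assume "f \<in> {indicator A | A. A \<in> sets borel}"
  then show "bounded_borel f" by (auto intro: bounded_borel_indicator)
next
  fix L :: "(real \<Rightarrow> complex) \<Rightarrow> complex" and h
  assume L: "sigma_functional L" and ind: "\<forall>f\<in>{indicator A | A. A \<in> sets borel}. L f = 0"
    and h: "bounded_borel h"
  have simple: "L s = 0" if s: "simple_function borel s" for s
  proof -
    have fin: "finite (range s)" and vs: "\<And>y. s -` {y} \<in> sets borel"
      using simple_functionD[OF s] by auto
    have "s = (\<lambda>t. \<Sum>y\<in>range s. y * indicator (s -` {y}) t)"
      using fin by (intro ext) (simp add: indicator_def if_distrib[of "(*) _"] sum.delta' cong: if_cong)
    then have "L s = L (\<lambda>t. \<Sum>y\<in>range s. y * indicator (s -` {y}) t)" by simp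
    also have "\<dots> = (\<Sum>y\<in>range s. L (\<lambda>t. y * indicator (s -` {y}) t))"
      by (intro sigma_functional_sum L bounded_borel_scale bounded_borel_indicator vs)
    also have "\<dots> = (\<Sum>y\<in>range s. y * L (indicator (s -` {y})))"
      by (simp add: sigma_functionalD(2)[OF L] bounded_borel_indicator vs)
    also have "\<dots> = 0" using ind vs by (intro sum.neutral) auto
    finally show ?thesis .
  qed
  have "h \<in> borel_measurable borel" using h by simp
  from borel_measurable_implies_sequence_metric[OF this, of 0]
  obtain F where F: "\<And>i. simple_function borel (F i)" "\<And>x. (\<lambda>i. F i x) \<longlonglongrightarrow> h x"
    "\<And>i x. cmod (F i x) \<le> 2 * cmod (h x)" by auto
  obtain C where C: "\<And>t. cmod (h t) \<le> C" using h by (metis bounded_borelE)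
  have "(\<lambda>i. L (F i)) \<longlonglongrightarrow> L h"
  proof (rule sigma_functionalD(3)[OF L, where C = "2 * C"])
    show "cmod (F n t) \<le> 2 * C" for n t using F(3)[of n t] C[of t] by linarith
  qed (use F in \<open>auto intro: borel_measurable_simple_function\<close>)
  then show "L h = 0" using simple F LIMSEQ_unique[of "\<lambda>n. 0" 0] by simp
qed

text \<open>The half-lines are closed under intersection and generate the Borel sets, and the sets on
  whose indicators \<open>L\<close> vanishes form a Dynkin system; the whole line belongs to it as a limit of
  half-lines.\<close>

lemma determining_half_lines: "determining (range (\<lambda>s. indicator {..s}))"
  unfolding determining_def
proof (intro conjI ballI allI impI)
  fix f :: "real \<Rightarrow> complex" assume "f \<in> range (\<lambda>s. indicator {..s})"
  then show "bounded_borel f" by (auto intro: bounded_borel_indicator)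
next
  fix L :: "(real \<Rightarrow> complex) \<Rightarrow> complex" and h
  assume L: "sigma_functional L" and half: "\<forall>f\<in>range (\<lambda>s. indicator {..s}). L f = 0"
    and h: "bounded_borel h"
  have "L (indicator {..real n}) = 0" for n using half by auto
  moreover have "(\<lambda>n. L (indicator {..real n})) \<longlonglongrightarrow> L (\<lambda>t. 1)"
  proof (rule sigma_functionalD(3)[OF L, where C = 1])
    fix t :: real
    have "\<forall>\<^sub>F n in sequentially. indicator {..real n} t = (1::complex)"
      using eventually_ge_at_top[of "nat \<lceil>t\<rceil>"]
      by eventually_elim (auto simp: indicator_def nat_le_iff le_of_int_ceiling ceiling_le_iff)
    then show "(\<lambda>n. indicator {..real n} t) \<longlonglongrightarrow> (1::complex)" by (rule tendsto_eventually)
  qed (auto simp: indicator_def)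
  ultimately have one: "L (\<lambda>t. 1) = 0" using LIMSEQ_unique[of "\<lambda>n. 0" 0] by simp
  have "L (indicator A) = 0" if "A \<in> sets borel" for A
  proof -
    have "Int_stable (range (atMost :: real \<Rightarrow> real set))" by (auto simp: Int_stable_def)
    moreover have "range (atMost :: real \<Rightarrow> real set) \<subseteq> Pow UNIV" by simp
    moreover have "A \<in> sigma_sets UNIV (range atMost)" using that unfolding borel_eq_atMost by simp
    ultimately show ?thesis
  proof (induction A rule: sigma_sets_induct_disjoint)
    case (compl A)
    then have "A \<in> sets borel" unfolding borel_eq_atMost by simp
    then have "L (\<lambda>t. 1 - indicator A t) = 0 - 0"
      using sigma_functional_diff[OF L bounded_borel_const bounded_borel_indicator] one compl by simp
    moreover have "(\<lambda>t. 1 - indicator A t :: complex) = indicator (UNIV - A)"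
      by (auto simp: indicator_def)
    ultimately show ?case by simp
  next
    case (union A)
    then have A: "A i \<in> sets borel" for i unfolding borel_eq_atMost by auto
    have "(\<lambda>n. L (\<lambda>t. \<Sum>i<n. indicator (A i) t)) \<longlonglongrightarrow> L (indicator (\<Union>i. A i))"
    proof (rule sigma_functionalD(3)[OF L, where C = 1])
      show "(\<lambda>t. \<Sum>i<n. indicator (A i) t :: complex) \<in> borel_measurable borel" for n
        by (intro bounded_borel_measurable bounded_borel_sum bounded_borel_indicator A)
      have eq: "(\<Sum>i<n. indicator (A i) t) = (indicator (\<Union>i<n. A i) t :: complex)" for n t
        using union(1) by (subst indicator_UN_disjoint) (auto simp: disjoint_family_on_def)
      show "cmod (\<Sum>i<n. indicator (A i) t) \<le> 1" for n t
        unfolding eq by (simp add: indicator_def del: UN_iff)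
      show "(\<lambda>n. \<Sum>i<n. indicator (A i) t) \<longlonglongrightarrow> (indicator (\<Union>i. A i) t :: complex)" for t
        unfolding eq by (rule LIMSEQ_indicator_UN)
    qed
    moreover have "L (\<lambda>t. \<Sum>i<n. indicator (A i) t) = 0" for n
      using union A by (simp add: sigma_functional_sum[OF L] bounded_borel_indicator)
    ultimately show ?case using LIMSEQ_unique[of "\<lambda>n. 0" 0] by simp
  next
    case empty
    then show ?case using sigma_functionalD(2)[OF L bounded_borel_const, of 0 0] by (simp add: indicator_def[abs_def])
  qed (use half in auto)
  qed
  then show "L h = 0"
    by (intro determiningD[OF determining_indicators L _ h]) auto
qed

abbreviation Cauchy_kernel :: "complex \<Rightarrow> real \<Rightarrow> complex" where
  "Cauchy_kernel z \<equiv> \<lambda>t. 1 / (z - complex_of_real t)"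

lemma Cauchy_kernel_bound:
  assumes "Im z \<noteq> 0"
  shows "cmod (1 / (z - complex_of_real t)) \<le> 1 / \<bar>Im z\<bar>"
proof -
  have "\<bar>Im z\<bar> \<le> cmod (z - complex_of_real t)" using abs_Im_le_cmod[of "z - complex_of_real t"] by simp
  then show ?thesis using assms by (simp add: norm_divide frac_le)
qed

lemma bounded_borel_Cauchy_kernel:
  "Im z \<noteq> 0 \<Longrightarrow> bounded_borel (Cauchy_kernel z)"
  by (rule bounded_borelI[OF _ Cauchy_kernel_bound]) measurable

lemma abs_arctan_le: "\<bar>arctan x\<bar> \<le> pi / 2"
  using arctan_bounded[of x] by linarith

text \<open>Stieltjes inversion: the difference of the Cauchy kernels at \<open>s - \<i>\<epsilon>\<close> and \<open>s + \<i>\<epsilon>\<close> is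
  \<open>2\<i>\<close> times the derivative with respect to \<open>s\<close> of \<open>arctan ((s - t) / \<epsilon>)\<close>.  So the value of \<open>L\<close> on
  these arctangents is a constant \<open>c\<close>.  The limits \<open>s \<rightarrow> \<infinity>\<close> and \<open>s \<rightarrow> -\<infinity>\<close> show that both
  \<open>(\<pi> / 2) L 1\<close> and \<open>-(\<pi> / 2) L 1\<close> are equal to \<open>c\<close>.\<close>

lemma vanishing_on_arctan:
  assumes L: "sigma_functional L" and \<epsilon>: "\<epsilon> > 0"
    and zero: "\<And>z. \<bar>Im z\<bar> = \<epsilon> \<Longrightarrow> L (Cauchy_kernel z) = 0"
  shows "L (\<lambda>t. complex_of_real (arctan ((s - t) / \<epsilon>))) = 0"
    and "L (\<lambda>t. 1) = 0"
proof -
  define a where "a s = (\<lambda>t. complex_of_real (arctan ((s - t) / \<epsilon>)))" for s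
  define K where "K s = (\<lambda>t. complex_of_real (\<epsilon> / ((s - t)\<^sup>2 + \<epsilon>\<^sup>2)))" for s
  have abb: "bounded_borel (a s)" for s
    unfolding a_def
  proof (rule bounded_borelI[where C = "pi/2"])
    show "cmod (complex_of_real (arctan ((s - t) / \<epsilon>))) \<le> pi/2" for t
      using abs_arctan_le[of "(s - t)/\<epsilon>"] by simp
  qed (measurable)
  have LK: "L (K s) = 0" for s
  proof -
    define z w where "z = Complex s (-\<epsilon>)" and "w = Complex s \<epsilon>"
    have nz: "z - complex_of_real t \<noteq> 0" "w - complex_of_real t \<noteq> 0" for t
      using \<epsilon> by (auto simp: z_def w_def complex_eq_iff)
    have prod: "(z - complex_of_real t) * (w - complex_of_real t) = complex_of_real ((s-t)\<^sup>2 + \<epsilon>\<^sup>2)" for t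
      by (simp add: z_def w_def complex_eq_iff power2_eq_square algebra_simps)
    have "K s t = (1 / (2*\<i>)) * (1 / (z - complex_of_real t) - 1 / (w - complex_of_real t))" for t
    proof -
      have "1 / (z - complex_of_real t) - 1 / (w - complex_of_real t)
          = (w - z) / ((z - complex_of_real t) * (w - complex_of_real t))"
        using nz[of t] by (simp add: diff_frac_eq)
      also have "w - z = 2 * \<i> * complex_of_real \<epsilon>" by (simp add: z_def w_def complex_eq_iff)
      finally show ?thesis unfolding prod by (simp add: K_def)
    qed
    then have K: "K s = (\<lambda>t. (1 / (2*\<i>)) * (1 / (z - complex_of_real t) - 1 / (w - complex_of_real t)))"
      by (rule ext)
    have im: "Im z \<noteq> 0" "Im w \<noteq> 0" "\<bar>Im z\<bar> = \<epsilon>" "\<bar>Im w\<bar> = \<epsilon>" using \<epsilon> by (auto simp: z_def w_def)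
    have "L (K s) = (1 / (2*\<i>)) *
        (L (Cauchy_kernel z) - L (Cauchy_kernel w))"
      unfolding K
      by (subst sigma_functionalD(2)[OF L], rule bounded_borel_diff[OF
            bounded_borel_Cauchy_kernel[OF im(1)] bounded_borel_Cauchy_kernel[OF im(2)]],
          subst sigma_functional_diff[OF L bounded_borel_Cauchy_kernel[OF im(1)]
            bounded_borel_Cauchy_kernel[OF im(2)]], rule refl)
    then show ?thesis unfolding zero[OF im(3)] zero[OF im(4)] by simp
  qed
  have der: "((\<lambda>s. arctan ((s - t) / \<epsilon>)) has_real_derivative \<epsilon> / ((s - t)\<^sup>2 + \<epsilon>\<^sup>2)) (at s)" for s t
  proof -
    have "((\<lambda>s. arctan ((s - t) / \<epsilon>)) has_real_derivative inverse (1 + ((s - t) / \<epsilon>)\<^sup>2) * (1 / \<epsilon>)) (at s)"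
      using \<epsilon> by (auto intro!: derivative_eq_intros)
    also have "inverse (1 + ((s - t) / \<epsilon>)\<^sup>2) * (1 / \<epsilon>) = \<epsilon> / ((s - t)\<^sup>2 + \<epsilon>\<^sup>2)"
    proof -
      have "1 + ((s - t) / \<epsilon>)\<^sup>2 = ((s - t)\<^sup>2 + \<epsilon>\<^sup>2) / \<epsilon>\<^sup>2" using \<epsilon> by (simp add: power_divide add_divide_distrib)
      then show ?thesis using \<epsilon> by (simp add: power2_eq_square)
    qed
    finally show ?thesis .
  qed
  have der_bd: "\<epsilon> / ((s - t)\<^sup>2 + \<epsilon>\<^sup>2) \<le> 1 / \<epsilon>" for s t
  proof -
    have "\<epsilon> / ((s - t)\<^sup>2 + \<epsilon>\<^sup>2) \<le> \<epsilon> / \<epsilon>\<^sup>2"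
      using \<epsilon> by (intro divide_left_mono) (auto intro!: mult_pos_pos add_nonneg_pos)
    then show ?thesis using \<epsilon> by (simp add: power2_eq_square)
  qed
  have lip: "\<bar>arctan ((s - t) / \<epsilon>) - arctan ((s' - t) / \<epsilon>)\<bar> \<le> (1/\<epsilon>) * \<bar>s - s'\<bar>" for s s' t
  proof -
    have "norm (arctan ((s - t) / \<epsilon>) - arctan ((s' - t) / \<epsilon>)) \<le> (1/\<epsilon>) * norm (s - s')"
    proof (rule field_differentiable_bound[of UNIV])
      show "norm (\<epsilon> / ((z - t)\<^sup>2 + \<epsilon>\<^sup>2)) \<le> 1 / \<epsilon>" for z
        using der_bd[of z t] \<epsilon> by (simp add: abs_of_nonneg)
    qed (use der in auto)
    then show ?thesis by simp
  qed
  have "((\<lambda>s. L (a s)) has_vector_derivative 0) (at s)" for s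
    unfolding has_vector_derivative_def has_derivative_at2
  proof (intro conjI, simp)
    have "((\<lambda>y. (1 / norm (y - s)) *\<^sub>R (L (a y) - L (a s))) \<longlongrightarrow> 0) (at s)"
      unfolding tendsto_at_iff_sequentially
    proof (intro allI impI)
      fix X :: "nat \<Rightarrow> real" assume X: "\<forall>i. X i \<in> UNIV - {s}" "X \<longlonglongrightarrow> s"
      have Xs: "filterlim X (at s) sequentially"
        using X by (simp add: filterlim_at)
      define q where "q n = (\<lambda>t. complex_of_real (1 / (X n - s)) * (a (X n) t - a s t))" for n
      have "(\<lambda>n. L (q n)) \<longlonglongrightarrow> L (K s)"
      proof (rule sigma_functionalD(3)[OF L, where C = "1/\<epsilon>"])
        show "q n \<in> borel_measurable borel" for n
          unfolding q_def using abb by measurable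
        show "cmod (q n t) \<le> 1 / \<epsilon>" for n t
        proof -
          have "cmod (q n t) = \<bar>arctan ((X n - t) / \<epsilon>) - arctan ((s - t) / \<epsilon>)\<bar> / \<bar>X n - s\<bar>"
            unfolding q_def a_def of_real_diff[symmetric] of_real_mult[symmetric] norm_of_real
            by (simp add: abs_mult)
          also have "\<dots> \<le> ((1/\<epsilon>) * \<bar>X n - s\<bar>) / \<bar>X n - s\<bar>"
            by (intro divide_right_mono lip) simp
          also have "\<dots> = 1/\<epsilon>" using X by simp
          finally show ?thesis .
        qed
        show "(\<lambda>n. q n t) \<longlonglongrightarrow> K s t" for t
        proof -
          have "((\<lambda>y. (arctan ((y - t) / \<epsilon>) - arctan ((s - t) / \<epsilon>)) / (y - s)) \<longlongrightarrow> \<epsilon> / ((s - t)\<^sup>2 + \<epsilon>\<^sup>2)) (at s)"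
            using der[where s = s and t = t] unfolding has_field_derivative_iff .
          from filterlim_compose[OF this Xs]
          have "(\<lambda>n. complex_of_real ((arctan ((X n - t) / \<epsilon>) - arctan ((s - t) / \<epsilon>)) / (X n - s)))
             \<longlonglongrightarrow> complex_of_real (\<epsilon> / ((s - t)\<^sup>2 + \<epsilon>\<^sup>2))"
            by (rule tendsto_of_real)
          then show ?thesis by (simp add: q_def a_def K_def)
        qed
      qed
      moreover have "L (q n) = complex_of_real (1 / (X n - s)) * (L (a (X n)) - L (a s))" for n
        unfolding q_def by (simp add: sigma_functionalD(2)[OF L] sigma_functional_diff[OF L] abb bounded_borel_diff
            del: of_real_diff of_real_divide)
      ultimately have "(\<lambda>n. complex_of_real (1 / (X n - s)) * (L (a (X n)) - L (a s))) \<longlonglongrightarrow> 0"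
        using LK by simp
      then have "(\<lambda>n. cmod (complex_of_real (1 / (X n - s)) * (L (a (X n)) - L (a s)))) \<longlonglongrightarrow> 0"
        by (rule tendsto_norm_zero)
      then have "(\<lambda>n. cmod ((1 / norm (X n - s)) *\<^sub>R (L (a (X n)) - L (a s)))) \<longlonglongrightarrow> 0"
        by (simp add: norm_mult norm_divide del: of_real_diff)
      then show "((\<lambda>y. (1 / norm (y - s)) *\<^sub>R (L (a y) - L (a s))) \<circ> X) \<longlonglongrightarrow> 0"
        unfolding o_def by (rule tendsto_norm_zero_cancel)
    qed
    then show "((\<lambda>y. (1 / norm (y - s)) *\<^sub>R (L (a y) - (L (a s) + (y - s) *\<^sub>R 0))) \<longlongrightarrow> 0) (at s)"
      by simp
  qed
  then obtain c where c: "\<And>s. L (a s) = c"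
    by (rule has_vector_derivative_zero_constant[OF convex_UNIV, of "\<lambda>s. L (a s)"]) auto
  have top: "(\<lambda>n. L (a (real n))) \<longlonglongrightarrow> L (\<lambda>t. complex_of_real (pi/2))"
  proof (rule sigma_functionalD(3)[OF L, where C = "pi/2"])
    show "(\<lambda>n. a (real n) t) \<longlonglongrightarrow> complex_of_real (pi/2)" for t
    proof -
      have "filterlim (\<lambda>n. (real n - t) / \<epsilon>) at_top sequentially" using \<epsilon> by real_asymp
      from filterlim_compose[OF tendsto_arctan_at_top this] show ?thesis
        unfolding a_def by (rule tendsto_of_real)
    qed
    show "cmod (a (real n) t) \<le> pi/2" for n t
      using abs_arctan_le[of "(real n - t)/\<epsilon>"] by (simp add: a_def)
  qed (use abb in auto)
  have bot: "(\<lambda>n. L (a (- real n))) \<longlonglongrightarrow> L (\<lambda>t. complex_of_real (-(pi/2)))"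
  proof (rule sigma_functionalD(3)[OF L, where C = "pi/2"])
    show "(\<lambda>n. a (- real n) t) \<longlonglongrightarrow> complex_of_real (-(pi/2))" for t
    proof -
      have "filterlim (\<lambda>n. (- real n - t) / \<epsilon>) at_bot sequentially" using \<epsilon> by real_asymp
      from filterlim_compose[OF tendsto_arctan_at_bot this] show ?thesis
        unfolding a_def by (intro tendsto_of_real) simp
    qed
    show "cmod (a (- real n) t) \<le> pi/2" for n t
      using abs_arctan_le[of "(- real n - t)/\<epsilon>"] by (simp add: a_def)
  qed (use abb in auto)
  have "L (\<lambda>t. complex_of_real (pi/2)) = c" "L (\<lambda>t. complex_of_real (-(pi/2))) = c"
    using top bot by (simp_all add: c LIMSEQ_const_iff)
  moreover have "L (\<lambda>t. complex_of_real (pi/2)) = complex_of_real (pi/2) * L (\<lambda>t. 1)"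
    "L (\<lambda>t. complex_of_real (-(pi/2))) = complex_of_real (-(pi/2)) * L (\<lambda>t. 1)"
    using sigma_functionalD(2)[OF L bounded_borel_const, of _ 1] by (metis mult.right_neutral)+
  ultimately have *: "complex_of_real (pi/2) * L (\<lambda>t. 1) = c" "- (complex_of_real (pi/2) * L (\<lambda>t. 1)) = c"
    by auto
  then have "c + c = 0" by (simp only: *(1)) (metis ab_left_minus)
  then have "c = 0" by (simp add: mult_2[symmetric])
  then show "L (\<lambda>t. complex_of_real (arctan ((s - t) / \<epsilon>))) = 0" "L (\<lambda>t. 1) = 0"
    using c[of s] * by (auto simp: a_def)
qed

text \<open>As \<open>\<epsilon>\<close> tends to zero, the arctangents of the previous lemma approach indicators of half-lines, up
  to constants.  Only kernels with poles close to the real line enter; the freedom in \<open>\<delta>\<close> is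
  used with the resolvent identity, which needs two different parameters.\<close>

lemma determining_Cauchy_kernels:
  assumes \<delta>: "\<delta> > 0"
  shows "determining {Cauchy_kernel z | z. Im z \<noteq> 0 \<and> \<bar>Im z\<bar> < \<delta>}"
  unfolding determining_def
proof (intro conjI ballI allI impI)
  fix f :: "real \<Rightarrow> complex" 
  assume "f \<in> {Cauchy_kernel z | z. Im z \<noteq> 0 \<and> \<bar>Im z\<bar> < \<delta>}"
  then show "bounded_borel f" using bounded_borel_Cauchy_kernel by auto
next
  fix L :: "(real \<Rightarrow> complex) \<Rightarrow> complex" and h
  assume L: "sigma_functional L"
    and zero: "\<forall>f\<in>{Cauchy_kernel z | z. Im z \<noteq> 0 \<and> \<bar>Im z\<bar> < \<delta>}. L f = 0"
    and h: "bounded_borel h"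
  have arc: "L (\<lambda>t. complex_of_real (arctan ((s - t) / \<epsilon>))) = 0" "L (\<lambda>t. 1) = 0"
    if "0 < \<epsilon>" "\<epsilon> < \<delta>" for s \<epsilon>
    by (rule vanishing_on_arctan[OF L that(1)]; use zero that in force)+
  have one: "L (\<lambda>t. 1) = 0" by (rule arc(2)[of "\<delta>/2"]) (use \<delta> in auto)
  have "L (indicator {..s}) = 0" for s
  proof -
    \<comment> \<open>The width \<open>1 / n\<^sup>2\<close> is much smaller than the shift \<open>1 / n\<close>, so the limit at the jump \<open>t = s\<close>
      is the value on the left.\<close>
    define u where "u n = (\<lambda>t. complex_of_real (arctan ((s + 1 / real n - t) / (1 / (real n)\<^sup>2))))" for n :: nat
    have "(\<lambda>n. L (u n)) \<longlonglongrightarrow> L (\<lambda>t. complex_of_real pi * indicator {..s} t - complex_of_real (pi/2) * 1)"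
    proof (rule sigma_functionalD(3)[OF L, where C = "pi/2"])
      show "cmod (u n t) \<le> pi/2" for n t
        unfolding u_def norm_of_real using abs_arctan_le[of "((s + 1 / real n - t) / (1 / (real n)\<^sup>2))"]
        by simp
      show "(\<lambda>n. u n t) \<longlonglongrightarrow> complex_of_real pi * indicator {..s} t - complex_of_real (pi/2) * 1" for t
      proof -
        consider "t < s" | "t = s" | "t > s" by linarith
        then show ?thesis
        proof cases
          case 1
          have "filterlim (\<lambda>n. ((s - t) + 1 / real n) / (1 / (real n)\<^sup>2)) at_top sequentially"
            using 1 by real_asymp
          then have "filterlim (\<lambda>n. (s + 1 / real n - t) / (1 / (real n)\<^sup>2)) at_top sequentially"
            by (simp add: algebra_simps)
          from tendsto_of_real[OF filterlim_compose[OF tendsto_arctan_at_top this], where ?'a = complex]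
          show ?thesis using 1 by (simp add: u_def)
        next
          case 2
          have "filterlim (\<lambda>n. (1 / real n) / (1 / (real n)\<^sup>2)) at_top sequentially"
            by real_asymp
          then have "filterlim (\<lambda>n. (s + 1 / real n - t) / (1 / (real n)\<^sup>2)) at_top sequentially"
            using 2 by simp
          from tendsto_of_real[OF filterlim_compose[OF tendsto_arctan_at_top this], where ?'a = complex]
          show ?thesis using 2 by (simp add: u_def)
        next
          case 3
          have "filterlim (\<lambda>n. ((s - t) + 1 / real n) / (1 / (real n)\<^sup>2)) at_bot sequentially"
            using 3 by real_asymp
          then have "filterlim (\<lambda>n. (s + 1 / real n - t) / (1 / (real n)\<^sup>2)) at_bot sequentially"
            by (simp add: algebra_simps)
          from tendsto_of_real[OF filterlim_compose[OF tendsto_arctan_at_bot this], where ?'a = complex]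
          show ?thesis using 3 by (simp add: u_def)
        qed
      qed
    qed (unfold u_def, measurable)
    moreover have "\<forall>\<^sub>F n in sequentially. L (u n) = 0"
    proof -
      have "\<forall>\<^sub>F n in sequentially. 1 / (real n)\<^sup>2 < \<delta>" using \<delta> by real_asymp
      then show ?thesis using eventually_gt_at_top[of 0]
        by eventually_elim (unfold u_def, rule arc(1), auto)
    qed
    ultimately have "L (\<lambda>t. complex_of_real pi * indicator {..s} t - complex_of_real (pi/2) * 1) = 0"
      by (rule tendsto_unique[OF sequentially_bot _ tendsto_eventually])
    moreover have "L (\<lambda>t. complex_of_real pi * indicator {..s} t - complex_of_real (pi/2) * 1)
       = complex_of_real pi * L (indicator {..s}) - complex_of_real (pi/2) * L (\<lambda>t. 1)"
      by (subst sigma_functional_diff[OF L])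
        (auto simp only: sigma_functionalD(2)[OF L] bounded_borel_scale bounded_borel_indicator bounded_borel_const
          atMost_borel)
    ultimately show ?thesis using one by simp
  qed
  then show "L h = 0"
    by (intro determiningD[OF determining_half_lines L _ h]) auto
qed


section \<open>Functional calculus of a family of spectral distributions\<close>

text \<open>A family of finite measures \<open>M x\<close>, together with sufficiently many functions \<open>f\<close> whose integrals
  are the quadratic forms \<open>\<langle>x, S x\<rangle>\<close> of known operators \<open>S\<close>.  Two instances matter: the indicators
  paired with the projections of a projection-valued measure, and the Cauchy kernels paired with the
  resolvents of a self-adjoint operator.  The last assumption says that products of test functions
  correspond to products of operators; it is asked, for each \<open>f\<close>, only for a determining set of
  second factors because the resolvent identity leaves out equal parameters.\<close>

locale operator_calculus =
  fixes M :: "'a::complex_hilbert_space \<Rightarrow> real measure"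
    and G :: "((real \<Rightarrow> complex) \<times> ('a \<Rightarrow> 'a)) set"
  assumes sets_M: "sets (M x) = sets borel"
    and emeasure_M: "emeasure (M x) UNIV = ennreal ((norm x)\<^sup>2)"
    and determining_G: "determining (fst ` G)"
    and clinear_G: "(f, S) \<in> G \<Longrightarrow> bounded_clinear S"
    and integral_G: "(f, S) \<in> G \<Longrightarrow> (\<integral>t. f t \<partial>M x) = cinner x (S x)"
    and mult_G: "(f, S) \<in> G \<Longrightarrow>
      determining (fst ` {(f', S') \<in> G. \<forall>x. (\<integral>t. f' t * f t \<partial>M x) = cinner x (S (S' x))})"
begin

lemma space_M: "space (M x) = UNIV"
  using sets_eq_imp_space_eq[OF sets_M] by simp

lemma finite_measure_M: "finite_measure (M x)"
  by standard (simp add: space_M emeasure_M)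

lemma measure_M: "measure (M x) UNIV = (norm x)\<^sup>2"
  by (simp add: measure_def emeasure_M)

lemma integrable_M: "bounded_borel f \<Longrightarrow> integrable (M x) f"
proof -
  interpret finite_measure "M x" by (rule finite_measure_M)
  assume f: "bounded_borel f"
  then obtain C where "\<And>t. cmod (f t) \<le> C" by (metis bounded_borelE)
  then show ?thesis using bounded_borel_measurable[OF f]
    by (intro integrable_const_bound[of _ C]) (auto simp: measurable_cong_sets[OF sets_M refl])
qed

lemma sigma_functional_M: "sigma_functional (\<lambda>h. \<integral>t. h t \<partial>M x)"
  by (rule sigma_functional_integral[OF sets_M finite_measure_M])

text \<open>For fixed \<open>x\<close> and \<open>y\<close> this is the complex measure usually written \<open>\<langle>x, E(dt) y\<rangle>\<close>.\<close>

definition form :: "(real \<Rightarrow> complex) \<Rightarrow> 'a \<Rightarrow> 'a \<Rightarrow> complex" where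
  "form h = polar (\<lambda>x. \<integral>t. h t \<partial>M x)"

lemma sigma_functional_form: "sigma_functional (\<lambda>h. form h x y)"
proof -
  have "sigma_functional (\<lambda>h. (1/4) * ((((\<integral>t. h t \<partial>M (x + y)) - (\<integral>t. h t \<partial>M (x - y)))
      - \<i> * (\<integral>t. h t \<partial>M (x + \<i> *\<^sub>C y))) + \<i> * (\<integral>t. h t \<partial>M (x - \<i> *\<^sub>C y))))"
    by (intro sigma_functional_add sigma_functional_minus sigma_functional_scale sigma_functional_M)
  then show ?thesis by (simp add: form_def polar_def)
qed

lemma form_G: "(f, S) \<in> G \<Longrightarrow> form f x y = cinner x (S y)"
  unfolding form_def by (simp add: integral_G polar_bounded_clinear clinear_G)

lemma form_eqI:
  assumes "sigma_functional L" "\<And>f S. (f, S) \<in> G \<Longrightarrow> cinner x (S y) = L f" "bounded_borel h"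
  shows "form h x y = L h"
  by (rule determining_eq[OF determining_G sigma_functional_form assms(1) _ assms(3)])
    (use form_G assms(2) in force)

lemma form_diagonal:
  assumes "bounded_borel h"
  shows "form h x x = (\<integral>t. h t \<partial>M x)"
  by (rule form_eqI[OF sigma_functional_M _ assms]) (simp add: integral_G)

text \<open>Both sides of each equation are complex measures in \<open>h\<close>, and on the test functions they agree
  because \<open>\<langle>x, S y\<rangle>\<close> is sesquilinear.\<close>

lemma sesquilinear_form:
  assumes h: "bounded_borel h"
  shows "sesquilinear (form h)"
proof
  show "form h x (y + z) = form h x y + form h x z" for x y z
    by (rule form_eqI[OF sigma_functional_add[OF sigma_functional_form sigma_functional_form] _ h])
      (simp add: form_G cinner_simps bounded_clinearD[OF clinear_G])
  show "form h (x + y) z = form h x z + form h y z" for x y z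
    by (rule form_eqI[OF sigma_functional_add[OF sigma_functional_form sigma_functional_form] _ h])
      (simp add: form_G cinner_simps)
  show "form h x (c *\<^sub>C y) = c * form h x y" for c x y
    by (rule form_eqI[OF sigma_functional_scale[OF sigma_functional_form] _ h])
      (simp add: form_G cinner_simps bounded_clinearD[OF clinear_G])
  show "form h (c *\<^sub>C x) y = cnj c * form h x y" for c x y
    by (rule form_eqI[OF sigma_functional_scale[OF sigma_functional_form] _ h])
      (simp add: form_G cinner_simps)
qed

lemma norm_integral_M_le:
  assumes h: "bounded_borel h" and C: "\<And>t. cmod (h t) \<le> C"
  shows "cmod (\<integral>t. h t \<partial>M x) \<le> C * (norm x)\<^sup>2"
proof -
  interpret finite_measure "M x" by (rule finite_measure_M)
  have "cmod (\<integral>t. h t \<partial>M x) \<le> (\<integral>t. C \<partial>M x)"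
    using integrable_M[OF h] C by (intro Bochner_Integration.integral_norm_bound_integral) auto
  then show ?thesis by (simp add: space_M measure_M mult.commute)
qed

lemma form_bounded:
  assumes h: "bounded_borel h" and C: "C \<ge> 0" "\<And>t. cmod (h t) \<le> C" and n: "norm x = 1" "norm y = 1"
  shows "cmod (form h x y) \<le> 4 * C"
proof -
  have I: "cmod (\<integral>t. h t \<partial>M v) \<le> C * 4" if "norm v \<le> 2" for v
  proof -
    have "(norm v)\<^sup>2 \<le> 2\<^sup>2" using that by (intro power_mono) auto
    then show ?thesis using norm_integral_M_le[OF h C(2), of v] mult_left_mono[of "(norm v)\<^sup>2" 4 C] C(1) by simp
  qed
  have "norm (x + y) \<le> 2" "norm (x - y) \<le> 2" "norm (x + \<i> *\<^sub>C y) \<le> 2" "norm (x - \<i> *\<^sub>C y) \<le> 2"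
    using norm_triangle_ineq[of x y] norm_triangle_ineq4[of x y]
      norm_triangle_ineq[of x "\<i> *\<^sub>C y"] norm_triangle_ineq4[of x "\<i> *\<^sub>C y"] n
    by (auto simp: norm_scaleC)
  note b = this[THEN I]
  have "cmod (form h x y) \<le> (cmod (\<integral>t. h t \<partial>M (x + y)) + cmod (\<integral>t. h t \<partial>M (x - y))
     + cmod (\<integral>t. h t \<partial>M (x + \<i> *\<^sub>C y)) + cmod (\<integral>t. h t \<partial>M (x - \<i> *\<^sub>C y))) / 4"
    unfolding form_def polar_def norm_divide
    by (simp, intro order_trans[OF norm_triangle_ineq] order_trans[OF norm_triangle_ineq4] add_mono)
      (simp_all add: norm_mult)
  also have "\<dots> \<le> 4 * C" using b by simp
  finally show ?thesis .
qed

text \<open>The operator \<open>\<integral> h dE\<close>.  For bounded Borel \<open>h\<close> the form determines it, so the choice is unique.\<close>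

definition opr :: "(real \<Rightarrow> complex) \<Rightarrow> 'a \<Rightarrow> 'a" where
  "opr h = (SOME T. bounded_clinear T \<and> (\<forall>x y. form h x y = cinner x (T y)))"

lemma opr_exists:
  assumes h: "bounded_borel h"
  shows "bounded_clinear (opr h) \<and> (\<forall>x y. form h x y = cinner x (opr h y))"
proof -
  obtain C where C: "C \<ge> 0" "\<And>t. cmod (h t) \<le> C" using h by (metis bounded_borelE)
  have "\<exists>T. bounded_clinear T \<and> (\<forall>x y. form h x y = cinner x (T y))"
    by (rule sesquilinear.bounded_operator[OF sesquilinear_form[OF h], of "4 * C"])
      (rule form_bounded[OF h C])
  then show ?thesis unfolding opr_def by (rule someI_ex)
qed

lemma clinear_opr: "bounded_borel h \<Longrightarrow> bounded_clinear (opr h)"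
  using opr_exists by blast

lemma cinner_opr: "bounded_borel h \<Longrightarrow> cinner x (opr h y) = form h x y"
  using opr_exists by metis

lemma cinner_opr_diagonal: "bounded_borel h \<Longrightarrow> cinner x (opr h x) = (\<integral>t. h t \<partial>M x)"
  by (simp add: cinner_opr form_diagonal)

lemma bounded_borel_G: "(f, S) \<in> G \<Longrightarrow> bounded_borel f"
  using determining_G unfolding determining_def by force

lemma opr_G: "(f, S) \<in> G \<Longrightarrow> opr f y = S y"
  by (rule cinner_ext) (simp add: cinner_opr form_G bounded_borel_G)

lemma opr_unique:
  assumes h: "bounded_borel h" and T: "bounded_clinear T" and q: "\<And>x. cinner x (T x) = (\<integral>t. h t \<partial>M x)"
  shows "T = opr h"
proof
  fix y show "T y = opr h y"
    using polar_bounded_clinear[OF T] h by (intro cinner_ext) (simp add: cinner_opr form_def q)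
qed

lemma opr_add:
  assumes "bounded_borel f" "bounded_borel g"
  shows "opr (\<lambda>t. f t + g t) y = opr f y + opr g y"
  by (rule cinner_ext) (simp add: cinner_opr bounded_borel_add assms cinner_add_right
      sigma_functionalD(1)[OF sigma_functional_form])

lemma opr_scale:
  assumes "bounded_borel f"
  shows "opr (\<lambda>t. c * f t) y = c *\<^sub>C opr f y"
  by (rule cinner_ext) (simp add: cinner_opr bounded_borel_scale assms cinner_scaleC_right
      sigma_functionalD(2)[OF sigma_functional_form])

lemma opr_diff:
  assumes "bounded_borel f" "bounded_borel g"
  shows "opr (\<lambda>t. f t - g t) y = opr f y - opr g y"
  by (rule cinner_ext) (simp add: cinner_opr bounded_borel_diff assms cinner_diff_right
      sigma_functional_diff[OF sigma_functional_form])

lemma opr_one: "opr (\<lambda>t. 1) y = y"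
proof -
  have "(\<lambda>y. y) = opr (\<lambda>t. 1)"
    by (rule opr_unique[OF bounded_borel_const bounded_clinear_id])
      (simp add: cinner_self space_M measure_M scaleR_conv_of_real)
  then show ?thesis by metis
qed

lemma opr_const: "opr (\<lambda>t. c) y = c *\<^sub>C y"
  using opr_scale[OF bounded_borel_const, of c 1 y] by (simp add: opr_one)

lemma opr_adjoint:
  assumes h: "bounded_borel h"
  shows "cinner (opr h x) y = cinner x (opr (\<lambda>t. cnj (h t)) y)"
proof -
  note hc = bounded_borel_cnj[OF h]
  have "sesquilinear (\<lambda>x y. cinner (opr h x) y - cinner x (opr (\<lambda>t. cnj (h t)) y))"
    by standard (simp_all add: cinner_simps bounded_clinearD[OF clinear_opr[OF h]]
        bounded_clinearD[OF clinear_opr[OF hc]] algebra_simps)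
  moreover have "cinner (opr h x) x - cinner x (opr (\<lambda>t. cnj (h t)) x) = 0" for x
    using cinner_opr_diagonal[OF h, of x] cinner_opr_diagonal[OF hc, of x]
      cinner_commute[of "opr h x" x] by simp
  ultimately show ?thesis using sesquilinear.zero_if_diagonal_zero by fastforce
qed

text \<open>Multiplicativity uses that test functions are determining twice: here in the factor \<open>g\<close>, for a
  fixed test function \<open>f\<close>, and in the next lemma in the other factor, for a fixed bounded \<open>g\<close>.\<close>

lemma opr_mult_G:
  assumes S: "(f, S) \<in> G" and g: "bounded_borel g"
  shows "form (\<lambda>t. g t * f t) x y = cinner x (S (opr g y))"
proof -
  note f = bounded_borel_G[OF S]
  have "form (\<lambda>t. g t * f t) x y = form g (opr (\<lambda>t. cnj (f t)) x) y"
  proof (rule determining_eq[OF mult_G[OF S] sigma_functional_times[OF sigma_functional_form f]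
          sigma_functional_form _ g])
    fix f' assume "f' \<in> fst ` {(f', S') \<in> G. \<forall>x. (\<integral>t. f' t * f t \<partial>M x) = cinner x (S (S' x))}"
    then obtain S' where S': "(f', S') \<in> G" and q: "\<And>x. (\<integral>t. f' t * f t \<partial>M x) = cinner x (S (S' x))" by auto
    have "form (\<lambda>t. f' t * f t) x y = cinner x (S (S' y))"
      unfolding form_def q
      using polar_bounded_clinear[OF bounded_clinear_compose[OF clinear_G[OF S] clinear_G[OF S']]] by simp
    also have "\<dots> = cinner (opr (\<lambda>t. cnj (f t)) x) (S' y)"
      using opr_adjoint[OF bounded_borel_cnj[OF f]] opr_G[OF S] by simp
    also have "\<dots> = form f' (opr (\<lambda>t. cnj (f t)) x) y" by (simp add: form_G[OF S'])
    finally show "form (\<lambda>t. f' t * f t) x y = form f' (opr (\<lambda>t. cnj (f t)) x) y" .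
  qed
  also have "\<dots> = cinner x (S (opr g y))"
    using opr_adjoint[OF bounded_borel_cnj[OF f]] opr_G[OF S] by (simp add: cinner_opr[OF g, symmetric])
  finally show ?thesis .
qed

lemma opr_mult:
  assumes h: "bounded_borel h" and g: "bounded_borel g"
  shows "opr h (opr g y) = opr (\<lambda>t. h t * g t) y"
proof (rule cinner_ext)
  fix x
  have "form h x (opr g y) = form (\<lambda>t. h t * g t) x y"
  proof (rule form_eqI[OF sigma_functional_times[OF sigma_functional_form g] _ h])
    fix f S assume "(f, S) \<in> G"
    then show "cinner x (S (opr g y)) = form (\<lambda>t. f t * g t) x y"
      using opr_mult_G[OF _ g] by (simp add: mult.commute)
  qed
  then show "cinner x (opr h (opr g y)) = cinner x (opr (\<lambda>t. h t * g t) y)"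
    by (simp add: cinner_opr h g bounded_borel_mult)
qed

lemma integral_M_opr:
  assumes h: "bounded_borel h" and k: "bounded_borel k"
  shows "(\<integral>t. k t \<partial>M (opr h x)) = (\<integral>t. k t * complex_of_real ((cmod (h t))\<^sup>2) \<partial>M x)"
proof -
  note hc = bounded_borel_cnj[OF h]
  have "(\<integral>t. k t \<partial>M (opr h x)) = cinner (opr h x) (opr k (opr h x))"
    by (simp add: cinner_opr_diagonal k)
  also have "\<dots> = cinner x (opr (\<lambda>t. cnj (h t)) (opr k (opr h x)))"
    by (rule opr_adjoint[OF h])
  also have "\<dots> = cinner x (opr (\<lambda>t. cnj (h t) * (k t * h t)) x)"
    by (simp add: opr_mult h k hc bounded_borel_mult)
  also have "\<dots> = (\<integral>t. cnj (h t) * (k t * h t) \<partial>M x)"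
    by (simp add: cinner_opr_diagonal h k hc bounded_borel_mult)
  also have "(\<lambda>t. cnj (h t) * (k t * h t)) = (\<lambda>t. k t * complex_of_real ((cmod (h t))\<^sup>2))"
    unfolding complex_norm_square by (auto simp: mult_ac)
  finally show ?thesis .
qed

lemma norm_opr_sq:
  assumes h: "bounded_borel h"
  shows "complex_of_real ((norm (opr h x))\<^sup>2) = (\<integral>t. complex_of_real ((cmod (h t))\<^sup>2) \<partial>M x)"
  using integral_M_opr[OF h bounded_borel_const[of 1], of x] by (simp add: space_M measure_M scaleR_conv_of_real)

lemma integral_M_indicator:
  "A \<in> sets borel \<Longrightarrow> (\<integral>t. indicator A t \<partial>M x) = complex_of_real (measure (M x) A)"
  by (simp add: complex_integral_indicator sets_M)

text \<open>The spectral distribution of \<open>h(T) x\<close>.  It decides which vectors \<open>h(T) x\<close> lie in the domain of \<open>T\<close>.\<close>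

lemma M_opr:
  assumes h: "bounded_borel h"
  shows "M (opr h x) = density (M x) (\<lambda>t. ennreal ((cmod (h t))\<^sup>2))"
proof (rule measure_eqI)
  show "sets (M (opr h x)) = sets (density (M x) (\<lambda>t. ennreal ((cmod (h t))\<^sup>2)))" by (simp add: sets_M)
  fix A assume "A \<in> sets (M (opr h x))"
  then have A: "A \<in> sets borel" by (simp add: sets_M)
  note [measurable] = h
  have mM: "borel_measurable (M v) = (borel_measurable borel :: (real \<Rightarrow> 'b::topological_space) set)" for v
    by (rule measurable_cong_sets[OF sets_M refl])
  interpret F: finite_measure "M v" for v by (rule finite_measure_M)
  have bb: "bounded_borel (\<lambda>t. indicator A t * complex_of_real ((cmod (h t))\<^sup>2))"
    unfolding complex_norm_square
    by (intro bounded_borel_mult bounded_borel_cnj bounded_borel_indicator h A)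
  have "complex_of_real (measure (M (opr h x)) A) = (\<integral>t. indicator A t \<partial>M (opr h x))"
    by (simp add: integral_M_indicator A)
  also have "\<dots> = (\<integral>t. indicator A t * complex_of_real ((cmod (h t))\<^sup>2) \<partial>M x)"
    by (rule integral_M_opr[OF h bounded_borel_indicator[OF A]])
  also have "\<dots> = (\<integral>t. complex_of_real (indicator A t * (cmod (h t))\<^sup>2) \<partial>M x)"
    by (intro Bochner_Integration.integral_cong) (auto simp: indicator_def)
  also have "\<dots> = complex_of_real (\<integral>t. indicator A t * (cmod (h t))\<^sup>2 \<partial>M x)"
    by (rule integral_complex_of_real)
  finally have eq: "measure (M (opr h x)) A = (\<integral>t. indicator A t * (cmod (h t))\<^sup>2 \<partial>M x)"
    using of_real_eq_iff by blast
  have "integrable (M x) (\<lambda>t. complex_of_real (indicator A t * (cmod (h t))\<^sup>2))"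
    using integrable_M[OF bb] by (rule Bochner_Integration.integrable_cong[THEN iffD1, rotated -1]) (auto simp: indicator_def)
  then have "integrable (M x) (\<lambda>t. indicator A t * (cmod (h t))\<^sup>2)"
    by (rule complex_of_real_integrable_eq[THEN iffD1])
  then have "(\<integral>\<^sup>+t. ennreal (indicator A t * (cmod (h t))\<^sup>2) \<partial>M x) = ennreal (measure (M (opr h x)) A)"
    unfolding eq by (intro nn_integral_eq_integral) auto
  moreover have "(\<integral>\<^sup>+t. ennreal (indicator A t * (cmod (h t))\<^sup>2) \<partial>M x) = (\<integral>\<^sup>+t. ennreal ((cmod (h t))\<^sup>2) * indicator A t \<partial>M x)"
    by (intro nn_integral_cong) (auto simp: indicator_def)
  ultimately show "emeasure (M (opr h x)) A = emeasure (density (M x) (\<lambda>t. ennreal ((cmod (h t))\<^sup>2))) A"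
    using A h by (subst emeasure_density) (auto simp: mM sets_M F.emeasure_eq_measure bounded_borel_measurable)
qed

text \<open>The squared norm of \<open>(F n - f)(T) x\<close> is the integral of \<open>\<bar>F n - f\<bar>\<^sup>2\<close>.\<close>

lemma opr_tendsto:
  assumes F: "\<And>n. F n \<in> borel_measurable borel" "\<And>n::nat. \<And>t. cmod (F n t) \<le> C"
    and lim: "\<And>t. (\<lambda>n. F n t) \<longlonglongrightarrow> f t"
  shows "(\<lambda>n. opr (F n) x) \<longlonglongrightarrow> opr f x"
proof -
  have Fb: "bounded_borel (F n)" for n using F by (intro bounded_borelI) auto
  have fC: "cmod (f t) \<le> C" for t
    by (rule tendsto_upperbound[OF tendsto_norm[OF lim]]) (use F in auto)
  have fm: "f \<in> borel_measurable borel"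
    by (rule borel_measurable_LIMSEQ_metric[OF F(1)]) (use lim in auto)
  have fb: "bounded_borel f" using fC fm by (intro bounded_borelI) auto
  have C0: "C \<ge> 0" using fC norm_ge_zero order_trans by blast
  define d where "d n = (\<lambda>t. complex_of_real ((cmod (F n t - f t))\<^sup>2))" for n
  have "(\<lambda>n. \<integral>t. d n t \<partial>M x) \<longlonglongrightarrow> (\<integral>t. 0 \<partial>M x)"
  proof (rule sigma_functionalD(3)[OF sigma_functional_M, where C = "(2 * C)\<^sup>2"])
    show "d n \<in> borel_measurable borel" for n unfolding d_def using F(1) fm by measurable
    show "cmod (d n t) \<le> (2 * C)\<^sup>2" for n t
    proof -
      have "cmod (F n t - f t) \<le> 2 * C" using norm_triangle_ineq4[of "F n t" "f t"] F(2)[of n t] fC[of t] by linarith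
      then have "(cmod (F n t - f t))\<^sup>2 \<le> (2 * C)\<^sup>2" by (rule power_mono) simp
      then show ?thesis unfolding d_def norm_of_real by simp
    qed
    show "(\<lambda>n. d n t) \<longlonglongrightarrow> 0" for t
    proof -
      have "(\<lambda>n. complex_of_real ((cmod (F n t - f t))\<^sup>2)) \<longlonglongrightarrow> complex_of_real ((cmod (f t - f t))\<^sup>2)"
        by (intro tendsto_intros lim)
      then show ?thesis by (simp add: d_def)
    qed
  qed
  moreover have "(\<integral>t. d n t \<partial>M x) = complex_of_real ((norm (opr (F n) x - opr f x))\<^sup>2)" for n
    using norm_opr_sq[OF bounded_borel_diff[OF Fb fb]] opr_diff[OF Fb fb] by (simp add: d_def)
  ultimately have "(\<lambda>n. complex_of_real ((norm (opr (F n) x - opr f x))\<^sup>2)) \<longlonglongrightarrow> complex_of_real 0" by simp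
  then have "(\<lambda>n. (norm (opr (F n) x - opr f x))\<^sup>2) \<longlonglongrightarrow> 0"
    using tendsto_Re by fastforce
  then have "(\<lambda>n. sqrt ((norm (opr (F n) x - opr f x))\<^sup>2)) \<longlonglongrightarrow> sqrt 0"
    by (rule tendsto_real_sqrt)
  then have "(\<lambda>n. norm (opr (F n) x - opr f x)) \<longlonglongrightarrow> 0" by simp
  then show ?thesis using LIM_zero_iff tendsto_norm_zero_iff by blast
qed

end


section \<open>Projection-valued measures\<close>

abbreviation projection_pairs :: "(real set \<Rightarrow> 'a \<Rightarrow> 'a) \<Rightarrow> ((real \<Rightarrow> complex) \<times> ('a \<Rightarrow> 'a)) set" where
  "projection_pairs E \<equiv> {(indicator A, E A) | A. A \<in> sets borel}"

lemma projection_valued_measureD: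
  assumes "projection_valued_measure E"
  shows "A \<in> sets borel \<Longrightarrow> bounded_clinear (E A)"
    and "A \<in> sets borel \<Longrightarrow> E A (E A x) = E A x"
    and "A \<in> sets borel \<Longrightarrow> cinner x (E A y) = cinner (E A x) y"
    and "E UNIV x = x"
    and "(\<And>n::nat. A' n \<in> sets borel) \<Longrightarrow> disjoint_family A' \<Longrightarrow> (\<lambda>n. E (A' n) x) sums E (\<Union>n. A' n) x"
  using assms unfolding projection_valued_measure_def orth_projection_def
  by (simp_all add: image_subset_iff)

context
  fixes E :: "real set \<Rightarrow> 'a::complex_hilbert_space \<Rightarrow> 'a"
  assumes E: "projection_valued_measure E"
begin

lemma pvm_empty: "E {} x = 0"
proof -
  have "(\<lambda>n::nat. E {} x) sums E (\<Union>n::nat. {}) x"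
    by (rule projection_valued_measureD(5)[OF E]) (auto simp: disjoint_family_on_def)
  then have "(\<lambda>n::nat. E {} x) \<longlonglongrightarrow> 0" by (intro summable_LIMSEQ_zero sums_summable)
  then show ?thesis by (simp add: LIMSEQ_const_iff)
qed

lemma pvm_Un:
  assumes "A \<in> sets borel" "B \<in> sets borel" "A \<inter> B = {}"
  shows "E (A \<union> B) x = E A x + E B x"
proof -
  have "(\<lambda>n. E (binaryset A B n) x) sums E (\<Union>n. binaryset A B n) x"
    by (rule projection_valued_measureD(5)[OF E])
      (use assms in \<open>auto simp: disjoint_family_on_def binaryset_def\<close>)
  moreover have "(\<lambda>n. E (binaryset A B n) x) sums (\<Sum>n\<in>{0, 1}. E (binaryset A B n) x)"
    by (rule sums_finite) (auto simp: binaryset_def pvm_empty)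
  ultimately show ?thesis
    using sums_unique2 by (fastforce simp: binaryset_def UN_binaryset_eq)
qed

text \<open>If \<open>P\<close>, \<open>Q\<close> and \<open>P + Q\<close> are projections, then \<open>P Q + Q P = 0\<close>.  Multiplying this by \<open>P\<close> from the left
  and from the right gives \<open>P Q = - P Q P = Q P\<close>, and both are zero.\<close>

lemma pvm_disjoint:
  assumes A: "A \<in> sets borel" and B: "B \<in> sets borel" and "A \<inter> B = {}"
  shows "E A (E B x) = 0"
proof -
  note U = pvm_Un[OF assms] and
    P = bounded_clinearD[OF projection_valued_measureD(1)[OF E A]] projection_valued_measureD(2)[OF E A]
    bounded_clinearD[OF projection_valued_measureD(1)[OF E B]] projection_valued_measureD(2)[OF E B]
  have anti: "E A (E B x) + E B (E A x) = 0" for x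
    using projection_valued_measureD(2)[OF E sets.Un[OF A B], of x] by (simp add: U P algebra_simps)
  have "E A (E A (E B x) + E B (E A x)) = 0" by (simp add: anti P)
  then have "E A (E B x) + E A (E B (E A x)) = 0" by (simp add: P)
  moreover have "E A (E B (E A x)) + E B (E A x) = 0" using anti[of "E A x"] by (simp add: P)
  ultimately have "E A (E B x) = E B (E A x)" by (metis add_right_cancel add.commute)
  then show ?thesis using anti[of x] scaleR_2[of "E A (E B x)"] by simp
qed

lemma pvm_Int:
  assumes A: "A \<in> sets borel" and B: "B \<in> sets borel"
  shows "E A (E B x) = E (A \<inter> B) x"
proof -
  have AB: "A \<inter> B \<in> sets borel" "A - B \<in> sets borel" "B - A \<in> sets borel" using A B by auto
  have AB_union: "(A \<inter> B) \<union> (A - B) = A" "(A \<inter> B) \<union> (B - A) = B" by auto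
  have split: "E A y = E (A \<inter> B) y + E (A - B) y" "E B y = E (A \<inter> B) y + E (B - A) y" for y
    by (rule pvm_Un[OF AB(1,2), unfolded AB_union], blast)
      (rule pvm_Un[OF AB(1,3), unfolded AB_union], blast)
  have d: "(A \<inter> B) \<inter> (B - A) = {}" "(A - B) \<inter> (A \<inter> B) = {}" "(A - B) \<inter> (B - A) = {}" by auto
  have "E A (E B x) = E (A \<inter> B) (E (A \<inter> B) x) + E (A \<inter> B) (E (B - A) x)
      + (E (A - B) (E (A \<inter> B) x) + E (A - B) (E (B - A) x))"
    unfolding split(1)[of "E B x"] unfolding split(2)[of x]
    by (simp add: bounded_clinearD[OF projection_valued_measureD(1)[OF E AB(1)]]
        bounded_clinearD[OF projection_valued_measureD(1)[OF E AB(2)]])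
  also have "\<dots> = E (A \<inter> B) (E (A \<inter> B) x)"
    by (simp add: pvm_disjoint[OF AB(1,3) d(1)] pvm_disjoint[OF AB(2,1) d(2)] pvm_disjoint[OF AB(2,3) d(3)])
  finally have "E A (E B x) = E (A \<inter> B) (E (A \<inter> B) x)" .
  then show ?thesis by (simp add: projection_valued_measureD(2)[OF E AB(1)])
qed

lemma pvm_cinner_eq_norm:
  assumes A: "A \<in> sets borel"
  shows "cinner x (E A x) = complex_of_real ((norm (E A x))\<^sup>2)"
  using projection_valued_measureD(2,3)[OF E A] by (metis cinner_self)

lemma sets_diag_measure: "sets (diag_measure E x) = sets borel"
  unfolding diag_measure_def using sets.sigma_sets_eq[of borel] by (subst sets_measure_of) auto

lemma emeasure_diag_measure:
  assumes A: "A \<in> sets borel"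
  shows "emeasure (diag_measure E x) A = ennreal ((norm (E A x))\<^sup>2)"
proof -
  let ?m = "\<lambda>A. ennreal (Re (cinner x (E A x)))"
  have "emeasure (diag_measure E x) A = ?m A"
    unfolding diag_measure_def
  proof (rule emeasure_measure_of[OF refl])
    show "A \<in> sets (measure_of UNIV (sets borel) ?m)"
      using A sets_diag_measure[of x] unfolding diag_measure_def by simp
    show "positive (sets (measure_of UNIV (sets borel) ?m)) ?m"
      by (simp add: positive_def pvm_empty)
    show "countably_additive (sets (measure_of UNIV (sets borel) ?m)) ?m"
      unfolding sets_diag_measure[of x, unfolded diag_measure_def] countably_additive_def
    proof (intro allI impI)
      fix B :: "nat \<Rightarrow> real set"
      assume B: "range B \<subseteq> sets borel" "disjoint_family B" "\<Union> (range B) \<in> sets borel"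
      have "(\<lambda>n. E (B n) x) sums E (\<Union>n. B n) x"
        by (rule projection_valued_measureD(5)[OF E]) (use B in auto)
      then have "(\<lambda>n. Re (cinner x (E (B n) x))) sums Re (cinner x (E (\<Union>n. B n) x))"
        by (intro sums_Re bounded_linear.sums[OF bounded_bilinear.bounded_linear_right[OF bounded_bilinear_cinner]])
      then show "(\<Sum>n. ?m (B n)) = ?m (\<Union>n. B n)"
        using B by (intro suminf_ennreal_eq) (auto simp: pvm_cinner_eq_norm)
    qed
  qed auto
  then show ?thesis using pvm_cinner_eq_norm[OF A] by simp
qed

lemma measure_diag_measure:
  "A \<in> sets borel \<Longrightarrow> measure (diag_measure E x) A = (norm (E A x))\<^sup>2"
  by (simp add: measure_def emeasure_diag_measure)

lemma integral_diag_measure_indicator: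
  "A \<in> sets borel \<Longrightarrow> (\<integral>t. indicator A t \<partial>diag_measure E x) = cinner x (E A x)"
  by (simp add: complex_integral_indicator sets_diag_measure measure_diag_measure pvm_cinner_eq_norm)

text \<open>All indicators are at hand as test functions, and \<open>pvm_Int\<close> is the product rule.\<close>

lemma operator_calculus_pvm:
  "operator_calculus (diag_measure E) (projection_pairs E)"
proof
  have fst: "fst ` (projection_pairs E) = {indicator A | A. A \<in> sets borel}"
    by force
  show "determining (fst ` (projection_pairs E))"
    unfolding fst by (rule determining_indicators)
  show "sets (diag_measure E x) = sets borel" for x by (rule sets_diag_measure)
  show "emeasure (diag_measure E x) UNIV = ennreal ((norm x)\<^sup>2)" for x
    by (simp add: emeasure_diag_measure projection_valued_measureD(4)[OF E])
  fix f S assume "(f, S) \<in> (projection_pairs E)"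
  then obtain A where A: "A \<in> sets borel" and f: "f = indicator A" and S: "S = E A" by auto
  show "bounded_clinear S" unfolding S by (rule projection_valued_measureD(1)[OF E A])
  show "(\<integral>t. f t \<partial>diag_measure E x) = cinner x (S x)" for x
    unfolding f S by (rule integral_diag_measure_indicator[OF A])
  have "{(f', S') \<in> (projection_pairs E).
      \<forall>x. (\<integral>t. f' t * f t \<partial>diag_measure E x) = cinner x (S (S' x))} = (projection_pairs E)"
  proof -
    have "(\<integral>t. indicator B t * f t \<partial>diag_measure E x) = cinner x (S (E B x))" if B: "B \<in> sets borel" for B x
    proof -
      have "(\<lambda>t. indicator B t * f t) = indicator (A \<inter> B)" by (auto simp: f indicator_def)
      then show ?thesis
        using integral_diag_measure_indicator[of "A \<inter> B" x] A B by (simp add: S pvm_Int)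
    qed
    then show ?thesis by auto
  qed
  then show "determining (fst ` {(f', S') \<in> (projection_pairs E).
      \<forall>x. (\<integral>t. f' t * f t \<partial>diag_measure E x) = cinner x (S (S' x))})"
    using fst determining_indicators by simp
qed

end

context operator_calculus
begin

text \<open>An indicator is real and idempotent, so it is sent to an orthogonal projection; countable
  additivity is the convergence of the partial sums of indicators.\<close>

lemma pvm_opr_indicator: "projection_valued_measure (\<lambda>A. opr (indicator A))"
  unfolding projection_valued_measure_def
proof (intro conjI ballI allI impI)
  fix A :: "real set" assume A: "A \<in> sets borel"
  note b = bounded_borel_indicator[OF A]
  have "(\<lambda>t. indicator A t * indicator A t :: complex) = indicator A" "(\<lambda>t. cnj (indicator A t)) = indicator A"
    by (auto simp: indicator_def)
  then show "orth_projection (opr (indicator A))"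
    unfolding orth_projection_def using opr_mult[OF b b] opr_adjoint[OF b] clinear_opr[OF b] by simp
next
  fix x :: 'a
  have "(indicator UNIV :: real \<Rightarrow> complex) = (\<lambda>t. 1)" by (auto simp: indicator_def)
  then show "opr (indicator UNIV) x = x" by (simp add: opr_one)
next
  fix A :: "nat \<Rightarrow> real set" and x
  assume A: "range A \<subseteq> sets borel" "disjoint_family A"
  have eq: "(\<Sum>i<n. indicator (A i) t) = (indicator (\<Union>i<n. A i) t :: complex)" for n t
    using A(2) by (subst indicator_UN_disjoint) (auto simp: disjoint_family_on_def)
  have "opr (\<lambda>t. \<Sum>i<n. indicator (A i) t) x = (\<Sum>i<n. opr (indicator (A i)) x)" for n
  proof (induction n)
    case 0
    then show ?case by (simp add: opr_const)
  next
    case (Suc n)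
    then show ?case using A(1)
      by (simp add: opr_add bounded_borel_sum bounded_borel_indicator image_subset_iff)
  qed
  moreover have "(\<lambda>n. opr (\<lambda>t. \<Sum>i<n. indicator (A i) t) x) \<longlonglongrightarrow> opr (indicator (\<Union>i. A i)) x"
  proof (rule opr_tendsto[where C = 1])
    show "(\<lambda>t. \<Sum>i<n. indicator (A i) t :: complex) \<in> borel_measurable borel" for n
      using A(1) by (intro bounded_borel_measurable bounded_borel_sum bounded_borel_indicator) auto
    show "cmod (\<Sum>i<n. indicator (A i) t) \<le> 1" for n t
      unfolding eq by (simp add: indicator_def del: UN_iff)
    show "(\<lambda>n. \<Sum>i<n. indicator (A i) t) \<longlonglongrightarrow> (indicator (\<Union>i. A i) t :: complex)" for t
      unfolding eq by (rule LIMSEQ_indicator_UN)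
  qed
  ultimately show "(\<lambda>n. opr (indicator (A n)) x) sums opr (indicator (\<Union>n. A n)) x"
    unfolding sums_def by simp
qed

lemma diag_measure_opr_indicator: "diag_measure (\<lambda>A. opr (indicator A)) x = M x"
proof (rule measure_eqI)
  show sets: "sets (diag_measure (\<lambda>A. opr (indicator A)) x) = sets (M x)"
    by (simp add: sets_diag_measure[OF pvm_opr_indicator] sets_M)
  interpret F: finite_measure "M x" by (rule finite_measure_M)
  fix A assume "A \<in> sets (diag_measure (\<lambda>A. opr (indicator A)) x)"
  then have A: "A \<in> sets borel" by (simp add: sets_diag_measure[OF pvm_opr_indicator])
  have "complex_of_real ((norm (opr (indicator A) x))\<^sup>2) = complex_of_real (measure (M x) A)"
    using pvm_cinner_eq_norm[OF pvm_opr_indicator A, of x]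
      cinner_opr_diagonal[OF bounded_borel_indicator[OF A], of x] integral_M_indicator[OF A, of x] by simp
  then have "(norm (opr (indicator A) x))\<^sup>2 = measure (M x) A" using of_real_eq_iff by blast
  then show "emeasure (diag_measure (\<lambda>A. opr (indicator A)) x) A = emeasure (M x) A"
    by (simp add: emeasure_diag_measure[OF pvm_opr_indicator A] F.emeasure_eq_measure)
qed

end


section \<open>Self-adjoint operators and their resolvents\<close>

lemma linear_operatorD:
  assumes "linear_operator T"
  shows "(x, y) \<in> T \<Longrightarrow> (x, y') \<in> T \<Longrightarrow> y = y'"
    and "(0, 0) \<in> T"
    and "(x, y) \<in> T \<Longrightarrow> (x', y') \<in> T \<Longrightarrow> (x + x', y + y') \<in> T"
    and "(x, y) \<in> T \<Longrightarrow> (c *\<^sub>C x, c *\<^sub>C y) \<in> T"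
  using assms unfolding linear_operator_def by (auto dest: single_valuedD)

lemma linear_operator_diff:
  assumes "linear_operator T" "(x, y) \<in> T" "(x', y') \<in> T"
  shows "(x - x', y - y') \<in> T"
  using linear_operatorD(3)[OF assms(1,2) linear_operatorD(4)[OF assms(1,3), of "-1"]]
  by (simp add: scaleC_minus1)

lemma adjoint_opD: "(y, z) \<in> adjoint_op T \<Longrightarrow> (x, w) \<in> T \<Longrightarrow> cinner y w = cinner z x"
  unfolding adjoint_op_def by blast

lemma adjoint_opI: "(\<And>x w. (x, w) \<in> T \<Longrightarrow> cinner y w = cinner z x) \<Longrightarrow> (y, z) \<in> adjoint_op T"
  unfolding adjoint_op_def by blast

lemma closure_pairD:
  fixes T :: "('a::complex_hilbert_space \<times> 'a) set"
  assumes "(x, y) \<in> closure T"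
  shows "\<exists>f g. (\<forall>n::nat. (f n, g n) \<in> T) \<and> f \<longlonglongrightarrow> x \<and> g \<longlonglongrightarrow> y"
proof -
  obtain h where h: "\<And>n::nat. h n \<in> T" "h \<longlonglongrightarrow> (x, y)" using assms by (metis closure_sequential)
  show ?thesis
    using h(1) tendsto_fst[OF h(2)] tendsto_snd[OF h(2)]
    by (intro exI[of _ "\<lambda>n. fst (h n)"] exI[of _ "\<lambda>n. snd (h n)"]) simp
qed

lemma closure_pairI:
  fixes T :: "('a::complex_hilbert_space \<times> 'a) set"
  assumes "\<And>n::nat. (f n, g n) \<in> T" "f \<longlonglongrightarrow> x" "g \<longlonglongrightarrow> y"
  shows "(x, y) \<in> closure T"
  unfolding closure_sequential using assms by (intro exI[of _ "\<lambda>n. (f n, g n)"]) (auto intro: tendsto_Pair)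

lemma closed_adjoint_op: "closed (adjoint_op T)"
  unfolding closure_subset_eq[symmetric]
proof (intro subrelI)
  fix y z assume "(y, z) \<in> closure (adjoint_op T)"
  then obtain f g where fg: "\<And>n::nat. (f n, g n) \<in> adjoint_op T" "f \<longlonglongrightarrow> y" "g \<longlonglongrightarrow> z"
    using closure_pairD by blast
  show "(y, z) \<in> adjoint_op T"
  proof (rule adjoint_opI)
    fix x w assume xw: "(x, w) \<in> T"
    have "(\<lambda>n. cinner (f n) w) \<longlonglongrightarrow> cinner y w" "(\<lambda>n. cinner (g n) x) \<longlonglongrightarrow> cinner z x"
      by (intro tendsto_cinner fg tendsto_const)+
    moreover have "cinner (f n) w = cinner (g n) x" for n using adjoint_opD[OF fg(1) xw] .
    ultimately show "cinner y w = cinner z x" using LIMSEQ_unique by auto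
  qed
qed

lemma adjoint_op_closure: "adjoint_op (closure T) = adjoint_op T"
proof (intro set_eqI iffI; clarify)
  fix y z assume "(y, z) \<in> adjoint_op (closure T)"
  then show "(y, z) \<in> adjoint_op T"
    using closure_subset[of T] by (intro adjoint_opI) (blast dest: adjoint_opD)
next
  fix y z assume a: "(y, z) \<in> adjoint_op T"
  show "(y, z) \<in> adjoint_op (closure T)"
  proof (rule adjoint_opI)
    fix x w assume "(x, w) \<in> closure T"
    then obtain f g where fg: "\<And>n::nat. (f n, g n) \<in> T" "f \<longlonglongrightarrow> x" "g \<longlonglongrightarrow> w"
      using closure_pairD by blast
    have "(\<lambda>n. cinner y (g n)) \<longlonglongrightarrow> cinner y w" "(\<lambda>n. cinner z (f n)) \<longlonglongrightarrow> cinner z x"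
      by (intro tendsto_cinner fg tendsto_const)+
    moreover have "cinner y (g n) = cinner z (f n)" for n using adjoint_opD[OF a fg(1)] .
    ultimately show "cinner y w = cinner z x" using LIMSEQ_unique by auto
  qed
qed

text \<open>The range of \<open>z - T\<close>: on the graph, \<open>y = (z - T) v\<close> reads \<open>(v, z v - y) \<in> T\<close>.\<close>

definition shift_range :: "('a::complex_hilbert_space \<times> 'a) set \<Rightarrow> complex \<Rightarrow> 'a set" where
  "shift_range T z = {y. \<exists>v. (v, z *\<^sub>C v - y) \<in> T}"

lemma complex_subspace_shift_range:
  assumes T: "linear_operator T"
  shows "complex_subspace (shift_range T z)"
  unfolding complex_subspace_def shift_range_def
proof (intro conjI ballI allI)
  show "0 \<in> {y. \<exists>v. (v, z *\<^sub>C v - y) \<in> T}"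
    using linear_operatorD(2)[OF T] by (auto intro!: exI[of _ 0])
next
  fix x y assume "x \<in> {y. \<exists>v. (v, z *\<^sub>C v - y) \<in> T}" "y \<in> {y. \<exists>v. (v, z *\<^sub>C v - y) \<in> T}"
  then obtain v w where "(v, z *\<^sub>C v - x) \<in> T" "(w, z *\<^sub>C w - y) \<in> T" by auto
  from linear_operatorD(3)[OF T this] show "x + y \<in> {y. \<exists>v. (v, z *\<^sub>C v - y) \<in> T}"
    by (auto intro!: exI[of _ "v + w"] simp: scaleC_add_right algebra_simps)
next
  fix c y assume "y \<in> {y. \<exists>v. (v, z *\<^sub>C v - y) \<in> T}"
  then obtain v where "(v, z *\<^sub>C v - y) \<in> T" by auto
  from linear_operatorD(4)[OF T this, of c] show "c *\<^sub>C y \<in> {y. \<exists>v. (v, z *\<^sub>C v - y) \<in> T}"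
    by (auto intro!: exI[of _ "c *\<^sub>C v"] simp: scaleC_simps mult.commute)
qed

text \<open>For a formally symmetric operator \<open>\<langle>v, T v\<rangle>\<close> is real, so \<open>\<langle>v, (z - T) v\<rangle>\<close> has imaginary part
  \<open>Im z \<parallel>v\<parallel>\<^sup>2\<close>.\<close>

lemma shift_bounded_below:
  assumes sym: "T \<subseteq> adjoint_op T" and v: "(v, z *\<^sub>C v - y) \<in> T"
  shows "\<bar>Im z\<bar> * norm v \<le> norm y"
proof (cases "v = 0")
  case False
  have "cinner v (z *\<^sub>C v - y) = cinner (z *\<^sub>C v - y) v"
    using adjoint_opD[OF _ v] sym v by blast
  then have "z * cinner v v - cinner v y = cnj (z * cinner v v - cinner v y)"
    using cinner_commute[of "z *\<^sub>C v - y" v] by (simp add: cinner_simps)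
  then have "Im (z * cinner v v - cinner v y) = 0"
    by (metis complex_cnj_cancel_iff complex_cnj_complex_of_real Reals_cnj_iff complex_is_Real_iff)
  then have "Im z * (norm v)\<^sup>2 = Im (cinner v y)" by (simp add: cinner_self)
  then have "\<bar>Im z\<bar> * (norm v)\<^sup>2 = \<bar>Im (cinner v y)\<bar>" by (metis abs_mult abs_power2 power2_abs)
  also have "\<dots> \<le> norm v * norm y"
    using abs_Im_le_cmod Cauchy_Schwarz order_trans by blast
  finally show ?thesis using False by (simp add: power2_eq_square)
qed simp

text \<open>By the lower bound the preimages of a convergent sequence are Cauchy, and the graph is closed.\<close>

lemma closed_shift_range:
  fixes T :: "('a::complex_hilbert_space \<times> 'a) set"
  assumes T: "linear_operator T" and sym: "T \<subseteq> adjoint_op T" and cl: "closed T" and z: "Im z \<noteq> 0"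
  shows "closed (shift_range T z)"
  unfolding closed_sequential_limits
proof (intro allI impI; elim conjE)
  fix y :: "nat \<Rightarrow> 'a" and l assume y: "\<forall>n. y n \<in> shift_range T z" "y \<longlonglongrightarrow> l"
  then obtain v where v: "\<And>n. (v n, z *\<^sub>C v n - y n) \<in> T" unfolding shift_range_def by (auto, metis)
  have bd: "norm (v m - v n) \<le> norm (y m - y n) / \<bar>Im z\<bar>" for m n
  proof -
    have "(v m - v n, z *\<^sub>C (v m - v n) - (y m - y n)) \<in> T"
      using linear_operator_diff[OF T v v, of m n] by (simp add: scaleC_diff_right algebra_simps)
    from shift_bounded_below[OF sym this] show ?thesis using z by (simp add: field_simps)
  qed
  have "Cauchy v"
  proof (rule metric_CauchyI)
    fix e :: real assume e: "e > 0"
    have "Cauchy y" using y(2) by (rule LIMSEQ_imp_Cauchy)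
    then obtain N where N: "\<And>m n. m \<ge> N \<Longrightarrow> n \<ge> N \<Longrightarrow> dist (y m) (y n) < e * \<bar>Im z\<bar>"
      using metric_CauchyD[of y "e * \<bar>Im z\<bar>"] e z by auto
    show "\<exists>M. \<forall>m\<ge>M. \<forall>n\<ge>M. dist (v m) (v n) < e"
    proof (intro exI[of _ N] allI impI)
      fix m n assume "m \<ge> N" "n \<ge> N"
      then have "norm (y m - y n) / \<bar>Im z\<bar> < e" using N[of m n] z by (simp add: dist_norm field_simps)
      then show "dist (v m) (v n) < e" using bd[of m n] by (simp add: dist_norm)
    qed
  qed
  then obtain u where u: "v \<longlonglongrightarrow> u" using Cauchy_convergent_iff convergent_def by blast
  have "(u, z *\<^sub>C u - l) \<in> closure T"
    by (rule closure_pairI[OF v u]) (intro tendsto_diff tendsto_scaleC tendsto_const u y)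
  then show "l \<in> shift_range T z" using cl unfolding shift_range_def by auto
qed

text \<open>The orthogonal complement of the range consists of eigenvectors of the adjoint.\<close>

lemma shift_range_orthogonal:
  assumes "\<And>s. s \<in> shift_range T z \<Longrightarrow> cinner s w = 0"
  shows "(w, cnj z *\<^sub>C w) \<in> adjoint_op T"
proof (rule adjoint_opI)
  fix x a assume "(x, a) \<in> T"
  then have "z *\<^sub>C x - a \<in> shift_range T z" unfolding shift_range_def by (auto intro!: exI[of _ x])
  from assms[OF this] have "cinner w (z *\<^sub>C x - a) = 0" using cinner_commute[of w] by simp
  then show "cinner w a = cinner (cnj z *\<^sub>C w) x" by (simp add: cinner_simps)
qed

lemma self_adjointD:
  assumes "self_adjoint T"
  shows "linear_operator T" "closure (Domain T) = UNIV" "adjoint_op T = T" "closed T"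
  using assms closed_adjoint_op[of T] unfolding self_adjoint_def densely_defined_def by auto

lemma self_adjoint_cinner:
  "self_adjoint T \<Longrightarrow> (x, y) \<in> T \<Longrightarrow> (x', y') \<in> T \<Longrightarrow> cinner x y' = cinner y x'"
  using adjoint_opD self_adjointD(3) by metis

text \<open>The range is closed, and a vector orthogonal to it would be an eigenvector of \<open>T\<close> with the
  nonreal eigenvalue \<open>cnj z\<close>.\<close>

lemma self_adjoint_shift_range:
  assumes T: "self_adjoint T" and z: "Im z \<noteq> 0"
  shows "shift_range T z = UNIV"
proof -
  note [simp] = self_adjointD[OF T]
  have "v = 0" if "\<And>s. s \<in> shift_range T z \<Longrightarrow> cinner s v = 0" for v
  proof -
    have "(v, cnj z *\<^sub>C v - 0) \<in> T" using shift_range_orthogonal[of T z v] that by simp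
    from shift_bounded_below[OF _ this] show ?thesis using z by (simp add: mult_le_0_iff)
  qed
  then have "closure (shift_range T z) = UNIV"
    by (intro dense_if_orthogonal_trivial complex_subspace_shift_range) auto
  then show ?thesis using closed_shift_range[of T z] z by simp
qed

text \<open>The closure is again symmetric, and \<open>z\<close> minus the closure has closed, hence full, range.  Given \<open>y\<close> in the
  domain of the adjoint, some \<open>v\<close> in the domain of the closure has the same image under \<open>z - T\<^sup>*\<close>, and
  \<open>y - v\<close> is orthogonal to the range for \<open>cnj z\<close>; so \<open>y = v\<close>.\<close>

lemma essentially_self_adjointI:
  fixes T :: "('a::complex_hilbert_space \<times> 'a) set"
  assumes T: "symmetric_op T" and z: "Im z \<noteq> 0"
    and dense: "closure (shift_range T z) = UNIV" "closure (shift_range T (cnj z)) = UNIV"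
  shows "essentially_self_adjoint T"
proof -
  have lin: "linear_operator T" and dom: "closure (Domain T) = UNIV" and sym: "T \<subseteq> adjoint_op T"
    using T unfolding symmetric_op_def densely_defined_def by auto
  have sub: "closure T \<subseteq> adjoint_op T" using sym closed_adjoint_op closure_minimal by blast
  have lin': "linear_operator (closure T)"
    unfolding linear_operator_def
  proof (intro conjI allI impI)
    have add: "(x + x', y + y') \<in> closure T" if xy: "(x, y) \<in> closure T" "(x', y') \<in> closure T" for x y x' y'
    proof -
      obtain f g where "\<And>n::nat. (f n, g n) \<in> T" "f \<longlonglongrightarrow> x" "g \<longlonglongrightarrow> y" using closure_pairD[OF xy(1)] by blast
      moreover obtain f' g' where "\<And>n::nat. (f' n, g' n) \<in> T" "f' \<longlonglongrightarrow> x'" "g' \<longlonglongrightarrow> y'"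
        using closure_pairD[OF xy(2)] by blast
      ultimately show ?thesis
        by (intro closure_pairI[of "\<lambda>n. f n + f' n" "\<lambda>n. g n + g' n"] linear_operatorD(3)[OF lin] tendsto_add)
    qed
    have scale: "(c *\<^sub>C x, c *\<^sub>C y) \<in> closure T" if xy: "(x, y) \<in> closure T" for c x y
    proof -
      obtain f g where "\<And>n::nat. (f n, g n) \<in> T" "f \<longlonglongrightarrow> x" "g \<longlonglongrightarrow> y" using closure_pairD[OF xy] by blast
      then show ?thesis
        by (intro closure_pairI[of "\<lambda>n. c *\<^sub>C f n" "\<lambda>n. c *\<^sub>C g n"] linear_operatorD(4)[OF lin] tendsto_scaleC tendsto_const)
    qed
    show "(0, 0) \<in> closure T" using linear_operatorD(2)[OF lin] closure_subset by blast
    show "(x + x', y + y') \<in> closure T" if "(x, y) \<in> closure T" "(x', y') \<in> closure T" for x y x' y'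
      by (rule add[OF that])
    show "(c *\<^sub>C x, c *\<^sub>C y) \<in> closure T" if "(x, y) \<in> closure T" for c x y by (rule scale[OF that])
    show "single_valued (closure T)"
    proof (rule single_valuedI)
      fix x y y' assume "(x, y) \<in> closure T" "(x, y') \<in> closure T"
      then have "(x + (-1) *\<^sub>C x, y + (-1) *\<^sub>C y') \<in> adjoint_op T" using add scale sub by blast
      then have 0: "(0, y - y') \<in> adjoint_op T" by (simp add: scaleC_minus1)
      have "cinner s (y - y') = 0" if s: "s \<in> Domain T" for s
      proof -
        obtain w where "(s, w) \<in> T" using s by auto
        then have "cinner (y - y') s = 0" using adjoint_opD[OF 0] by fastforce
        then show ?thesis using cinner_commute[of s "y - y'"] by simp
      qed
      from orthogonal_dense_zero[OF dom this] show "y = y'" by simp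
    qed
  qed
  have sym': "closure T \<subseteq> adjoint_op (closure T)" unfolding adjoint_op_closure by (rule sub)
  have full: "shift_range (closure T) w = UNIV" if "Im w \<noteq> 0" "closure (shift_range T w) = UNIV" for w
  proof -
    have "shift_range T w \<subseteq> shift_range (closure T) w"
      using closure_subset[of T] unfolding shift_range_def by blast
    from closure_mono[OF this] show ?thesis
      using closed_shift_range[OF lin' sym' _ that(1)] that(2)
      by (simp add: top.extremum_uniqueI)
  qed
  have "adjoint_op (closure T) \<subseteq> closure T"
  proof (rule subrelI)
    fix y w assume yw: "(y, w) \<in> adjoint_op (closure T)"
    have "z *\<^sub>C y - w \<in> shift_range (closure T) z" using full[OF z dense(1)] by simp
    then obtain v where v: "(v, z *\<^sub>C v - (z *\<^sub>C y - w)) \<in> closure T" unfolding shift_range_def by auto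
    have "cinner s (y - v) = 0" if s: "s \<in> shift_range (closure T) (cnj z)" for s
    proof -
      obtain u where u: "(u, cnj z *\<^sub>C u - s) \<in> closure T" using s unfolding shift_range_def by auto
      have "cinner y (cnj z *\<^sub>C u - s) = cinner w u" by (rule adjoint_opD[OF yw u])
      then have e1: "cinner w u = cnj z * cinner y u - cinner y s" by (simp add: cinner_simps)
      have "cinner v (cnj z *\<^sub>C u - s) = cinner (z *\<^sub>C v - (z *\<^sub>C y - w)) u"
        using adjoint_opD[OF _ u] v sym' by blast
      then have e2: "- cinner v s = cinner w u - cnj z * cinner y u" by (simp add: cinner_simps)
      have "- cinner v s = - cinner y s" unfolding e2 e1 by simp
      then have "cinner (y - v) s = 0" by (simp add: cinner_simps)
      then show ?thesis using cinner_commute[of s "y - v"] by simp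
    qed
    moreover have "shift_range (closure T) (cnj z) = UNIV" using full[OF _ dense(2)] z by simp
    ultimately have "cinner (y - v) (y - v) = 0" by simp
    then have "y = v" by (simp add: cinner_self_eq_zero)
    then show "(y, w) \<in> closure T" using v by simp
  qed
  moreover have "closure (Domain (closure T)) = UNIV"
    using closure_mono[OF Domain_mono[OF closure_subset[of T]]] dom by (simp add: top.extremum_uniqueI)
  ultimately have "self_adjoint (closure T)"
    using lin' sym' unfolding self_adjoint_def densely_defined_def by blast
  then show ?thesis using T unfolding essentially_self_adjoint_def by blast
qed

text \<open>The unique \<open>v\<close> with \<open>(z - T) v = y\<close>.\<close>

definition resolvent_op :: "('a::complex_hilbert_space \<times> 'a) set \<Rightarrow> complex \<Rightarrow> 'a \<Rightarrow> 'a" where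
  "resolvent_op T z y = (THE v. (v, z *\<^sub>C v - y) \<in> T)"

context
  fixes T :: "('a::complex_hilbert_space \<times> 'a) set"
  assumes T: "self_adjoint T"
begin

lemma resolvent_op_eqI:
  assumes z: "Im z \<noteq> 0" and v: "(v, z *\<^sub>C v - y) \<in> T"
  shows "resolvent_op T z y = v"
  unfolding resolvent_op_def
proof (rule the_equality, rule v)
  fix w assume w: "(w, z *\<^sub>C w - y) \<in> T"
  have "(w - v, z *\<^sub>C (w - v) - 0) \<in> T"
    using linear_operator_diff[OF self_adjointD(1)[OF T] w v] by (simp add: scaleC_diff_right algebra_simps)
  from shift_bounded_below[OF _ this] show "w = v"
    using z self_adjointD(3)[OF T] by (simp add: mult_le_0_iff)
qed

lemma resolvent_op_in:
  assumes z: "Im z \<noteq> 0"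
  shows "(resolvent_op T z y, z *\<^sub>C resolvent_op T z y - y) \<in> T"
proof -
  have "y \<in> shift_range T z" using self_adjoint_shift_range[OF T z] by simp
  then obtain v where v: "(v, z *\<^sub>C v - y) \<in> T" unfolding shift_range_def by auto
  then show ?thesis using resolvent_op_eqI[OF z v] by simp
qed

lemma resolvent_op_shift: "Im z \<noteq> 0 \<Longrightarrow> (x, a) \<in> T \<Longrightarrow> resolvent_op T z (z *\<^sub>C x - a) = x"
  by (rule resolvent_op_eqI) auto

lemma bounded_clinear_resolvent_op:
  assumes z: "Im z \<noteq> 0"
  shows "bounded_clinear (resolvent_op T z)"
proof (rule bounded_clinearI)
  note in_T = resolvent_op_in[OF z] and lin = self_adjointD(1)[OF T]
  show "resolvent_op T z (x + y) = resolvent_op T z x + resolvent_op T z y" for x y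
    using linear_operatorD(3)[OF lin in_T[of x] in_T[of y]]
    by (intro resolvent_op_eqI[OF z]) (simp add: scaleC_add_right algebra_simps)
  show "resolvent_op T z (c *\<^sub>C x) = c *\<^sub>C resolvent_op T z x" for c x
    using linear_operatorD(4)[OF lin in_T[of x], of c]
    by (intro resolvent_op_eqI[OF z]) (simp add: scaleC_simps mult.commute)
  show "norm (resolvent_op T z x) \<le> norm x * (1 / \<bar>Im z\<bar>)" for x
    using shift_bounded_below[OF _ in_T[of x]] z self_adjointD(3)[OF T] by (simp add: field_simps)
qed

lemma resolvent_op_adjoint:
  assumes z: "Im z \<noteq> 0"
  shows "cinner (resolvent_op T z x) y = cinner x (resolvent_op T (cnj z) y)"
  using self_adjoint_cinner[OF T resolvent_op_in[OF z, of x] resolvent_op_in[of "cnj z" y]] z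
  by (simp add: cinner_simps)

lemma resolvent_identity:
  assumes z: "Im z \<noteq> 0" and w: "Im w \<noteq> 0" and "z \<noteq> w"
  shows "resolvent_op T z (resolvent_op T w y) = (1 / (z - w)) *\<^sub>C (resolvent_op T w y - resolvent_op T z y)"
proof (rule resolvent_op_eqI[OF z])
  let ?u = "resolvent_op T w y" and ?v = "resolvent_op T z y"
  have "((1 / (z - w)) *\<^sub>C (?u - ?v), (1 / (z - w)) *\<^sub>C ((w *\<^sub>C ?u - y) - (z *\<^sub>C ?v - y))) \<in> T"
    by (intro linear_operatorD(4)[OF self_adjointD(1)[OF T]] linear_operator_diff[OF self_adjointD(1)[OF T]]
        resolvent_op_in z w)
  moreover have "(1 / (z - w)) *\<^sub>C ((w *\<^sub>C ?u - y) - (z *\<^sub>C ?v - y))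
      = z *\<^sub>C (1 / (z - w)) *\<^sub>C (?u - ?v) - ?u"
  proof -
    have "?u = (1 / (z - w)) *\<^sub>C (z - w) *\<^sub>C ?u" using assms(3) by (simp add: scaleC_scaleC)
    then have "z *\<^sub>C (1 / (z - w)) *\<^sub>C (?u - ?v) - ?u
        = (1 / (z - w)) *\<^sub>C (z *\<^sub>C (?u - ?v) - (z - w) *\<^sub>C ?u)"
      by (simp add: scaleC_diff_right scaleC_scaleC mult.commute)
    then show ?thesis by (simp add: scaleC_diff_right scaleC_diff_left)
  qed
  ultimately show "((1 / (z - w)) *\<^sub>C (?u - ?v), z *\<^sub>C (1 / (z - w)) *\<^sub>C (?u - ?v) - ?u) \<in> T" by simp
qed

end


section \<open>Spectral distributions of a self-adjoint operator\<close>

lemma integral_cis_period: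
  "has_bochner_integral lborel (\<lambda>\<theta>. indicator {-pi..pi} \<theta> *\<^sub>R cis (of_int j * \<theta>))
     (if j = 0 then 2 * complex_of_real pi else 0)"
proof (cases "j = 0")
  case True
  have "has_bochner_integral lborel (\<lambda>\<theta>. indicator {-pi..pi} \<theta> *\<^sub>R (1::complex)) (complex_of_real pi - complex_of_real (-pi))"
    by (rule has_bochner_integral_FTC_Icc) (auto intro!: derivative_eq_intros has_vector_derivative_of_real)
  then show ?thesis using True by simp
next
  case False
  have "has_bochner_integral lborel (\<lambda>\<theta>. indicator {-pi..pi} \<theta> *\<^sub>R cis (of_int j * \<theta>))
     (cis (of_int j * pi) / (\<i> * of_int j) - cis (of_int j * (-pi)) / (\<i> * of_int j))"
  proof (rule has_bochner_integral_FTC_Icc)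
    fix \<theta> :: real
    have "((\<lambda>z. exp (\<i> * of_int j * z) / (\<i> * of_int j)) has_field_derivative exp (\<i> * of_int j * complex_of_real \<theta>))
        (at (complex_of_real \<theta>))"
      using False by (auto intro!: derivative_eq_intros)
    from has_vector_derivative_real_field[OF this]
    have "((\<lambda>\<theta>. cis (of_int j * \<theta>) / (\<i> * of_int j)) has_vector_derivative cis (of_int j * \<theta>)) (at \<theta>)"
      by (simp add: cis_conv_exp mult_ac)
    then show "((\<lambda>\<theta>. cis (of_int j * \<theta>) / (\<i> * of_int j)) has_vector_derivative cis (of_int j * \<theta>)) (at \<theta> within {-pi..pi})"
      by (rule has_vector_derivative_at_within)
  next
    show "continuous_on {-pi..pi} (\<lambda>\<theta>. cis (of_int j * \<theta>))"
      by (intro continuous_intros)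
  qed simp
  moreover have "cis (of_int j * pi) = cis (of_int j * (-pi))"
    using sin_zero_iff_int2 by (auto simp: complex_eq_iff) 
  ultimately show ?thesis using False by simp
qed

lemma isometry_power_cinner:
  assumes iso: "\<And>x y. cinner (U x) (U y) = cinner x y"
  shows "cinner ((U ^^ k) x) ((U ^^ (k + m)) x) = cinner x ((U ^^ m) x)"
  by (induction k) (simp_all add: iso)

text \<open>Herglotz' theorem for the powers of an isometry.  The Fejer densities
  \<open>\<parallel>\<Sum>k<N. e\<^bsup>-ik\<theta>\<^esup> U\<^sup>k x\<parallel>\<^sup>2 / (2\<pi>N)\<close> on \<open>[-\<pi>, \<pi>]\<close> are positive.  Expanding the square, their Fourier
  coefficient of order \<open>m\<close> is \<open>(1 - m / N) \<langle>x, U\<^sup>m x\<rangle>\<close>, which converges to \<open>\<langle>x, U\<^sup>m x\<rangle>\<close>; Helly's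
  selection theorem supplies a weak limit.\<close>

lemma Herglotz_isometry:
  fixes U :: "'a::complex_hilbert_space \<Rightarrow> 'a"
  assumes iso: "\<And>x y. cinner (U x) (U y) = cinner x y" and x: "norm x = 1"
  shows "\<exists>\<nu>. real_distribution \<nu> \<and> (\<forall>m. (\<integral>\<theta>. cis (real m * \<theta>) \<partial>\<nu>) = cinner x ((U ^^ m) x))"
proof -
  define p where "p N \<theta> = (norm (\<Sum>k<N. cis (- real k * \<theta>) *\<^sub>C (U ^^ k) x))\<^sup>2 / (2 * pi * real N)" for N \<theta>
  define q where "q N \<theta> = p N \<theta> * indicator {-pi..pi} \<theta>" for N \<theta>
  have p_expand: "complex_of_real (p N \<theta>) * cis (real m * \<theta>) = (\<Sum>k<N. \<Sum>l<N.
      cis (of_int (int k + int m - int l) * \<theta>) * (cinner ((U ^^ k) x) ((U ^^ l) x) / complex_of_real (2 * pi * real N)))"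
    for N m \<theta>
  proof -
    have "complex_of_real (p N \<theta>) = (\<Sum>k<N. \<Sum>l<N. cis (real k * \<theta>) * cis (- real l * \<theta>) *
       cinner ((U ^^ k) x) ((U ^^ l) x)) / complex_of_real (2 * pi * real N)"
    proof -
      have "cinner (\<Sum>k<N. cis (- real k * \<theta>) *\<^sub>C (U ^^ k) x) (\<Sum>l<N. cis (- real l * \<theta>) *\<^sub>C (U ^^ l) x)
        = (\<Sum>k<N. \<Sum>l<N. cis (real k * \<theta>) * cis (- real l * \<theta>) * cinner ((U ^^ k) x) ((U ^^ l) x))"
        unfolding cinner_sum_left unfolding cinner_sum_right
        by (intro sum.cong refl) (simp add: cinner_simps cis_cnj mult_ac)
      then show ?thesis unfolding p_def of_real_divide cinner_self[symmetric] by simp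
    qed
    moreover have "cis (real k * \<theta>) * cis (- real l * \<theta>) * cis (real m * \<theta>) = cis (of_int (int k + int m - int l) * \<theta>)" for k l
      by (simp add: cis_mult algebra_simps)
    ultimately show ?thesis
      by (simp add: sum_divide_distrib sum_distrib_right) (intro sum.cong refl, simp add: mult_ac)
  qed
  \<comment> \<open>Only the pairs with \<open>l = k + m\<close> survive the integration over a period; there are \<open>N - m\<close> of them
    (none if \<open>m > N\<close>, in agreement with truncated subtraction).\<close>
  have integral_q: "has_bochner_integral lborel (\<lambda>\<theta>. complex_of_real (q N \<theta>) * cis (real m * \<theta>))
      (complex_of_real (real (N - m) / real N) * cinner x ((U ^^ m) x))" if N: "N > 0" for N m
  proof -
    have "has_bochner_integral lborel (\<lambda>\<theta>. \<Sum>k<N. \<Sum>l<N.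
        (indicator {-pi..pi} \<theta> *\<^sub>R cis (of_int (int k + int m - int l) * \<theta>)) *
        (cinner ((U ^^ k) x) ((U ^^ l) x) / complex_of_real (2 * pi * real N)))
      (\<Sum>k<N. \<Sum>l<N. (if int k + int m - int l = 0 then 2 * complex_of_real pi else 0) *
        (cinner ((U ^^ k) x) ((U ^^ l) x) / complex_of_real (2 * pi * real N)))"
      by (intro has_bochner_integral_sum has_bochner_integral_mult_left integral_cis_period)
    moreover have "(\<lambda>\<theta>. complex_of_real (q N \<theta>) * cis (real m * \<theta>)) = (\<lambda>\<theta>. \<Sum>k<N. \<Sum>l<N.
        (indicator {-pi..pi} \<theta> *\<^sub>R cis (of_int (int k + int m - int l) * \<theta>)) *
        (cinner ((U ^^ k) x) ((U ^^ l) x) / complex_of_real (2 * pi * real N)))"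
    proof
      fix \<theta>
      show "complex_of_real (q N \<theta>) * cis (real m * \<theta>) = (\<Sum>k<N. \<Sum>l<N.
        (indicator {-pi..pi} \<theta> *\<^sub>R cis (of_int (int k + int m - int l) * \<theta>)) *
        (cinner ((U ^^ k) x) ((U ^^ l) x) / complex_of_real (2 * pi * real N)))"
        using p_expand[of N \<theta> m] by (cases "\<theta> \<in> {-pi..pi}") (auto simp: q_def)
    qed
    moreover have "(\<Sum>k<N. \<Sum>l<N. (if int k + int m - int l = 0 then 2 * complex_of_real pi else 0) *
        (cinner ((U ^^ k) x) ((U ^^ l) x) / complex_of_real (2 * pi * real N)))
      = complex_of_real (real (N - m) / real N) * cinner x ((U ^^ m) x)"
    proof -
      have "(\<Sum>l<N. (if int k + int m - int l = 0 then 2 * complex_of_real pi else 0) *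
        (cinner ((U ^^ k) x) ((U ^^ l) x) / complex_of_real (2 * pi * real N)))
        = (if k + m < N then cinner x ((U ^^ m) x) / of_nat N else 0)" for k
      proof -
        have "(\<Sum>l<N. (if int k + int m - int l = 0 then 2 * complex_of_real pi else 0) *
            (cinner ((U ^^ k) x) ((U ^^ l) x) / complex_of_real (2 * pi * real N)))
          = (\<Sum>l<N. if l = k + m then cinner x ((U ^^ m) x) / of_nat N else 0)"
          by (intro sum.cong refl) (auto simp: isometry_power_cinner[OF iso])
        then show ?thesis by simp
      qed
      then have "(\<Sum>k<N. \<Sum>l<N. (if int k + int m - int l = 0 then 2 * complex_of_real pi else 0) *
        (cinner ((U ^^ k) x) ((U ^^ l) x) / complex_of_real (2 * pi * real N)))
        = (\<Sum>k<N. if k + m < N then cinner x ((U ^^ m) x) / of_nat N else 0)" by simp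
      also have "\<dots> = (\<Sum>k\<in>{..<N-m}. cinner x ((U ^^ m) x) / of_nat N)"
        by (rule sum.mono_neutral_cong_right) auto
      finally show ?thesis by simp
    qed
    ultimately show ?thesis by simp
  qed
  have q0: "q N \<theta> \<ge> 0" for N \<theta> unfolding q_def p_def by (auto simp: indicator_def)
  have q1: "has_bochner_integral lborel (q N) 1" if "N > 0" for N
  proof -
    have "has_bochner_integral lborel (\<lambda>\<theta>. complex_of_real (q N \<theta>)) 1"
      using integral_q[OF that, of 0] that x by (simp add: cinner_self)
    from has_bochner_integral_Re[OF this] show ?thesis by simp
  qed
  have qm: "q N \<in> borel_measurable borel" for N
  proof (cases "N = 0")
    case True
    then have "q N = (\<lambda>_. 0)" by (auto simp: q_def p_def)
    then show ?thesis by simp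
  next
    case False
    then show ?thesis using borel_measurable_has_bochner_integral[OF q1[of N]] by simp
  qed
  define \<mu> where "\<mu> n = density lborel (\<lambda>\<theta>. ennreal (q (Suc n) \<theta>))" for n
  have emeasure_\<mu>: "emeasure (\<mu> n) UNIV = 1" for n
  proof -
    have "(\<integral>\<^sup>+\<theta>. ennreal (q (Suc n) \<theta>) \<partial>lborel) = ennreal 1"
      using q1[of "Suc n"] q0 by (auto simp: has_bochner_integral_iff nn_integral_eq_integral)
    then show ?thesis using qm[of "Suc n"] by (simp add: \<mu>_def emeasure_density)
  qed
  have \<mu>_borel: "space (\<mu> n) = UNIV" "sets (\<mu> n) = sets borel" for n by (simp_all add: \<mu>_def)
  have rd: "real_distribution (\<mu> n)" for n
    unfolding real_distribution_def real_distribution_axioms_def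
    by (auto intro!: prob_spaceI simp: emeasure_\<mu> \<mu>_borel)
  have integral_\<mu>: "(\<integral>\<theta>. cis (real m * \<theta>) \<partial>\<mu> n) = complex_of_real (real (Suc n - m) / real (Suc n)) * cinner x ((U ^^ m) x)" for m n
  proof -
    have "(\<integral>\<theta>. cis (real m * \<theta>) \<partial>\<mu> n) = (\<integral>\<theta>. q (Suc n) \<theta> *\<^sub>R cis (real m * \<theta>) \<partial>lborel)"
      unfolding \<mu>_def
    proof (rule integral_density)
      show "(\<lambda>\<theta>. cis (real m * \<theta>)) \<in> borel_measurable lborel"
        by (auto intro!: borel_measurable_continuous_onI continuous_intros)
    qed (use qm q0 in auto)
    then show ?thesis
      using has_bochner_integral_integral_eq[OF integral_q[of "Suc n" m]] by (simp add: scaleR_conv_of_real)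
  qed
  have "tight \<mu>"
    unfolding tight_def
  proof (intro conjI allI impI)
    fix \<epsilon> :: real assume "\<epsilon> > 0"
    have "measure (\<mu> n) {-4<..4} = 1" for n
    proof -
      have "emeasure (\<mu> n) {-4<..4} = (\<integral>\<^sup>+\<theta>. ennreal (q (Suc n) \<theta>) * indicator {-4<..4} \<theta> \<partial>lborel)"
        unfolding \<mu>_def using qm by (intro emeasure_density) auto
      also have "\<dots> = (\<integral>\<^sup>+\<theta>. ennreal (q (Suc n) \<theta>) \<partial>lborel)"
        using pi_less_4 by (intro nn_integral_cong) (auto simp: q_def indicator_def)
      also have "\<dots> = emeasure (\<mu> n) UNIV"
        unfolding \<mu>_def using qm by (subst emeasure_density) auto
      finally show ?thesis by (simp add: emeasure_\<mu> measure_def)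
    qed
    then show "\<exists>a b. a < b \<and> (\<forall>n. 1 - \<epsilon> < measure (\<mu> n) {a<..b})"
      using \<open>\<epsilon> > 0\<close> by (intro exI[of _ "-4"] exI[of _ 4]) simp
  qed (rule rd)
  then obtain r \<nu> where r: "strict_mono (r :: nat \<Rightarrow> nat)" and \<nu>: "real_distribution \<nu>" and w: "weak_conv_m (\<mu> \<circ> r) \<nu>"
    using tight_imp_convergent_subsubsequence[of \<mu> id] by (auto simp: strict_mono_def o_def)
  have "(\<integral>\<theta>. cis (real m * \<theta>) \<partial>\<nu>) = cinner x ((U ^^ m) x)" for m
  proof -
    have "(\<lambda>n. \<integral>\<theta>. cis (real m * \<theta>) \<partial>(\<mu> \<circ> r) n) \<longlonglongrightarrow> (\<integral>\<theta>. cis (real m * \<theta>) \<partial>\<nu>)"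
    proof (rule weak_conv_imp_integral_bdd_continuous_conv[OF _ \<nu> w, where B = 1])
      have "continuous_on UNIV (\<lambda>\<theta>. cis (real m * \<theta>))" by (intro continuous_intros)
      then show "isCont (\<lambda>\<theta>. cis (real m * \<theta>)) \<theta>" for \<theta> by (simp add: continuous_on_eq_continuous_at)
    qed (auto simp: rd)
    moreover have "(\<lambda>n. \<integral>\<theta>. cis (real m * \<theta>) \<partial>(\<mu> \<circ> r) n) \<longlonglongrightarrow> complex_of_real 1 * cinner x ((U ^^ m) x)"
    proof -
      have "(\<lambda>n. real (Suc n - m) / real (Suc n)) \<longlonglongrightarrow> 1"
      proof (rule Lim_transform_eventually)
        show "(\<lambda>n. (real (Suc n) - real m) / real (Suc n)) \<longlonglongrightarrow> 1" by real_asymp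
        show "\<forall>\<^sub>F n in sequentially. (real (Suc n) - real m) / real (Suc n) = real (Suc n - m) / real (Suc n)"
          using eventually_ge_at_top[of m] by eventually_elim (simp add: of_nat_diff)
      qed
      then have "(\<lambda>n. complex_of_real (real (Suc n - m) / real (Suc n)) * cinner x ((U ^^ m) x)) \<longlonglongrightarrow> complex_of_real 1 * cinner x ((U ^^ m) x)"
        by (intro tendsto_mult tendsto_of_real tendsto_const)
      from LIMSEQ_subseq_LIMSEQ[OF this r] show ?thesis by (simp add: integral_\<mu> o_def)
    qed
    ultimately show ?thesis using LIMSEQ_unique by fastforce
  qed
  then show ?thesis using \<nu> by blast
qed


text \<open>The averages are contractions, and on a vector \<open>y - U y\<close> the sum telescopes to
  \<open>y - U\<^sup>N y\<close>, whose norm is at most \<open>2 \<parallel>y\<parallel>\<close>.\<close>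

lemma mean_ergodic_zero:
  fixes U :: "'a::complex_hilbert_space \<Rightarrow> 'a"
  assumes U: "bounded_clinear U" and iso: "\<And>x y. cinner (U x) (U y) = cinner x y"
    and dense: "closure (range (\<lambda>y. y - U y)) = UNIV"
  shows "(\<lambda>N. (1 / real N) *\<^sub>R (\<Sum>n<N. (U ^^ n) x)) \<longlonglongrightarrow> 0"
proof -
  have nU: "norm ((U ^^ n) y) = norm y" for n y
  proof (induction n)
    case (Suc n)
    have "norm (U v) = norm v" for v
      by (rule norm_eq_if_cinner_eq) (rule iso)
    then show ?case using Suc by simp
  qed simp
  have U_diff: "(U ^^ n) (x - y) = (U ^^ n) x - (U ^^ n) y" for n x y
    by (induction n) (simp_all add: bounded_clinearD[OF U])
  define A where "A N x = (1 / real N) *\<^sub>R (\<Sum>n<N. (U ^^ n) x)" for N x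
  have A_le: "norm (A N y) \<le> norm y" for N y
  proof (cases "N = 0")
    case False
    have "norm (\<Sum>n<N. (U ^^ n) y) \<le> real N * norm y"
      using sum_norm_le[of "{..<N}" "\<lambda>n. (U ^^ n) y" "\<lambda>_. norm y"] by (simp add: nU)
    then show ?thesis using False by (simp add: A_def field_simps)
  qed (simp add: A_def)
  have A_diff: "A N (x - y) = A N x - A N y" for N x y
    by (simp add: A_def U_diff sum_subtractf scaleR_diff_right)
  have tele: "norm (A N (y - U y)) \<le> 2 * norm y / real N" for N y
  proof -
    have "(\<Sum>n<N. (U ^^ n) (y - U y)) = y - (U ^^ N) y"
      by (induction N) (simp_all add: U_diff funpow_swap1)
    then have "norm (A N (y - U y)) = norm (y - (U ^^ N) y) / real N"
      by (simp add: A_def)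
    also have "\<dots> \<le> (norm y + norm ((U ^^ N) y)) / real N"
      by (intro divide_right_mono norm_triangle_ineq4) simp
    finally show ?thesis by (simp add: nU)
  qed
  have "(\<lambda>N. A N x) \<longlonglongrightarrow> 0"
  proof (rule LIMSEQ_I)
    fix e :: real assume e: "e > 0"
    have "x \<in> closure (range (\<lambda>y. y - U y))" using dense by simp
    then obtain y where y: "dist (y - U y) x < e / 2"
      using e unfolding closure_approachable by (metis (no_types, lifting) half_gt_zero imageE)
    have "\<forall>\<^sub>F N in sequentially. 2 * norm y / real N < e / 2" using e by real_asymp
    then obtain N0 where N0: "\<And>N. N \<ge> N0 \<Longrightarrow> 2 * norm y / real N < e / 2"
      by (auto simp: eventually_sequentially)
    show "\<exists>no. \<forall>n\<ge>no. norm (A n x - 0) < e"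
    proof (intro exI[of _ N0] allI impI)
      fix N assume N: "N \<ge> N0"
      have "A N x = A N (x - (y - U y)) + A N (y - U y)" by (simp add: A_diff)
      then have "norm (A N x) \<le> norm (x - (y - U y)) + 2 * norm y / real N"
        using norm_triangle_mono[OF A_le tele] by metis
      then show "norm (A N x - 0) < e" using N0[OF N] y by (simp add: dist_norm norm_minus_commute)
    qed
  qed
  then show ?thesis by (simp add: A_def)
qed

text \<open>The Cayley transform \<open>(T - \<i>) (T + \<i>)\<^sup>-\<^sup>1 = 1 - 2 \<i> (T + \<i>)\<^sup>-\<^sup>1\<close>; the sign changes because
  \<open>resolvent_op T (- \<i>)\<close> is the inverse of \<open>- \<i> - T\<close>.\<close>

definition cayley :: "('a::complex_hilbert_space \<times> 'a) set \<Rightarrow> 'a \<Rightarrow> 'a" where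
  "cayley T y = y + (2 * \<i>) *\<^sub>C resolvent_op T (- \<i>) y"

text \<open>The real number \<open>t\<close> with \<open>e\<^bsup>i\<theta>\<^esup> = (t - \<i>) / (t + \<i>)\<close>.  The point \<open>e\<^bsup>i\<theta>\<^esup> = 1\<close> corresponds to
  infinity; there the formula has the value \<open>0\<close>, on a set that will have measure zero.\<close>

definition line_coordinate :: "real \<Rightarrow> real" where
  "line_coordinate \<theta> = Re (\<i> * (1 + cis \<theta>) / (1 - cis \<theta>))"

lemma line_coordinate_measurable [measurable]: "line_coordinate \<in> borel_measurable borel"
proof -
  have [measurable]: "cis \<in> borel_measurable borel"
    by (auto intro!: borel_measurable_continuous_onI continuous_intros)
  show ?thesis unfolding line_coordinate_def[abs_def] by measurable
qed

lemma Cauchy_kernel_line_coordinate: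
  assumes "cis \<theta> \<noteq> 1"
  shows "1 / (z - complex_of_real (line_coordinate \<theta>)) = (1 - cis \<theta>) / ((z - \<i>) - (z + \<i>) * cis \<theta>)"
proof -
  define w where "w = cis \<theta>"
  have w: "w \<noteq> 1" "w \<noteq> 0" "cnj w = 1 / w"
    using assms by (auto simp: w_def cis_cnj divide_simps simp flip: cis_inverse)
  define t where "t = \<i> * (1 + w) / (1 - w)"
  have "cnj t = t"
    using w by (simp add: t_def divide_simps) (simp add: algebra_simps)
  then have "complex_of_real (line_coordinate \<theta>) = t"
    unfolding line_coordinate_def w_def[symmetric] t_def[symmetric]
    by (metis Reals_cnj_iff of_real_Re)
  moreover have "z - t = ((z - \<i>) - (z + \<i>) * w) / (1 - w)"
    using w by (simp add: t_def divide_simps) (simp add: algebra_simps)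
  ultimately show ?thesis unfolding w_def[symmetric] by simp
qed

context
  fixes T :: "('a::complex_hilbert_space \<times> 'a) set"
  assumes T: "self_adjoint T"
begin

lemma bounded_clinear_cayley: "bounded_clinear (cayley T)"
  unfolding cayley_def[abs_def]
  by (intro bounded_clinear_add bounded_clinear_id bounded_clinear_scaleC bounded_clinear_resolvent_op[OF T]) simp

text \<open>With \<open>a = T v\<close>, the Cayley transform sends \<open>-(a + \<i> v)\<close> to \<open>-(a - \<i> v)\<close>; by symmetry of \<open>T\<close> the mixed terms
  cancel in both inner products.\<close>

lemma cayley_isometry: "cinner (cayley T x) (cayley T y) = cinner x y"
proof -
  define v w where "v = resolvent_op T (- \<i>) x" and "w = resolvent_op T (- \<i>) y"
  define a b where "a = (- \<i>) *\<^sub>C v - x" and "b = (- \<i>) *\<^sub>C w - y"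
  have "(v, a) \<in> T" "(w, b) \<in> T" unfolding a_def b_def v_def w_def by (rule resolvent_op_in[OF T], simp)+
  then have sym: "cinner v b = cinner a w" by (rule self_adjoint_cinner[OF T])
  have x: "x = - (a + \<i> *\<^sub>C v)" "y = - (b + \<i> *\<^sub>C w)" by (auto simp: a_def b_def scaleC_minus_left)
  have two: "(2 * \<i>) *\<^sub>C u = \<i> *\<^sub>C u + \<i> *\<^sub>C u" for u :: 'a
    by (simp add: scaleC_add_left[symmetric])
  have cx: "cayley T x = - (a - \<i> *\<^sub>C v)" "cayley T y = - (b - \<i> *\<^sub>C w)"
    unfolding cayley_def v_def[symmetric] w_def[symmetric] two by (simp_all add: x)
  have "cinner (cayley T x) (cayley T y) = cinner a b + cinner v w"
    unfolding cx by (simp add: cinner_simps sym algebra_simps)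
  also have "\<dots> = cinner x y"
    by (subst x(1), subst x(2)) (simp add: cinner_simps sym algebra_simps)
  finally show ?thesis .
qed

text \<open>The range of \<open>1 - U\<close> contains the domain of \<open>T\<close>.\<close>

lemma cayley_range_dense: "closure (range (\<lambda>y. y - cayley T y)) = UNIV"
proof -
  have "Domain T \<subseteq> range (\<lambda>y. y - cayley T y)"
  proof
    fix x assume "x \<in> Domain T"
    then obtain a where a: "(x, a) \<in> T" by auto
    define u where "u = (1 / (-2 * \<i>)) *\<^sub>C x"
    have "(u, (1 / (-2 * \<i>)) *\<^sub>C a) \<in> T" unfolding u_def by (rule linear_operatorD(4)[OF self_adjointD(1)[OF T] a])
    from resolvent_op_shift[OF T _ this, of "- \<i>"]
    have "resolvent_op T (- \<i>) ((- \<i>) *\<^sub>C u - (1 / (-2 * \<i>)) *\<^sub>C a) = u" by simp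
    then have "x = ((- \<i>) *\<^sub>C u - (1 / (-2 * \<i>)) *\<^sub>C a) - cayley T ((- \<i>) *\<^sub>C u - (1 / (-2 * \<i>)) *\<^sub>C a)"
      unfolding cayley_def by (simp add: u_def scaleC_scaleC scaleC_minus_left[symmetric])
    then show "x \<in> range (\<lambda>y. y - cayley T y)" by blast
  qed
  from closure_mono[OF this] show ?thesis
    using self_adjointD(2)[OF T] by (simp add: top.extremum_uniqueI)
qed

text \<open>In the lower half-plane the Cauchy kernel is a geometric series in \<open>e\<^bsup>i\<theta>\<^esup>\<close>, and the resolvent
  is the same series in the Cayley transform.\<close>

lemma resolvent_cayley_series:
  assumes z: "Im z < 0" and q: "q = (z + \<i>) / (z - \<i>)"
  shows "cmod q < 1" and "z \<noteq> \<i>"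
    and "(\<lambda>n. q ^ n *\<^sub>C ((cayley T ^^ n) x - (cayley T ^^ Suc n) x)) sums ((z - \<i>) *\<^sub>C resolvent_op T z x)"
proof -
  show zi: "z \<noteq> \<i>" using z by auto
  have "(cmod (z + \<i>))\<^sup>2 < (cmod (z - \<i>))\<^sup>2"
    unfolding cmod_power2 using z by (simp add: power2_eq_square algebra_simps)
  then have "cmod (z + \<i>) < cmod (z - \<i>)" by (rule power_less_imp_less_base) simp
  then show q1: "cmod q < 1" using zi by (simp add: q norm_divide)
  let ?U = "cayley T"
  note U = bounded_clinear_cayley
  have nU: "norm ((?U ^^ n) x) = norm x" for n
    using isometry_power_cinner[OF cayley_isometry, of n x 0] by (intro norm_eq_if_cinner_eq) simp
  have "summable (\<lambda>n. q ^ n *\<^sub>C (?U ^^ n) x)"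
  proof (rule summable_comparison_test')
    show "summable (\<lambda>n. cmod q ^ n * norm x)" using q1 by (intro summable_mult2 summable_geometric) simp
    show "norm (q ^ n *\<^sub>C (?U ^^ n) x) \<le> cmod q ^ n * norm x" for n
      by (simp add: norm_scaleC norm_power nU)
  qed
  then obtain s where s: "(\<lambda>n. q ^ n *\<^sub>C (?U ^^ n) x) sums s" by (auto simp: summable_def)
  have bl: "bounded_linear ?U" using U by (simp add: bounded_clinear_def)
  have Us: "(\<lambda>n. q ^ n *\<^sub>C (?U ^^ Suc n) x) sums ?U s"
    using bounded_linear.sums[OF bl s] by (simp add: bounded_clinearD[OF U])
  have "(\<lambda>n. q ^ Suc n *\<^sub>C (?U ^^ Suc n) x) sums (q *\<^sub>C ?U s)"
    using bounded_linear.sums[OF bounded_bilinear.bounded_linear_right[OF bounded_bilinear_scaleC, of q] Us]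
    by (simp add: scaleC_scaleC)
  moreover have "(\<lambda>n. q ^ Suc n *\<^sub>C (?U ^^ Suc n) x) sums (s - x)"
    using s by (subst sums_Suc_iff) simp
  ultimately have xs: "x = s - q *\<^sub>C ?U s" using sums_unique2 by fastforce
  define r where "r = resolvent_op T (- \<i>) s"
  have Ur: "?U s = s + (2 * \<i>) *\<^sub>C r" by (simp add: cayley_def r_def)
  have "(r, (- \<i>) *\<^sub>C r - s) \<in> T" unfolding r_def by (rule resolvent_op_in[OF T]) simp
  define c where "c = - 2 * \<i> / (z - \<i>)"
  have "(c *\<^sub>C r, c *\<^sub>C ((- \<i>) *\<^sub>C r - s)) \<in> T"
    by (rule linear_operatorD(4)[OF self_adjointD(1)[OF T]]) fact
  moreover have "c *\<^sub>C ((- \<i>) *\<^sub>C r - s) = z *\<^sub>C c *\<^sub>C r - x"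
  proof -
    have coeff: "c * (- \<i>) = z * c + q * (2 * \<i>)" "- c = q - 1"
      using zi by (auto simp: c_def q divide_simps) (simp add: algebra_simps)
    have "c *\<^sub>C ((- \<i>) *\<^sub>C r - s) = (c * (- \<i>)) *\<^sub>C r + (- c) *\<^sub>C s"
      by (simp add: scaleC_diff_right scaleC_scaleC scaleC_minus_left scaleC_minus_right)
    also have "\<dots> = z *\<^sub>C c *\<^sub>C r - x"
      unfolding coeff xs Ur by (simp add: scaleC_simps algebra_simps)
    finally show ?thesis .
  qed
  ultimately have "resolvent_op T z x = c *\<^sub>C r"
    using z by (intro resolvent_op_eqI[OF T]) auto
  then have "(z - \<i>) *\<^sub>C resolvent_op T z x = ((z - \<i>) * c) *\<^sub>C r" by (simp add: scaleC_scaleC)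
  also have "\<dots> = s - ?U s" using zi by (simp add: c_def Ur scaleC_minus_left)
  finally have res: "(z - \<i>) *\<^sub>C resolvent_op T z x = s - ?U s" .
  have "(\<lambda>n. q ^ n *\<^sub>C (?U ^^ n) x - q ^ n *\<^sub>C (?U ^^ Suc n) x) sums (s - ?U s)"
    by (intro sums_diff s Us)
  then show "(\<lambda>n. q ^ n *\<^sub>C ((?U ^^ n) x - (?U ^^ Suc n) x)) sums ((z - \<i>) *\<^sub>C resolvent_op T z x)"
    unfolding res by (simp add: scaleC_diff_right)
qed

text \<open>The measure is that of Herglotz' theorem for the Cayley transform \<open>U\<close>, carried to the line.  Nothing is
  lost at infinity: the averages of \<open>e\<^bsup>in\<theta>\<^esup>\<close> converge to the indicator of \<open>e\<^bsup>i\<theta>\<^esup> = 1\<close>, whose integral is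
  therefore the limit of averages of \<open>\<langle>x, U\<^sup>n x\<rangle>\<close>, and this is zero because \<open>1 - U\<close> has dense range.
  The Cauchy transform in the lower half-plane is then found by integrating the geometric series
  term by term, and the upper half-plane follows by conjugation.\<close>

lemma spectral_distribution_unit:
  assumes x: "norm x = 1"
  shows "\<exists>M. real_distribution M \<and> (\<forall>z. Im z \<noteq> 0 \<longrightarrow>
    (\<integral>t. 1 / (z - complex_of_real t) \<partial>M) = cinner x (resolvent_op T z x))"
proof -
  let ?U = "cayley T"
  obtain \<nu> where rd: "real_distribution \<nu>" and moment: "\<And>m. (\<integral>\<theta>. cis (real m * \<theta>) \<partial>\<nu>) = cinner x ((?U ^^ m) x)"
    using Herglotz_isometry[OF cayley_isometry x] by auto
  interpret \<nu>: real_distribution \<nu> by fact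
  have L: "sigma_functional (\<lambda>h. \<integral>\<theta>. h \<theta> \<partial>\<nu>)"
    by (rule sigma_functional_integral) (auto intro: \<nu>.finite_measure_axioms)
  have cis_bb: "bounded_borel (\<lambda>\<theta>. cis (r * \<theta>))" for r
    by (rule bounded_borelI[where C = 1]) (auto intro!: borel_measurable_continuous_onI continuous_intros)
  have sum_cis: "(\<integral>\<theta>. (\<Sum>n<N. c n * cis (real (k n) * \<theta>)) \<partial>\<nu>) = (\<Sum>n<N. c n * cinner x ((?U ^^ k n) x))"
    for c :: "nat \<Rightarrow> complex" and k :: "nat \<Rightarrow> nat" and N
    by (subst sigma_functional_sum[OF L])
      (auto simp: moment intro!: bounded_borel_scale cis_bb)
  have cis1: "{\<theta>. cis \<theta> = 1} \<in> sets borel"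
    by (intro borel_closed closed_Collect_eq continuous_intros)
  have geom_cis: "(\<Sum>n<N. cis (real n * \<theta>)) = (\<Sum>n<N. cis \<theta> ^ n)" for N \<theta>
    by (intro sum.cong refl) (rule Complex.DeMoivre[symmetric])
  have "(\<lambda>N. \<integral>\<theta>. (\<Sum>n<N. (1 / of_nat N) * cis (real n * \<theta>)) \<partial>\<nu>) \<longlonglongrightarrow> (\<integral>\<theta>. indicator {\<theta>. cis \<theta> = 1} \<theta> \<partial>\<nu>)"
  proof (rule sigma_functionalD(3)[OF L, where C = 1])
    show "(\<lambda>\<theta>. \<Sum>n<N. (1 / of_nat N) * cis (real n * \<theta>)) \<in> borel_measurable borel" for N
      by (intro bounded_borel_measurable bounded_borel_sum bounded_borel_scale cis_bb)
    show "cmod (\<Sum>n<N. (1 / of_nat N) * cis (real n * \<theta>)) \<le> 1" for N \<theta>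
      using sum_norm_le[of "{..<N}" "\<lambda>n. (1 / of_nat N) * cis (real n * \<theta>)" "\<lambda>_. 1 / real N"]
      by (cases "N = 0") (auto simp: norm_mult norm_divide)
    show "(\<lambda>N. \<Sum>n<N. (1 / of_nat N) * cis (real n * \<theta>)) \<longlonglongrightarrow> indicator {\<theta>. cis \<theta> = 1} \<theta>" for \<theta>
    proof (cases "cis \<theta> = 1")
      case True
      have "\<forall>\<^sub>F N in sequentially. (\<Sum>n<N. (1 / of_nat N) * cis (real n * \<theta>)) = (1::complex)"
        using eventually_gt_at_top[of 0]
        by eventually_elim (use True in \<open>simp add: Complex.DeMoivre[symmetric] sum_divide_distrib[symmetric]\<close>)
      then show ?thesis using True by (simp add: tendsto_eventually)
    next
      case False
      have "(\<lambda>N. \<Sum>n<N. (1 / of_nat N) * cis (real n * \<theta>)) \<longlonglongrightarrow> 0"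
      proof (rule Lim_null_comparison)
        show "\<forall>\<^sub>F N in sequentially. cmod (\<Sum>n<N. (1 / of_nat N) * cis (real n * \<theta>)) \<le> (2 / cmod (cis \<theta> - 1)) * (1 / real N)"
        proof (intro always_eventually allI)
          fix N
          have "(\<Sum>n<N. cis (real n * \<theta>)) = (cis \<theta> ^ N - 1) / (cis \<theta> - 1)"
            unfolding geom_cis using False by (rule geometric_sum)
          then have "cmod (\<Sum>n<N. cis (real n * \<theta>)) \<le> 2 / cmod (cis \<theta> - 1)"
            using norm_triangle_ineq4[of "cis \<theta> ^ N" 1] by (simp add: norm_divide norm_power divide_right_mono)
          then have "(1 / real N) * cmod (\<Sum>n<N. cis (real n * \<theta>)) \<le> (1 / real N) * (2 / cmod (cis \<theta> - 1))"
            by (rule mult_left_mono) simp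
          then show "cmod (\<Sum>n<N. (1 / of_nat N) * cis (real n * \<theta>)) \<le> (2 / cmod (cis \<theta> - 1)) * (1 / real N)"
            unfolding sum_distrib_left[symmetric] norm_mult by (simp add: norm_divide mult.commute)
        qed
        show "(\<lambda>N. (2 / cmod (cis \<theta> - 1)) * (1 / real N)) \<longlonglongrightarrow> 0"
          by (rule tendsto_mult_right_zero) (rule lim_1_over_n)
      qed
      then show ?thesis using False by simp
    qed
  qed
  moreover have "(\<lambda>N. \<integral>\<theta>. (\<Sum>n<N. (1 / of_nat N) * cis (real n * \<theta>)) \<partial>\<nu>) \<longlonglongrightarrow> 0"
  proof -
    have "(\<lambda>N. cinner x ((1 / real N) *\<^sub>R (\<Sum>n<N. (?U ^^ n) x))) \<longlonglongrightarrow> cinner x 0"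
      by (intro tendsto_cinner tendsto_const mean_ergodic_zero bounded_clinear_cayley cayley_isometry cayley_range_dense)
    moreover have "cinner x ((1 / real N) *\<^sub>R (\<Sum>n<N. (?U ^^ n) x)) = (\<integral>\<theta>. (\<Sum>n<N. (1 / of_nat N) * cis (real n * \<theta>)) \<partial>\<nu>)" for N
      using sum_cis[of "\<lambda>_. 1 / of_nat N" "\<lambda>n. n" N]
      by (simp add: scaleC_of_real[symmetric] cinner_scaleC_right cinner_sum_right sum_divide_distrib)
    ultimately show ?thesis by simp
  qed
  ultimately have "(\<integral>\<theta>. indicator {\<theta>. cis \<theta> = 1} \<theta> \<partial>\<nu>) = (0::complex)" using LIMSEQ_unique by blast
  then have "complex_of_real (measure \<nu> {\<theta>. cis \<theta> = 1}) = 0"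
    using cis1 by (simp add: complex_integral_indicator)
  then have "emeasure \<nu> {\<theta>. cis \<theta> = 1} = 0" by (simp add: \<nu>.emeasure_eq_measure)
  then have AE1: "AE \<theta> in \<nu>. cis \<theta> \<noteq> 1"
    using cis1 by (intro AE_I[of _ _ "{\<theta>. cis \<theta> = 1}"]) auto
  define M where "M = distr \<nu> borel line_coordinate"
  have rdM: "real_distribution M"
    unfolding M_def by (rule \<nu>.real_distribution_distr) simp
  have lower: "(\<integral>t. 1 / (z - complex_of_real t) \<partial>M) = cinner x (resolvent_op T z x)" if z: "Im z < 0" for z
  proof -
    define q where "q = (z + \<i>) / (z - \<i>)"
    note series = resolvent_cayley_series[OF z q_def]
    have qw: "cmod (q * cis \<theta>) < 1" for \<theta> using series(1) by (simp add: norm_mult)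
    define f where "f N \<theta> = (\<Sum>n<N. q ^ n * cis (real n * \<theta>)) - (\<Sum>n<N. q ^ n * cis (real (Suc n) * \<theta>))" for N \<theta>
    have f_eq: "f N \<theta> = (1 - cis \<theta>) * (\<Sum>n<N. (q * cis \<theta>) ^ n)" for N \<theta>
    proof -
      have "q ^ n * cis (real (Suc n) * \<theta>) = cis \<theta> * (q * cis \<theta>) ^ n" for n
        unfolding Complex.DeMoivre[symmetric] by (simp add: power_mult_distrib mult_ac)
      moreover have "q ^ n * cis (real n * \<theta>) = (q * cis \<theta>) ^ n" for n
        unfolding Complex.DeMoivre[symmetric] by (simp add: power_mult_distrib)
      ultimately show ?thesis
        by (simp only: f_def sum_distrib_left[symmetric]) (simp add: algebra_simps)
    qed
    have "(\<integral>t. 1 / (z - complex_of_real t) \<partial>M) = (\<integral>\<theta>. 1 / (z - complex_of_real (line_coordinate \<theta>)) \<partial>\<nu>)"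
      unfolding M_def by (rule integral_distr) auto
    also have "\<dots> = (\<integral>\<theta>. (1 / (z - \<i>)) * ((1 - cis \<theta>) * (1 / (1 - q * cis \<theta>))) \<partial>\<nu>)"
    proof (rule integral_cong_AE)
      have [measurable]: "cis \<in> borel_measurable borel"
        by (auto intro!: borel_measurable_continuous_onI continuous_intros)
      show "(\<lambda>\<theta>. (1 / (z - \<i>)) * ((1 - cis \<theta>) * (1 / (1 - q * cis \<theta>)))) \<in> borel_measurable \<nu>"
        by (subst measurable_cong_sets[OF \<nu>.events_eq_borel refl]) measurable
      show "(\<lambda>\<theta>. 1 / (z - complex_of_real (line_coordinate \<theta>))) \<in> borel_measurable \<nu>"
        by (subst measurable_cong_sets[OF \<nu>.events_eq_borel refl]) measurable
      have eq: "1 / (z - complex_of_real (line_coordinate \<theta>)) = (1 / (z - \<i>)) * ((1 - cis \<theta>) * (1 / (1 - q * cis \<theta>)))"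
        if "cis \<theta> \<noteq> 1" for \<theta>
      proof -
        have "(z - \<i>) - (z + \<i>) * cis \<theta> = (z - \<i>) * (1 - q * cis \<theta>)"
        proof -
          have "(z - \<i>) * q = z + \<i>" using series(2) by (simp add: q_def)
          then show ?thesis unfolding right_diff_distrib mult.assoc[symmetric] by simp
        qed
        then show ?thesis unfolding Cauchy_kernel_line_coordinate[OF that] by simp
      qed
      show "AE \<theta> in \<nu>. 1 / (z - complex_of_real (line_coordinate \<theta>)) = (1 / (z - \<i>)) * ((1 - cis \<theta>) * (1 / (1 - q * cis \<theta>)))"
        using AE1 by eventually_elim (rule eq)
    qed
    also have "\<dots> = (1 / (z - \<i>)) * (\<integral>\<theta>. (1 - cis \<theta>) * (1 / (1 - q * cis \<theta>)) \<partial>\<nu>)"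
      by (rule integral_mult_right_zero)
    also have "(\<integral>\<theta>. (1 - cis \<theta>) * (1 / (1 - q * cis \<theta>)) \<partial>\<nu>) = cinner x ((z - \<i>) *\<^sub>C resolvent_op T z x)"
    proof -
      have "(\<lambda>N. \<integral>\<theta>. f N \<theta> \<partial>\<nu>) \<longlonglongrightarrow> (\<integral>\<theta>. (1 - cis \<theta>) * (1 / (1 - q * cis \<theta>)) \<partial>\<nu>)"
      proof (rule sigma_functionalD(3)[OF L, where C = "2 * (1 / (1 - cmod q))"])
        show "f N \<in> borel_measurable borel" for N
          unfolding f_def by (intro bounded_borel_measurable bounded_borel_diff bounded_borel_sum bounded_borel_scale cis_bb)
        show "(\<lambda>N. f N \<theta>) \<longlonglongrightarrow> (1 - cis \<theta>) * (1 / (1 - q * cis \<theta>))" for \<theta>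
          unfolding f_eq using geometric_sums[OF qw[of \<theta>]] by (intro tendsto_mult_left) (simp add: sums_def)
        show "cmod (f N \<theta>) \<le> 2 * (1 / (1 - cmod q))" for N \<theta>
          unfolding f_eq norm_mult
        proof (rule mult_mono)
          show "cmod (1 - cis \<theta>) \<le> 2" using norm_triangle_ineq4[of 1 "cis \<theta>"] by simp
          have "cmod (\<Sum>n<N. (q * cis \<theta>) ^ n) \<le> (\<Sum>n<N. cmod q ^ n)"
            by (rule sum_norm_le) (simp add: norm_power norm_mult)
          also have "\<dots> \<le> (\<Sum>n. cmod q ^ n)"
            using series(1) by (intro sum_le_suminf summable_geometric) auto
          also have "\<dots> = 1 / (1 - cmod q)" using series(1) by (intro suminf_geometric) simp
          finally show "cmod (\<Sum>n<N. (q * cis \<theta>) ^ n) \<le> 1 / (1 - cmod q)" .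
        qed auto
      qed
      moreover have "(\<integral>\<theta>. f N \<theta> \<partial>\<nu>) = (\<Sum>n<N. cinner x (q ^ n *\<^sub>C ((?U ^^ n) x - (?U ^^ Suc n) x)))" for N
      proof -
        have "(\<integral>\<theta>. f N \<theta> \<partial>\<nu>) = (\<integral>\<theta>. (\<Sum>n<N. q ^ n * cis (real n * \<theta>)) \<partial>\<nu>) - (\<integral>\<theta>. (\<Sum>n<N. q ^ n * cis (real (Suc n) * \<theta>)) \<partial>\<nu>)"
          unfolding f_def by (intro sigma_functional_diff[OF L] bounded_borel_sum bounded_borel_scale cis_bb)
        also have "\<dots> = (\<Sum>n<N. q ^ n * cinner x ((?U ^^ n) x)) - (\<Sum>n<N. q ^ n * cinner x ((?U ^^ Suc n) x))"
          by (subst sum_cis[of _ "\<lambda>n. n"], subst sum_cis[of _ Suc], rule refl)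
        finally show ?thesis
          by (simp only: sum_subtractf[symmetric] cinner_scaleC_right cinner_diff_right right_diff_distrib)
      qed
      moreover have "(\<lambda>N. \<Sum>n<N. cinner x (q ^ n *\<^sub>C ((?U ^^ n) x - (?U ^^ Suc n) x))) \<longlonglongrightarrow> cinner x ((z - \<i>) *\<^sub>C resolvent_op T z x)"
        using bounded_linear.sums[OF bounded_bilinear.bounded_linear_right[OF bounded_bilinear_cinner] series(3)]
        unfolding sums_def .
      ultimately show ?thesis using LIMSEQ_unique by fastforce
    qed
    finally show ?thesis using series(2) by (simp add: cinner_scaleC_right)
  qed
  have "(\<integral>t. 1 / (z - complex_of_real t) \<partial>M) = cinner x (resolvent_op T z x)" if z: "Im z \<noteq> 0" for z
  proof (cases "Im z < 0")
    case False
    then have "Im (cnj z) < 0" using z by simp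
    have "(\<integral>t. 1 / (z - complex_of_real t) \<partial>M) = cnj (\<integral>t. 1 / (cnj z - complex_of_real t) \<partial>M)"
      by (subst Bochner_Integration.integral_cnj[symmetric]) simp
    also have "\<dots> = cnj (cinner x (resolvent_op T (cnj z) x))"
      unfolding lower[OF \<open>Im (cnj z) < 0\<close>] ..
    also have "\<dots> = cinner (resolvent_op T (cnj z) x) x" by (rule cinner_commute[symmetric])
    also have "\<dots> = cinner x (resolvent_op T z x)" using z by (simp add: resolvent_op_adjoint[OF T])
    finally show ?thesis .
  qed (rule lower)
  then show ?thesis using rdM by blast
qed

end


abbreviation resolvent_pairs ::
  "('a::complex_hilbert_space \<times> 'a) set \<Rightarrow> ((real \<Rightarrow> complex) \<times> ('a \<Rightarrow> 'a)) set" where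
  "resolvent_pairs T \<equiv> {(Cauchy_kernel z, resolvent_op T z) | z. Im z \<noteq> 0}"

context
  fixes T :: "('a::complex_hilbert_space \<times> 'a) set"
  assumes T: "self_adjoint T"
begin

lemma spectral_distribution_exists:
  "\<exists>M. sets M = sets borel \<and> emeasure M UNIV = ennreal ((norm x)\<^sup>2) \<and> (\<forall>z. Im z \<noteq> 0 \<longrightarrow>
    (\<integral>t. 1 / (z - complex_of_real t) \<partial>M) = cinner x (resolvent_op T z x))"
proof (cases "x = 0")
  case True
  have "sets (null_measure borel :: real measure) = sets borel" by simp
  moreover have "(\<integral>t. f t \<partial>(null_measure borel :: real measure)) = 0" for f :: "real \<Rightarrow> complex"
    by (rule integral_eq_zero_AE, rule AE_I[of _ _ UNIV]) simp_all
  ultimately show ?thesis using True by (intro exI[of _ "null_measure borel"]) simp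
next
  case False
  define u where "u = complex_of_real (1 / norm x) *\<^sub>C x"
  have "norm u = 1" using False by (simp add: u_def norm_scaleC norm_divide)
  from spectral_distribution_unit[OF T this] obtain M where rd: "real_distribution M"
    and M: "\<And>z. Im z \<noteq> 0 \<Longrightarrow> (\<integral>t. 1 / (z - complex_of_real t) \<partial>M) = cinner u (resolvent_op T z u)" by auto
  interpret real_distribution M by fact
  define M' where "M' = density M (\<lambda>_. ennreal ((norm x)\<^sup>2))"
  have "emeasure M' UNIV = ennreal ((norm x)\<^sup>2)"
    unfolding M'_def using emeasure_space_1 by (simp add: emeasure_density_const)
  moreover have "(\<integral>t. 1 / (z - complex_of_real t) \<partial>M') = cinner x (resolvent_op T z x)" if z: "Im z \<noteq> 0" for z
  proof -
    have "Cauchy_kernel z \<in> borel_measurable M"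
      using bounded_borel_measurable[OF bounded_borel_Cauchy_kernel[OF z]]
      by (simp add: measurable_cong_sets[OF events_eq_borel refl])
    then have "(\<integral>t. 1 / (z - complex_of_real t) \<partial>M') = (\<integral>t. (norm x)\<^sup>2 *\<^sub>R (1 / (z - complex_of_real t)) \<partial>M)"
      unfolding M'_def by (intro integral_density) auto
    also have "\<dots> = (norm x)\<^sup>2 *\<^sub>R cinner u (resolvent_op T z u)"
      by (subst integral_scaleR_right) (simp only: M[OF z])
    also have "\<dots> = cinner x (resolvent_op T z x)"
      using False by (simp add: u_def cinner_simps bounded_clinearD[OF bounded_clinear_resolvent_op[OF T z]]
          scaleR_conv_of_real power2_eq_square)
    finally show ?thesis .
  qed
  ultimately show ?thesis by (intro exI[of _ M']) (simp add: M'_def)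
qed

text \<open>By Stieltjes inversion there is exactly one such measure.\<close>

definition spectral_distribution :: "'a \<Rightarrow> real measure" where
  "spectral_distribution x = (SOME M. sets M = sets borel \<and> emeasure M UNIV = ennreal ((norm x)\<^sup>2) \<and>
    (\<forall>z. Im z \<noteq> 0 \<longrightarrow> (\<integral>t. 1 / (z - complex_of_real t) \<partial>M) = cinner x (resolvent_op T z x)))"

lemma spectral_distribution:
  "sets (spectral_distribution x) = sets borel"
  "emeasure (spectral_distribution x) UNIV = ennreal ((norm x)\<^sup>2)"
  "Im z \<noteq> 0 \<Longrightarrow> (\<integral>t. 1 / (z - complex_of_real t) \<partial>spectral_distribution x) = cinner x (resolvent_op T z x)"
  using someI_ex[OF spectral_distribution_exists[of x]] unfolding spectral_distribution_def by blast+

text \<open>The product rule for the kernels at \<open>z \<noteq> w\<close> is the resolvent identity read in partial fractions.  The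
  parameters \<open>w\<close> that are closer to the real axis than \<open>z\<close> are different from \<open>z\<close> and still determine.\<close>

lemma operator_calculus_resolvent:
  assumes sets: "\<And>x. sets (M x) = sets borel" and mass: "\<And>x. emeasure (M x) UNIV = ennreal ((norm x)\<^sup>2)"
    and cauchy: "\<And>x z. Im z \<noteq> 0 \<Longrightarrow> (\<integral>t. 1 / (z - complex_of_real t) \<partial>M x) = cinner x (resolvent_op T z x)"
  shows "operator_calculus M (resolvent_pairs T)"
    (is "operator_calculus M ?G")
proof
  show "determining (fst ` ?G)"
    by (rule determining_superset[OF determining_Cauchy_kernels[of 1]])
      (force intro: bounded_borel_Cauchy_kernel)+
  show "sets (M x) = sets borel" "emeasure (M x) UNIV = ennreal ((norm x)\<^sup>2)" for x
    by (rule sets, rule mass)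
  fix f S assume "(f, S) \<in> ?G"
  then obtain z where z: "Im z \<noteq> 0" and f: "f = Cauchy_kernel z" and S: "S = resolvent_op T z" by auto
  show "bounded_clinear S" unfolding S by (rule bounded_clinear_resolvent_op[OF T z])
  show "(\<integral>t. f t \<partial>M x) = cinner x (S x)" for x unfolding f S by (rule cauchy[OF z])
  show "determining (fst ` {(f', S') \<in> ?G. \<forall>x. (\<integral>t. f' t * f t \<partial>M x) = cinner x (S (S' x))})"
  proof (rule determining_superset[OF determining_Cauchy_kernels[of "\<bar>Im z\<bar>"]])
    show "bounded_borel f'" if "f' \<in> fst ` {(f', S') \<in> ?G. \<forall>x. (\<integral>t. f' t * f t \<partial>M x) = cinner x (S (S' x))}" for f'
      using that bounded_borel_Cauchy_kernel by auto
    show "{Cauchy_kernel w | w. Im w \<noteq> 0 \<and> \<bar>Im w\<bar> < \<bar>Im z\<bar>}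
      \<subseteq> fst ` {(f', S') \<in> ?G. \<forall>x. (\<integral>t. f' t * f t \<partial>M x) = cinner x (S (S' x))}"
    proof clarify
      fix w assume w: "Im w \<noteq> 0" "\<bar>Im w\<bar> < \<bar>Im z\<bar>"
      then have zw: "z \<noteq> w" by auto
      have "(\<integral>t. 1 / (w - complex_of_real t) * f t \<partial>M x) = cinner x (S (resolvent_op T w x))" for x
      proof -
        have fin: "finite_measure (M x)"
          using mass[of x] sets_eq_imp_space_eq[OF sets[of x]] by (intro finite_measureI) simp
        note L = sigma_functional_integral[OF sets fin]
        have "1 / (w - complex_of_real t) * f t =
            (1 / (z - w)) * (1 / (w - complex_of_real t) - 1 / (z - complex_of_real t))" for t
        proof -
          have "w - complex_of_real t \<noteq> 0" "z - complex_of_real t \<noteq> 0" using w z by (auto simp: complex_eq_iff)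
          then show ?thesis using zw by (simp add: f divide_simps)
        qed
        then have "(\<integral>t. 1 / (w - complex_of_real t) * f t \<partial>M x) =
            (\<integral>t. (1 / (z - w)) * (1 / (w - complex_of_real t) - 1 / (z - complex_of_real t)) \<partial>M x)" by presburger
        also have "\<dots> = (1 / (z - w)) * (cinner x (resolvent_op T w x) - cinner x (resolvent_op T z x))"
          by (subst sigma_functionalD(2)[OF L], rule bounded_borel_diff[OF
            bounded_borel_Cauchy_kernel[OF w(1)] bounded_borel_Cauchy_kernel[OF z]],
            subst sigma_functional_diff[OF L bounded_borel_Cauchy_kernel[OF w(1)]
            bounded_borel_Cauchy_kernel[OF z]], simp only: cauchy[OF w(1)] cauchy[OF z])
        also have "\<dots> = cinner x (S (resolvent_op T w x))"
          unfolding S resolvent_identity[OF T z w(1) zw] by (simp only: cinner_simps)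
        finally show ?thesis .
      qed
      then have "(Cauchy_kernel w, resolvent_op T w)
          \<in> {(f', S') \<in> ?G. \<forall>x. (\<integral>t. f' t * f t \<partial>M x) = cinner x (S (S' x))}"
        using w(1) by auto
      from imageI[OF this, of fst]
      show "(Cauchy_kernel w) \<in> fst ` {(f', S') \<in> ?G. \<forall>x. (\<integral>t. f' t * f t \<partial>M x) = cinner x (S (S' x))}"
        by (simp only: fst_conv)
    qed
  qed (use z in simp)
qed

end

section \<open>The spectral theorem\<close>

locale self_adjoint_operator =
  fixes T :: "('a::complex_hilbert_space \<times> 'a) set"
  assumes self_adjoint_T: "self_adjoint T"

sublocale self_adjoint_operator \<subseteq> operator_calculus "spectral_distribution T"
  "resolvent_pairs T"
  by (rule operator_calculus_resolvent[OF self_adjoint_T spectral_distribution[OF self_adjoint_T]])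

context self_adjoint_operator
begin

lemma opr_Cauchy_kernel: "Im z \<noteq> 0 \<Longrightarrow> opr (Cauchy_kernel z) y = resolvent_op T z y"
  by (rule opr_G) auto

text \<open>The truncations \<open>t 1\<^bsub>[-n,n]\<^esub>(t)\<close>; applied to \<open>x\<close> they converge exactly when \<open>x\<close> is in the domain.\<close>

definition truncation :: "nat \<Rightarrow> real \<Rightarrow> complex" where
  "truncation n t = complex_of_real t * indicator {- real n..real n} t"

lemma truncation_bound: "cmod (truncation n t) \<le> \<bar>t\<bar>" "cmod (truncation n t) \<le> real n"
  by (auto simp: truncation_def indicator_def norm_mult)

lemma bounded_borel_truncation: "bounded_borel (truncation n)"
  by (rule bounded_borelI[OF _ truncation_bound(2)]) (auto simp: truncation_def[abs_def])

lemma truncation_tendsto: "(\<lambda>n. truncation n t) \<longlonglongrightarrow> complex_of_real t"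
proof -
  have "\<forall>\<^sub>F n in sequentially. truncation n t = complex_of_real t"
    using eventually_ge_at_top[of "nat \<lceil>\<bar>t\<bar>\<rceil>"]
    by eventually_elim (auto simp: truncation_def indicator_def nat_le_iff ceiling_le_iff)
  then show ?thesis by (rule tendsto_eventually)
qed

lemma borel_measurable_M: "borel_measurable (spectral_distribution T x) = (borel_measurable borel :: (real \<Rightarrow> 'b::topological_space) set)"
  by (rule measurable_cong_sets[OF sets_M refl])

text \<open>A vector of the domain has the form \<open>(\<i> - T)\<^sup>-\<^sup>1 y\<close>, and \<open>t\<^sup>2 / \<bar>\<i> - t\<bar>\<^sup>2 \<le> 1\<close>.\<close>

lemma second_moment_if_Domain:
  assumes "x \<in> Domain T"
  shows "(\<integral>\<^sup>+t. ennreal (t\<^sup>2) \<partial>spectral_distribution T x) < \<infinity>"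
proof -
  obtain a where a: "(x, a) \<in> T" using assms by auto
  define y where "y = \<i> *\<^sub>C x - a"
  have x: "x = opr (\<lambda>t. 1 / (\<i> - complex_of_real t)) y"
    using resolvent_op_shift[OF self_adjoint_T _ a, of \<i>] by (simp add: y_def opr_Cauchy_kernel)
  have bb: "bounded_borel (\<lambda>t. 1 / (\<i> - complex_of_real t))" by (rule bounded_borel_Cauchy_kernel) simp
  note [measurable] = bounded_borel_measurable[OF bb]
  have "(\<integral>\<^sup>+t. ennreal (t\<^sup>2) \<partial>spectral_distribution T x) =
      (\<integral>\<^sup>+t. ennreal ((cmod (1 / (\<i> - complex_of_real t)))\<^sup>2) * ennreal (t\<^sup>2) \<partial>spectral_distribution T y)"
    unfolding x M_opr[OF bb]
    by (rule nn_integral_density) (simp_all add: borel_measurable_M)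
  also have "\<dots> \<le> (\<integral>\<^sup>+t. 1 \<partial>spectral_distribution T y)"
  proof (rule nn_integral_mono)
    fix t :: real
    have "(cmod (1 / (\<i> - complex_of_real t)))\<^sup>2 * t\<^sup>2 = t\<^sup>2 / (t\<^sup>2 + 1)"
      by (simp add: norm_divide power_divide cmod_power2)
    also have "\<dots> \<le> 1" by (simp add: divide_le_eq_1 add_nonneg_pos)
    finally show "ennreal ((cmod (1 / (\<i> - complex_of_real t)))\<^sup>2) * ennreal (t\<^sup>2) \<le> 1"
      by (simp add: ennreal_mult'[symmetric] ennreal_le_1)
  qed
  also have "\<dots> < \<infinity>" by (simp add: space_M emeasure_M)
  finally show ?thesis .
qed

text \<open>The truncations form a Cauchy sequence because the tails of the second moment tend to zero.  Applying
  \<open>(\<i> - T)\<^sup>-\<^sup>1\<close> to \<open>(\<i> - t)\<close> cut off at \<open>n\<close> gives the cut-off identity, and in the limit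
  \<open>(\<i> - T)\<^sup>-\<^sup>1 (\<i> x - y) = x\<close>, which says \<open>T x = y\<close>.\<close>

lemma opr_truncation_converges:
  assumes fin: "(\<integral>\<^sup>+t. ennreal (t\<^sup>2) \<partial>spectral_distribution T x) < \<infinity>"
  shows "\<exists>y. (\<lambda>n. opr (truncation n) x) \<longlonglongrightarrow> y \<and> (x, y) \<in> T"
proof -
  let ?M = "spectral_distribution T x"
  have int2: "integrable ?M (\<lambda>t. t\<^sup>2)"
    using fin by (intro integrableI_nonneg) (auto simp: borel_measurable_M)
  define r where "r n = (\<integral>t. t\<^sup>2 * indicator {t. \<bar>t\<bar> > real n} t \<partial>?M)" for n :: nat
  have int_r: "integrable ?M (\<lambda>t. t\<^sup>2 * indicator {t. \<bar>t\<bar> > real n} t)" for n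
    by (rule integrable_mult_indicator[OF _ int2, of "{t. \<bar>t\<bar> > real n}", simplified mult.commute real_scaleR_def])
      (simp add: sets_M)
  have r0: "r \<longlonglongrightarrow> 0"
  proof -
    have "(\<lambda>n. \<integral>t. t\<^sup>2 * indicator {t. \<bar>t\<bar> > real n} t \<partial>?M) \<longlonglongrightarrow> (\<integral>t. 0 \<partial>?M)"
    proof (rule integral_dominated_convergence[where w = "\<lambda>t. t\<^sup>2"])
      show "AE t in ?M. (\<lambda>n. t\<^sup>2 * indicator {t. \<bar>t\<bar> > real n} t) \<longlonglongrightarrow> 0"
      proof (intro AE_I2 tendsto_eventually)
        fix t :: real
        show "\<forall>\<^sub>F n in sequentially. t\<^sup>2 * indicator {t. \<bar>t\<bar> > real n} t = 0"
          using eventually_ge_at_top[of "nat \<lceil>\<bar>t\<bar>\<rceil>"]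
          by eventually_elim (auto simp: indicator_def nat_le_iff ceiling_le_iff)
      qed
      show "AE t in ?M. norm (t\<^sup>2 * indicator {t. \<bar>t\<bar> > real n} t) \<le> t\<^sup>2" for n
        by (auto simp: indicator_def)
    qed (use int2 int_r in \<open>auto simp: borel_measurable_M dest: borel_measurable_integrable\<close>)
    then show ?thesis by (simp add: r_def[abs_def])
  qed
  have dist_le: "(norm (opr (truncation m) x - opr (truncation n) x))\<^sup>2 \<le> r n" if "n \<le> m" for m n
  proof -
    note bb = bounded_borel_diff[OF bounded_borel_truncation[of m] bounded_borel_truncation[of n]]
    have "complex_of_real ((norm (opr (truncation m) x - opr (truncation n) x))\<^sup>2)
        = (\<integral>t. complex_of_real ((cmod (truncation m t - truncation n t))\<^sup>2) \<partial>?M)"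
      using norm_opr_sq[OF bb] by (simp only: opr_diff[OF bounded_borel_truncation bounded_borel_truncation])
    also have "\<dots> = complex_of_real (\<integral>t. (cmod (truncation m t - truncation n t))\<^sup>2 \<partial>?M)"
      by (rule integral_complex_of_real)
    finally have "(norm (opr (truncation m) x - opr (truncation n) x))\<^sup>2 = (\<integral>t. (cmod (truncation m t - truncation n t))\<^sup>2 \<partial>?M)"
      using of_real_eq_iff by blast
    also have "\<dots> \<le> r n"
      unfolding r_def
    proof (rule integral_mono_AE')
      show "integrable ?M (\<lambda>t. t\<^sup>2 * indicator {t. \<bar>t\<bar> > real n} t)" by (rule int_r)
      show "AE t in ?M. (cmod (truncation m t - truncation n t))\<^sup>2 \<le> t\<^sup>2 * indicator {t. \<bar>t\<bar> > real n} t"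
        using that by (intro AE_I2) (auto simp: truncation_def indicator_def norm_mult)
    qed auto
    finally show ?thesis .
  qed
  have "Cauchy (\<lambda>n. opr (truncation n) x)"
  proof (rule CauchyI')
    fix e :: real assume e: "e > 0"
    then have "\<forall>\<^sub>F n in sequentially. r n < e\<^sup>2" using r0 by (auto intro: order_tendstoD)
    then obtain N where N: "\<And>n. n \<ge> N \<Longrightarrow> r n < e\<^sup>2" by (auto simp: eventually_sequentially)
    show "\<exists>M. \<forall>m\<ge>M. \<forall>n>m. dist (opr (truncation m) x) (opr (truncation n) x) < e"
    proof (intro exI[of _ N] allI impI)
      fix m n :: nat assume "m \<ge> N" "n > m"
      then have "(norm (opr (truncation n) x - opr (truncation m) x))\<^sup>2 < e\<^sup>2"
        using dist_le[of m n] N[of m] by simp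
      then show "dist (opr (truncation m) x) (opr (truncation n) x) < e"
        using e by (simp add: dist_norm norm_minus_commute power_less_imp_less_base)
    qed
  qed
  then obtain y where y: "(\<lambda>n. opr (truncation n) x) \<longlonglongrightarrow> y"
    using Cauchy_convergent_iff convergent_def by blast
  define k where "k = (\<lambda>t. 1 / (\<i> - complex_of_real t))"
  have bk: "bounded_borel k" unfolding k_def by (rule bounded_borel_Cauchy_kernel) simp
  define e where "e n = (\<lambda>t::real. indicator {- real n..real n} t :: complex)" for n :: nat
  have be: "bounded_borel (e n)" for n
    unfolding e_def using bounded_borel_indicator[of "{- real n..real n}"] by simp
  have ex: "(\<lambda>n. opr (e n) x) \<longlonglongrightarrow> x"
  proof -
    have "(\<lambda>n. opr (e n) x) \<longlonglongrightarrow> opr (\<lambda>t. 1) x"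
    proof (rule opr_tendsto[where C = 1])
      show "(\<lambda>n. e n t) \<longlonglongrightarrow> 1" for t
      proof (rule tendsto_eventually)
        show "\<forall>\<^sub>F n in sequentially. e n t = 1"
          using eventually_ge_at_top[of "nat \<lceil>\<bar>t\<bar>\<rceil>"]
          by eventually_elim (auto simp: e_def indicator_def nat_le_iff ceiling_le_iff)
      qed
    qed (use be in \<open>auto simp: e_def indicator_def\<close>)
    then show ?thesis by (simp add: opr_one)
  qed
  have "opr k (\<i> *\<^sub>C opr (e n) x - opr (truncation n) x) = opr (e n) x" for n
  proof -
    have "opr k (\<i> *\<^sub>C opr (e n) x - opr (truncation n) x) = opr k (opr (\<lambda>t. \<i> * e n t - truncation n t) x)"
      by (simp add: opr_diff opr_scale be bounded_borel_truncation bounded_borel_scale)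
    also have "\<dots> = opr (\<lambda>t. k t * (\<i> * e n t - truncation n t)) x"
      by (intro opr_mult bk bounded_borel_diff bounded_borel_scale be bounded_borel_truncation)
    also have "(\<lambda>t. k t * (\<i> * e n t - truncation n t)) = e n"
    proof
      fix t
      have "\<i> - complex_of_real t \<noteq> 0" by (simp add: complex_eq_iff)
      then show "k t * (\<i> * e n t - truncation n t) = e n t"
        by (auto simp: k_def e_def truncation_def indicator_def)
    qed
    finally show ?thesis .
  qed
  moreover have "(\<lambda>n. opr k (\<i> *\<^sub>C opr (e n) x - opr (truncation n) x)) \<longlonglongrightarrow> opr k (\<i> *\<^sub>C x - y)"
    by (intro bounded_clinear_tendsto[OF clinear_opr[OF bk]] tendsto_diff tendsto_scaleC tendsto_const ex y)
  ultimately have "opr k (\<i> *\<^sub>C x - y) = x" using ex LIMSEQ_unique by fastforce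
  then have "resolvent_op T \<i> (\<i> *\<^sub>C x - y) = x" by (simp add: k_def opr_Cauchy_kernel)
  then have "(x, y) \<in> T" using resolvent_op_in[OF self_adjoint_T, of \<i> "\<i> *\<^sub>C x - y"] by simp
  then show ?thesis using y by blast
qed

lemma spectral_measure_opr: "spectral_measure T (\<lambda>A. opr (indicator A))"
  unfolding spectral_measure_def diag_measure_opr_indicator
proof (intro conjI pvm_opr_indicator)
  show "Domain T = {x. (\<integral>\<^sup>+t. ennreal (t\<^sup>2) \<partial>spectral_distribution T x) < \<infinity>}"
    using second_moment_if_Domain opr_truncation_converges by (auto simp: Domain.simps) blast+
  show "\<forall>(x, y)\<in>T. cinner x y = complex_of_real (\<integral>t. t \<partial>spectral_distribution T x)"
  proof clarify
    fix x y assume xy: "(x, y) \<in> T"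
    let ?M = "spectral_distribution T x"
    have fin: "(\<integral>\<^sup>+t. ennreal (t\<^sup>2) \<partial>?M) < \<infinity>" using second_moment_if_Domain xy by blast
    obtain y' where y': "(\<lambda>n. opr (truncation n) x) \<longlonglongrightarrow> y'" "(x, y') \<in> T" using opr_truncation_converges[OF fin] by auto
    have "y' = y" using linear_operatorD(1)[OF self_adjointD(1)[OF self_adjoint_T] y'(2) xy] .
    then have "(\<lambda>n. cinner x (opr (truncation n) x)) \<longlonglongrightarrow> cinner x y"
      using y'(1) by (auto intro: tendsto_cinner)
    then have "(\<lambda>n. \<integral>t. truncation n t \<partial>?M) \<longlonglongrightarrow> cinner x y"
      by (simp add: cinner_opr_diagonal bounded_borel_truncation)
    moreover have "(\<lambda>n. \<integral>t. truncation n t \<partial>?M) \<longlonglongrightarrow> (\<integral>t. complex_of_real t \<partial>?M)"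
    proof (rule integral_dominated_convergence[where w = "\<lambda>t. 1 + t\<^sup>2"])
      have "integrable ?M (\<lambda>t. t\<^sup>2)"
        using fin by (intro integrableI_nonneg) (auto simp: borel_measurable_M)
      moreover have "integrable ?M (\<lambda>t. 1::real)"
        using finite_measure_M[of x] by (simp add: finite_measure.integrable_const)
      ultimately show "integrable ?M (\<lambda>t. 1 + t\<^sup>2)" by (rule Bochner_Integration.integrable_add[rotated])
      show "AE t in ?M. norm (truncation n t) \<le> 1 + t\<^sup>2" for n
      proof (intro AE_I2)
        fix t :: real
        have "\<bar>t\<bar> \<le> 1 + t\<^sup>2"
          using zero_le_power2[of "\<bar>t\<bar> - 1"] by (simp add: power2_eq_square algebra_simps)
        then show "norm (truncation n t) \<le> 1 + t\<^sup>2" using truncation_bound(1)[of n t] by linarith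
      qed
      show "AE t in ?M. (\<lambda>n. truncation n t) \<longlonglongrightarrow> complex_of_real t" using truncation_tendsto by simp
    qed (use bounded_borel_measurable[OF bounded_borel_truncation] in \<open>auto simp: borel_measurable_M\<close>)
    ultimately have "cinner x y = (\<integral>t. complex_of_real t \<partial>?M)" using LIMSEQ_unique by blast
    then show "cinner x y = complex_of_real (\<integral>t. t \<partial>?M)" by simp
  qed
qed

end


section \<open>Uniqueness of the functional calculus and of the distribution\<close>

context self_adjoint_operator
begin

text \<open>Let \<open>S = \<integral> 1 / (z - t) dE\<close>.  It maps into the domain of \<open>T\<close>, since \<open>t / (z - t)\<close> is bounded, and it
  remains to see \<open>(z - T) S = 1\<close>.  Only the diagonal of \<open>T\<close> is known, but this is enough: the
  form \<open>\<langle>S x, (z - T) S y - y\<rangle>\<close> vanishes on the diagonal, hence everywhere, and no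
  nonzero vector is orthogonal to the range of \<open>S\<close>.\<close>

lemma spectral_measure_resolvent:
  assumes E: "spectral_measure T E" and z: "Im z \<noteq> 0"
  shows "(\<integral>t. 1 / (z - complex_of_real t) \<partial>diag_measure E x) = cinner x (resolvent_op T z x)"
proof -
  have pvm: "projection_valued_measure E"
    and dom: "Domain T = {x. (\<integral>\<^sup>+t. ennreal (t\<^sup>2) \<partial>diag_measure E x) < \<infinity>}"
    and mean: "\<And>x y. (x, y) \<in> T \<Longrightarrow> cinner x y = complex_of_real (\<integral>t. t \<partial>diag_measure E x)"
    using E unfolding spectral_measure_def by auto
  interpret C: operator_calculus "diag_measure E" "projection_pairs E"
    by (rule operator_calculus_pvm[OF pvm])
  have CM: "borel_measurable (diag_measure E x) = (borel_measurable borel :: (real \<Rightarrow> 'b::topological_space) set)" for x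
    by (rule measurable_cong_sets[OF C.sets_M refl])
  define s where "s = Cauchy_kernel z"
  have s: "bounded_borel s" unfolding s_def by (rule bounded_borel_Cauchy_kernel[OF z])
  note [measurable] = bounded_borel_measurable[OF s]
  have nz: "z - complex_of_real t \<noteq> 0" for t using z by (auto simp: complex_eq_iff)
  define S where "S = C.opr s"
  have S: "bounded_clinear S" unfolding S_def by (rule C.clinear_opr[OF s])
  have lin: "linear_operator T" by (rule self_adjointD(1)[OF self_adjoint_T])
  have "S x \<in> Domain T" for x
  proof -
    define B where "B = 1 + cmod z / \<bar>Im z\<bar>"
    have bound: "(cmod (s t))\<^sup>2 * t\<^sup>2 \<le> B\<^sup>2" for t
    proof -
      have "\<bar>t\<bar> \<le> cmod (z - complex_of_real t) + cmod z"
        using norm_triangle_ineq4[of z "z - complex_of_real t"] by simp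
      then have "cmod (s t) * \<bar>t\<bar> \<le> cmod (s t) * (cmod (z - complex_of_real t) + cmod z)"
        by (rule mult_left_mono) simp
      also have "\<dots> = 1 + cmod (s t) * cmod z"
        using nz[of t] by (simp add: s_def norm_divide distrib_left)
      also have "\<dots> \<le> B"
        using mult_right_mono[OF Cauchy_kernel_bound[OF z, of t], of "cmod z"] by (simp add: B_def s_def)
      finally have "(cmod (s t) * \<bar>t\<bar>)\<^sup>2 \<le> B\<^sup>2" by (rule power_mono) simp
      then show ?thesis by (simp add: power_mult_distrib)
    qed
    have "(\<integral>\<^sup>+t. ennreal (t\<^sup>2) \<partial>diag_measure E (S x)) = (\<integral>\<^sup>+t. ennreal ((cmod (s t))\<^sup>2) * ennreal (t\<^sup>2) \<partial>diag_measure E x)"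
      unfolding S_def C.M_opr[OF s] by (rule nn_integral_density) (simp_all add: CM)
    also have "\<dots> \<le> (\<integral>\<^sup>+t. ennreal (B\<^sup>2) \<partial>diag_measure E x)"
      using bound by (intro nn_integral_mono) (simp add: ennreal_mult'[symmetric] ennreal_leI)
    also have "\<dots> < \<infinity>" by (simp add: C.space_M C.emeasure_M ennreal_mult_less_top)
    finally show ?thesis unfolding dom by simp
  qed
  then have "\<forall>x. \<exists>w. (S x, w) \<in> T" by auto
  then obtain A where A: "\<And>x. (S x, A x) \<in> T" by metis
  have A_add: "A (x + y) = A x + A y" for x y
    using linear_operatorD(1)[OF lin A[of "x + y"]] linear_operatorD(3)[OF lin A[of x] A[of y]]
    by (simp add: bounded_clinearD[OF S])
  have A_scale: "A (c *\<^sub>C x) = c *\<^sub>C A x" for c x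
    using linear_operatorD(1)[OF lin A[of "c *\<^sub>C x"]] linear_operatorD(4)[OF lin A[of x], of c]
    by (simp add: bounded_clinearD[OF S])
  \<comment> \<open>Here \<open>A = T S\<close>.  The diagonal vanishes because \<open>(z - t) \<bar>s(t)\<bar>\<^sup>2\<close> is the conjugate of \<open>s(t)\<close>.\<close>
  have diag: "cinner (S x) (z *\<^sub>C S x - A x - x) = 0" for x
  proof -
    define k where "k t = z * (s t * cnj (s t)) - cnj (s t)" for t
    have ss: "bounded_borel (\<lambda>t. s t * cnj (s t))" and sc: "bounded_borel (\<lambda>t. cnj (s t))"
      by (intro bounded_borel_mult bounded_borel_cnj s)+
    have k_eq: "complex_of_real ((cmod (s t))\<^sup>2 * t) = k t" for t
    proof -
      have "k t = cnj (s t) * (s t * z - 1)" by (simp add: k_def algebra_simps)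
      also have "s t * z - 1 = s t * complex_of_real t" using nz[of t] by (simp add: s_def divide_simps)
      finally show ?thesis using complex_norm_square[of "s t"] by (simp add: mult_ac)
    qed
    have "cinner (S x) (A x) = complex_of_real (\<integral>t. t \<partial>diag_measure E (S x))" by (rule mean[OF A])
    also have "(\<integral>t. t \<partial>diag_measure E (S x)) = (\<integral>t. (cmod (s t))\<^sup>2 *\<^sub>R t \<partial>diag_measure E x)"
      unfolding S_def C.M_opr[OF s] by (rule integral_density) (simp_all add: CM)
    also have "complex_of_real \<dots> = (\<integral>t. complex_of_real ((cmod (s t))\<^sup>2 * t) \<partial>diag_measure E x)"
      by (simp only: real_scaleR_def integral_complex_of_real)
    also have "\<dots> = (\<integral>t. k t \<partial>diag_measure E x)" by (simp only: k_eq)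
    also have "\<dots> = z * (\<integral>t. s t * cnj (s t) \<partial>diag_measure E x) - (\<integral>t. cnj (s t) \<partial>diag_measure E x)"
      unfolding k_def using sigma_functionalD(2)[OF C.sigma_functional_M ss]
        sigma_functional_diff[OF C.sigma_functional_M bounded_borel_scale[OF ss] sc] by simp
    also have "(\<integral>t. s t * cnj (s t) \<partial>diag_measure E x) = cinner (S x) (S x)"
      using C.norm_opr_sq[OF s, of x] by (simp add: S_def cinner_self complex_norm_square[symmetric])
    also have "(\<integral>t. cnj (s t) \<partial>diag_measure E x) = cinner (S x) x"
      unfolding S_def C.opr_adjoint[OF s] by (rule C.cinner_opr_diagonal[OF sc, symmetric])
    finally show ?thesis by (simp add: cinner_simps)
  qed
  have "sesquilinear (\<lambda>x y. cinner (S x) (z *\<^sub>C S y - A y - y))"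
    by standard (simp_all add: bounded_clinearD[OF S] A_add A_scale cinner_simps algebra_simps)
  from sesquilinear.zero_if_diagonal_zero[OF this diag]
  have zero: "cinner (S x) (z *\<^sub>C S y - A y - y) = 0" for x y .
  have inj: "v = 0" if "\<And>x. cinner (S x) v = 0" for v
  proof -
    note sc = bounded_borel_cnj[OF s]
    have "cinner x (C.opr (\<lambda>t. cnj (s t)) v) = 0" for x
      using that[of x] by (simp add: S_def C.opr_adjoint[OF s])
    then have "C.opr (\<lambda>t. cnj (s t)) v = 0" by (intro cinner_ext) simp
    then have "(\<integral>t. complex_of_real ((cmod (s t))\<^sup>2) \<partial>diag_measure E v) = 0"
      using C.norm_opr_sq[OF sc, of v] by simp
    then have "complex_of_real (\<integral>t. (cmod (s t))\<^sup>2 \<partial>diag_measure E v) = 0" by (simp only: integral_complex_of_real)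
    then have "(\<integral>t. (cmod (s t))\<^sup>2 \<partial>diag_measure E v) = 0" by (simp only: of_real_eq_0_iff)
    moreover have "integrable (diag_measure E v) (\<lambda>t. (cmod (s t))\<^sup>2)"
      using C.integrable_M[OF bounded_borel_mult[OF s sc]]
      by (subst complex_of_real_integrable_eq[symmetric]) (simp only: complex_norm_square)
    ultimately have "AE t in diag_measure E v. (cmod (s t))\<^sup>2 = 0"
      by (subst (asm) integral_nonneg_eq_0_iff_AE) auto
    moreover have "s t \<noteq> 0" for t using nz[of t] by (simp add: s_def)
    ultimately have "AE t in diag_measure E v. False" by simp
    then have "emeasure (diag_measure E v) (space (diag_measure E v)) = 0"
      by (simp add: AE_iff_null null_sets_def)
    then show "v = 0" by (simp add: C.space_M C.emeasure_M)
  qed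
  have "z *\<^sub>C S y - A y - y = 0" for y by (rule inj) (rule zero)
  then have "A y = z *\<^sub>C S y - y" for y by (metis diff_diff_eq diff_eq_diff_eq add_diff_cancel_right' diff_0_right diff_diff_eq2 eq_iff_diff_eq_0)
  then have "(S y, z *\<^sub>C S y - y) \<in> T" for y using A[of y] by simp
  then have "resolvent_op T z y = S y" for y by (rule resolvent_op_eqI[OF self_adjoint_T z])
  then show ?thesis using C.cinner_opr_diagonal[OF s, of x] by (simp add: S_def s_def)
qed

lemma integral_spectral_measure:
  assumes E: "spectral_measure T E" and h: "bounded_borel h"
  shows "(\<integral>t. h t \<partial>diag_measure E x) = (\<integral>t. h t \<partial>spectral_distribution T x)"
proof -
  have "projection_valued_measure E" using E by (simp add: spectral_measure_def)
  then interpret C: operator_calculus "diag_measure E" "projection_pairs E"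
    by (rule operator_calculus_pvm)
  show ?thesis
    by (rule determining_eq[OF determining_Cauchy_kernels[of 1] C.sigma_functional_M sigma_functional_M _ h])
      (auto simp: spectral_measure_resolvent[OF E] spectral_distribution(3)[OF self_adjoint_T])
qed

text \<open>All spectral measures of \<open>T\<close> have the same diagonal measures, so the description of \<open>h(T)\<close> through an
  unspecified spectral measure is unique.\<close>

lemma fun_calc_eq_opr:
  assumes h: "bounded_borel h"
  shows "fun_calc T h = opr h"
  unfolding fun_calc_def
proof (rule the_equality)
  show "bounded_clinear (opr h) \<and> (\<exists>E. spectral_measure T E \<and>
      (\<forall>x. cinner x (opr h x) = (\<integral>t. h t \<partial>diag_measure E x)))"
    using clinear_opr[OF h] spectral_measure_opr
    by (auto simp: diag_measure_opr_indicator cinner_opr_diagonal[OF h] intro!: exI[of _ "\<lambda>A. opr (indicator A)"])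
  show "S = opr h" if "bounded_clinear S \<and> (\<exists>E. spectral_measure T E \<and>
      (\<forall>x. cinner x (S x) = (\<integral>t. h t \<partial>diag_measure E x)))" for S
    using that by (intro opr_unique[OF h]) (auto simp: integral_spectral_measure[OF _ h])
qed

end

lemma finite_measure_eqI_Cauchy:
  fixes \<mu> \<nu> :: "real measure"
  assumes "finite_measure \<mu>" "sets \<mu> = sets borel" "finite_measure \<nu>" "sets \<nu> = sets borel"
    and eq: "\<And>z. Im z \<noteq> 0 \<Longrightarrow> (\<integral>t. 1 / (z - complex_of_real t) \<partial>\<mu>) = (\<integral>t. 1 / (z - complex_of_real t) \<partial>\<nu>)"
  shows "\<mu> = \<nu>"
proof (rule measure_eqI)
  show "sets \<mu> = sets \<nu>" using assms by simp
  fix A assume "A \<in> sets \<mu>"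
  then have A: "A \<in> sets borel" using assms by simp
  interpret \<mu>: finite_measure \<mu> by fact
  interpret \<nu>: finite_measure \<nu> by fact
  have "(\<integral>t. (indicator A t :: complex) \<partial>\<mu>) = (\<integral>t. indicator A t \<partial>\<nu>)"
    by (rule determining_eq[OF determining_Cauchy_kernels[of 1] sigma_functional_integral sigma_functional_integral])
      (use assms A eq in \<open>auto intro: bounded_borel_indicator\<close>)
  then have "complex_of_real (measure \<mu> A) = complex_of_real (measure \<nu> A)"
    using assms(2,4) A by (simp add: complex_integral_indicator)
  then show "emeasure \<mu> A = emeasure \<nu> A"
    by (simp add: \<mu>.emeasure_eq_measure \<nu>.emeasure_eq_measure)
qed

lemma Cauchy_kernel_bcontfun:
  assumes "Im z \<noteq> 0"
  shows "Cauchy_kernel z \<in> bcontfun"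
proof -
  have "z - complex_of_real t \<noteq> 0" for t using assms by (auto simp: complex_eq_iff)
  then have "continuous_on UNIV (Cauchy_kernel z)"
    by (intro continuous_intros) auto
  then show ?thesis
    using Cauchy_kernel_bound[OF assms] unfolding bcontfun_def bounded_iff by auto
qed

lemma (in self_adjoint_operator) distribution_eq:
  assumes "norm \<Omega> = 1"
  shows "distribution T \<Omega> = spectral_distribution T \<Omega>"
    and "real_distribution (spectral_distribution T \<Omega>)"
proof -
  show rd: "real_distribution (spectral_distribution T \<Omega>)"
    unfolding real_distribution_def real_distribution_axioms_def
    using assms by (auto intro!: prob_spaceI simp: space_M emeasure_M sets_M)
  show "distribution T \<Omega> = spectral_distribution T \<Omega>"
    unfolding distribution_def
  proof (rule the_equality)
    show "real_distribution (spectral_distribution T \<Omega>) \<and>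
      (\<forall>h\<in>bcontfun. cinner \<Omega> (fun_calc T h \<Omega>) = (\<integral>t. h t \<partial>spectral_distribution T \<Omega>))"
      using rd by (auto simp: fun_calc_eq_opr cinner_opr_diagonal bounded_borel_bcontfun)
    fix \<mu> assume \<mu>: "real_distribution \<mu> \<and> (\<forall>h\<in>bcontfun. cinner \<Omega> (fun_calc T h \<Omega>) = (\<integral>t. h t \<partial>\<mu>))"
    then interpret \<mu>: real_distribution \<mu> by simp
    show "\<mu> = spectral_distribution T \<Omega>"
    proof (rule finite_measure_eqI_Cauchy)
      fix z :: complex assume "Im z \<noteq> 0"
      from Cauchy_kernel_bcontfun[OF this] bounded_borel_Cauchy_kernel[OF this] \<mu>
      show "(\<integral>t. 1 / (z - complex_of_real t) \<partial>\<mu>) = (\<integral>t. 1 / (z - complex_of_real t) \<partial>spectral_distribution T \<Omega>)"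
        by (metis cinner_opr_diagonal fun_calc_eq_opr)
    qed (simp_all add: sets_M finite_measure_M \<mu>.finite_measure_axioms)
  qed
qed

lemma cauchy_transform_cnj: "cauchy_transform \<mu> (cnj z) = cnj (cauchy_transform \<mu> z)"
  unfolding cauchy_transform_def by (subst Bochner_Integration.integral_cnj[symmetric]) simp

text \<open>Reciprocals and complex conjugation extend the equation to Cauchy transforms in both half-planes, where
  they determine the measure.\<close>

lemma monotone_convI:
  assumes \<rho>: "real_distribution \<rho>"
    and F: "\<And>z. Im z > 0 \<Longrightarrow> recip_cauchy_transform \<rho> z =
        recip_cauchy_transform \<mu> (recip_cauchy_transform \<nu> z)"
  shows "\<mu> \<rhd> \<nu> = \<rho>"
  unfolding monotone_conv_def
proof (rule the_equality)
  show "real_distribution \<rho> \<and> (\<forall>z. Im z > 0 \<longrightarrow> recip_cauchy_transform \<rho> z =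
        recip_cauchy_transform \<mu> (recip_cauchy_transform \<nu> z))" using assms by simp
  fix \<rho>' assume \<rho>': "real_distribution \<rho>' \<and> (\<forall>z. Im z > 0 \<longrightarrow> recip_cauchy_transform \<rho>' z =
        recip_cauchy_transform \<mu> (recip_cauchy_transform \<nu> z))"
  interpret r: real_distribution \<rho> by fact
  interpret r': real_distribution \<rho>' using \<rho>' by simp
  have upper: "cauchy_transform \<rho>' z = cauchy_transform \<rho> z" if "Im z > 0" for z
    using F[OF that] \<rho>' that unfolding recip_cauchy_transform_def[of \<rho>] recip_cauchy_transform_def[of \<rho>']
    by (metis div_by_1 divide_divide_eq_right mult_1)
  have "cauchy_transform \<rho>' z = cauchy_transform \<rho> z" if "Im z \<noteq> 0" for z
  proof (cases "Im z > 0")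
    case False
    then have "Im (cnj z) > 0" using that by simp
    from upper[OF this] show ?thesis unfolding cauchy_transform_cnj by simp
  qed (rule upper)
  then show "\<rho>' = \<rho>"
    by (intro finite_measure_eqI_Cauchy)
      (auto simp: cauchy_transform_def intro: r.finite_measure_axioms r'.finite_measure_axioms)
qed


section \<open>Bounded continuous functions\<close>

lemma bcontfunI:
  fixes f :: "'a::topological_space \<Rightarrow> complex"
  shows "continuous_on UNIV f \<Longrightarrow> (\<And>t. cmod (f t) \<le> C) \<Longrightarrow> f \<in> bcontfun"
  unfolding bcontfun_def bounded_iff by auto

lemma bcontfunE:
  fixes f :: "'a::topological_space \<Rightarrow> complex"
  assumes "f \<in> bcontfun" obtains C where "C \<ge> 0" "\<And>t. cmod (f t) \<le> C" "continuous_on UNIV f"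
proof -
  obtain C where "\<And>t. cmod (f t) \<le> C" "continuous_on UNIV f"
    using assms unfolding bcontfun_def bounded_iff by auto
  then show ?thesis using that[of C] norm_ge_zero order_trans by blast
qed

lemma bcontfun_const: "(\<lambda>t. c :: complex) \<in> bcontfun"
  by (rule bcontfunI[of _ "cmod c"]) auto

lemma bcontfun_add:
  fixes f g :: "'a::topological_space \<Rightarrow> complex"
  assumes "f \<in> bcontfun" "g \<in> bcontfun"
  shows "(\<lambda>t. f t + g t) \<in> bcontfun"
proof -
  obtain C D where "\<And>t. cmod (f t) \<le> C" "\<And>t. cmod (g t) \<le> D" "continuous_on UNIV f" "continuous_on UNIV g"
    using assms by (metis bcontfunE)
  then show ?thesis by (intro bcontfunI[of _ "C + D"]) (auto intro: norm_triangle_mono continuous_intros)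
qed

lemma bcontfun_mult:
  fixes f g :: "'a::topological_space \<Rightarrow> complex"
  assumes "f \<in> bcontfun" "g \<in> bcontfun"
  shows "(\<lambda>t. f t * g t) \<in> bcontfun"
proof -
  obtain C D where "C \<ge> 0" "\<And>t. cmod (f t) \<le> C" "\<And>t. cmod (g t) \<le> D" "continuous_on UNIV f" "continuous_on UNIV g"
    using assms by (metis bcontfunE)
  then show ?thesis
    by (intro bcontfunI[of _ "C * D"]) (auto simp: norm_mult intro!: mult_mono continuous_intros)
qed

lemma bcontfun_diff_const:
  fixes f :: "'a::topological_space \<Rightarrow> complex"
  shows "f \<in> bcontfun \<Longrightarrow> (\<lambda>t. f t - c) \<in> bcontfun"
  using bcontfun_add[OF _ bcontfun_const[of "- c"], of f] by simp

lemma bcontfun_cnj: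
  fixes f :: "'a::topological_space \<Rightarrow> complex"
  shows "f \<in> bcontfun \<Longrightarrow> (\<lambda>t. cnj (f t)) \<in> bcontfun"
  unfolding bcontfun_def bounded_iff by (auto intro: continuous_intros)

section \<open>The domain of a self-adjoint operator in terms of bounded functions\<close>

text \<open>The function \<open>x / (\<i> - x)\<close> vanishes at \<open>0\<close>, so monotone independence applies to it, and up to a
  scalar and a factor it is the Cauchy kernel at \<open>\<i>\<close>.  Through it, being in the graph of an unbounded
  operator becomes an equation between vectors that involves a single bounded operator.\<close>

definition cayley_part :: "real \<Rightarrow> complex" where
  "cayley_part t = complex_of_real t / (\<i> - complex_of_real t)"

lemma i_minus_nonzero: "\<i> - complex_of_real t \<noteq> 0"
  by (simp add: complex_eq_iff)

lemma cayley_part_bcontfun: "cayley_part \<in> bcontfun"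
proof (rule bcontfunI[of _ 1])
  show "continuous_on UNIV cayley_part"
    unfolding cayley_part_def[abs_def] by (intro continuous_intros) (simp add: complex_eq_iff)
  fix t
  have "\<bar>t\<bar> \<le> cmod (\<i> - complex_of_real t)"
    using abs_Re_le_cmod[of "\<i> - complex_of_real t"] by simp
  then show "cmod (cayley_part t) \<le> 1"
    using i_minus_nonzero[of t] by (simp add: cayley_part_def norm_divide)
qed

lemma cayley_part_0: "cayley_part 0 = 0"
  by (simp add: cayley_part_def)

lemma cayley_part_identity:
  "\<i> * (cayley_part t * c) = complex_of_real t * c + cayley_part t * (complex_of_real t * c)"
  using i_minus_nonzero[of t] by (simp add: cayley_part_def divide_simps) (simp add: algebra_simps)

context self_adjoint_operator
begin

lemmas opr_bcont = opr_mult[OF bounded_borel_bcontfun bounded_borel_bcontfun]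

text \<open>The assumption is \<open>(\<i> - T)\<^sup>-\<^sup>1 (\<i> x - y) = x\<close>, since \<open>1 / (\<i> - t) = -\<i> (1 + t / (\<i> - t))\<close>.\<close>

lemma in_graphI:
  assumes "\<i> *\<^sub>C opr cayley_part x = y + opr cayley_part y"
  shows "(x, y) \<in> T"
proof -
  note r = bounded_borel_bcontfun[OF cayley_part_bcontfun]
  have "1 / (\<i> - complex_of_real t) = (- \<i>) * (1 + cayley_part t)" for t
    using i_minus_nonzero[of t] by (simp add: cayley_part_def divide_simps)
  then have "resolvent_op T \<i> v = (- \<i>) *\<^sub>C (v + opr cayley_part v)" for v
    using opr_Cauchy_kernel[of \<i> v] opr_scale[OF bounded_borel_add[OF bounded_borel_const r], of "- \<i>" 1 v]
      opr_add[OF bounded_borel_const r, of 1 v] by (simp add: opr_one)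
  then have "resolvent_op T \<i> (\<i> *\<^sub>C x - y) = x"
    by (simp add: bounded_clinearD[OF clinear_opr[OF r]] assms scaleC_simps)
  then show ?thesis using resolvent_op_in[OF self_adjoint_T, of \<i> "\<i> *\<^sub>C x - y"] by simp
qed

lemma opr_in_graph:
  assumes f: "f \<in> bcontfun" and k: "k \<in> bcontfun" and kf: "\<And>t. k t = complex_of_real t * f t"
  shows "(opr f x, opr k x) \<in> T"
proof (rule in_graphI)
  note [simp] = bounded_borel_bcontfun[OF f] bounded_borel_bcontfun[OF k] bounded_borel_bcontfun[OF cayley_part_bcontfun]
  have "\<i> * (cayley_part t * f t) = k t + cayley_part t * k t" for t
    unfolding kf by (rule cayley_part_identity)
  then have "opr (\<lambda>t. \<i> * (cayley_part t * f t)) x = opr (\<lambda>t. k t + cayley_part t * k t) x" by simp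
  then show "\<i> *\<^sub>C opr cayley_part (opr f x) = opr k x + opr cayley_part (opr k x)"
    by (simp add: opr_mult opr_add opr_scale bounded_borel_mult)
qed

lemma opr_in_alg0:
  assumes f: "f \<in> bcontfun" and "f 0 = 0"
  shows "opr f \<in> alg0 T"
proof -
  have "(\<lambda>z. f (Re z)) \<in> bcontfun"
  proof -
    obtain C where C: "\<And>t. cmod (f t) \<le> C" and cont: "continuous_on UNIV f" using f by (metis bcontfunE)
    have "continuous_on UNIV (\<lambda>z. f (Re z))"
      by (rule continuous_on_compose2[OF cont]) (auto intro: continuous_intros)
    then show ?thesis using C by (rule bcontfunI)
  qed
  moreover have "opr f = fun_calc T (\<lambda>t. f (Re (complex_of_real t)))"
    using fun_calc_eq_opr[OF bounded_borel_bcontfun[OF f]] by simp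
  ultimately show ?thesis unfolding alg0_def using assms(2) by (auto intro!: exI[of _ "\<lambda>z. f (Re z)"])
qed

end

section \<open>Monotone independence\<close>

lemma op_prod_Nil: "op_prod [] = id" and op_prod_Cons: "op_prod (S # Ss) = S \<circ> op_prod Ss"
  by (simp_all add: op_prod_def)

context
  fixes A B :: "('a::complex_hilbert_space \<Rightarrow> 'a) set" and \<Omega> :: 'a
  assumes mon: "monotone_indep_alg A B \<Omega>"
begin

lemma monotone_word:
  assumes "k \<ge> 1" "alternating k \<epsilon>" "\<And>i. i \<in> {1..k} \<Longrightarrow> X i \<in> (if \<epsilon> i = 1 then A else B)"
  shows "cinner \<Omega> (op_prod (map X [1..<Suc k]) \<Omega>) =
          cinner \<Omega> (op_prod (map X (filter (\<lambda>i. \<epsilon> i = 1) [1..<Suc k])) \<Omega>) *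
          (\<Prod>i | i \<in> {1..k} \<and> \<epsilon> i = 2. cinner \<Omega> (X i \<Omega>))"
  using mon assms unfolding monotone_indep_alg_def by blast

text \<open>The norm computations below use the words \<open>AB\<close>, \<open>BA\<close>, \<open>ABA\<close>, \<open>BAB\<close> and \<open>ABABA\<close>.\<close>

lemma monotone_AB:
  assumes "S1 \<in> A" "S2 \<in> B"
  shows "cinner \<Omega> (S1 (S2 \<Omega>)) = cinner \<Omega> (S1 \<Omega>) * cinner \<Omega> (S2 \<Omega>)"
proof -
  define \<epsilon> :: "nat \<Rightarrow> nat" where "\<epsilon> i = (if odd i then 1 else 2)" for i
  define X where "X i = (if i = 1 then S1 else S2)" for i :: nat
  have upt: "[1..<Suc 2] = [1, 2]" by (simp add: upt_conv_Cons numeral_eq_Suc)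
  have range: "{1..2::nat} = {1, 2}" by auto
  have "{i. i \<in> {1..2} \<and> \<epsilon> i = 2} = {2}" unfolding range by (auto simp: \<epsilon>_def)
  moreover have "alternating 2 \<epsilon>" by (auto simp: alternating_def \<epsilon>_def)
  moreover have "X i \<in> (if \<epsilon> i = 1 then A else B)" if "i \<in> {1..2}" for i
    using that assms unfolding range by (auto simp: X_def \<epsilon>_def)
  ultimately show ?thesis
    using monotone_word[of 2 \<epsilon> X] unfolding upt
    by (simp add: X_def \<epsilon>_def op_prod_Nil op_prod_Cons)
qed

lemma monotone_BA:
  assumes "S1 \<in> B" "S2 \<in> A"
  shows "cinner \<Omega> (S1 (S2 \<Omega>)) = cinner \<Omega> (S2 \<Omega>) * cinner \<Omega> (S1 \<Omega>)"
proof -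
  define \<epsilon> :: "nat \<Rightarrow> nat" where "\<epsilon> i = (if odd i then 2 else 1)" for i
  define X where "X i = (if i = 1 then S1 else S2)" for i :: nat
  have upt: "[1..<Suc 2] = [1, 2]" by (simp add: upt_conv_Cons numeral_eq_Suc)
  have range: "{1..2::nat} = {1, 2}" by auto
  have "{i. i \<in> {1..2} \<and> \<epsilon> i = 2} = {1}" unfolding range by (auto simp: \<epsilon>_def)
  moreover have "alternating 2 \<epsilon>" by (auto simp: alternating_def \<epsilon>_def)
  moreover have "X i \<in> (if \<epsilon> i = 1 then A else B)" if "i \<in> {1..2}" for i
    using that assms unfolding range by (auto simp: X_def \<epsilon>_def)
  ultimately show ?thesis
    using monotone_word[of 2 \<epsilon> X] unfolding upt
    by (simp add: X_def \<epsilon>_def op_prod_Nil op_prod_Cons)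
qed

lemma monotone_ABA:
  assumes "S1 \<in> A" "S2 \<in> B" "S3 \<in> A"
  shows "cinner \<Omega> (S1 (S2 (S3 \<Omega>))) = cinner \<Omega> (S1 (S3 \<Omega>)) * cinner \<Omega> (S2 \<Omega>)"
proof -
  define \<epsilon> :: "nat \<Rightarrow> nat" where "\<epsilon> i = (if odd i then 1 else 2)" for i
  define X where "X i = (if i = 1 then S1 else if i = 2 then S2 else S3)" for i :: nat
  have upt: "[1..<Suc 3] = [1, 2, 3]" by (simp add: upt_conv_Cons numeral_eq_Suc)
  have range: "{1..3::nat} = {1, 2, 3}" by auto
  have "{i. i \<in> {1..3} \<and> \<epsilon> i = 2} = {2}" unfolding range by (auto simp: \<epsilon>_def)
  moreover have "alternating 3 \<epsilon>" by (auto simp: alternating_def \<epsilon>_def)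
  moreover have "X i \<in> (if \<epsilon> i = 1 then A else B)" if "i \<in> {1..3}" for i
    using that assms unfolding range by (auto simp: X_def \<epsilon>_def)
  ultimately show ?thesis
    using monotone_word[of 3 \<epsilon> X] unfolding upt
    by (simp add: X_def \<epsilon>_def op_prod_Nil op_prod_Cons)
qed

lemma monotone_BAB:
  assumes "S1 \<in> B" "S2 \<in> A" "S3 \<in> B"
  shows "cinner \<Omega> (S1 (S2 (S3 \<Omega>))) = cinner \<Omega> (S2 \<Omega>) * (cinner \<Omega> (S1 \<Omega>) * cinner \<Omega> (S3 \<Omega>))"
proof -
  define \<epsilon> :: "nat \<Rightarrow> nat" where "\<epsilon> i = (if odd i then 2 else 1)" for i
  define X where "X i = (if i = 1 then S1 else if i = 2 then S2 else S3)" for i :: nat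
  have upt: "[1..<Suc 3] = [1, 2, 3]" by (simp add: upt_conv_Cons numeral_eq_Suc)
  have range: "{1..3::nat} = {1, 2, 3}" by auto
  have "{i. i \<in> {1..3} \<and> \<epsilon> i = 2} = {1, 3}" unfolding range by (auto simp: \<epsilon>_def)
  moreover have "alternating 3 \<epsilon>" by (auto simp: alternating_def \<epsilon>_def)
  moreover have "X i \<in> (if \<epsilon> i = 1 then A else B)" if "i \<in> {1..3}" for i
    using that assms unfolding range by (auto simp: X_def \<epsilon>_def)
  ultimately show ?thesis
    using monotone_word[of 3 \<epsilon> X] unfolding upt
    by (simp add: X_def \<epsilon>_def op_prod_Nil op_prod_Cons)
qed

lemma monotone_ABABA:
  assumes "S1 \<in> A" "S2 \<in> B" "S3 \<in> A" "S4 \<in> B" "S5 \<in> A"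
  shows "cinner \<Omega> (S1 (S2 (S3 (S4 (S5 \<Omega>))))) =
    cinner \<Omega> (S1 (S3 (S5 \<Omega>))) * (cinner \<Omega> (S2 \<Omega>) * cinner \<Omega> (S4 \<Omega>))"
proof -
  define \<epsilon> :: "nat \<Rightarrow> nat" where "\<epsilon> i = (if odd i then 1 else 2)" for i
  define X where "X i = (if i = 1 then S1 else if i = 2 then S2 else if i = 3 then S3 else if i = 4 then S4 else S5)"
    for i :: nat
  have upt: "[1..<Suc 5] = [1, 2, 3, 4, 5]"
    by (simp add: upt_conv_Cons numeral_eq_Suc)
  have range: "{1..5::nat} = {1, 2, 3, 4, 5}" by auto
  have "{i. i \<in> {1..5} \<and> \<epsilon> i = 2} = {2, 4}" unfolding range by (auto simp: \<epsilon>_def)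
  moreover have "alternating 5 \<epsilon>" by (auto simp: alternating_def \<epsilon>_def)
  moreover have "X i \<in> (if \<epsilon> i = 1 then A else B)" if "i \<in> {1..5}" for i
    using that assms unfolding range by (auto simp: X_def \<epsilon>_def)
  ultimately show ?thesis
    using monotone_word[of 5 \<epsilon> X] unfolding upt
    by (simp add: X_def \<epsilon>_def op_prod_Nil op_prod_Cons)
qed

end


section \<open>Monotonically independent self-adjoint operators\<close>

lemma eq_scaleC_if_cinner_eq:
  assumes uu: "cinner u u = c * (cnj a * a)" and wu: "cinner w u = c * a" and ww: "cinner w w = c"
  shows "u = a *\<^sub>C w"
proof -
  have "cnj c = c" using ww cinner_commute[of w w] by simp
  then have uw: "cinner u w = c * cnj a" using wu cinner_commute[of u w] by simp
  have "cinner (u - a *\<^sub>C w) (u - a *\<^sub>C w) = 0"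
    by (simp add: cinner_simps uu wu ww uw algebra_simps)
  then show ?thesis by (simp add: cinner_self_eq_zero)
qed

locale monotone_pair =
  X: self_adjoint_operator X + Y: self_adjoint_operator Y
  for X Y :: "('a::complex_hilbert_space \<times> 'a) set" +
  fixes \<Omega> :: 'a
  assumes unit: "norm \<Omega> = 1" and indep: "monotone_indep X Y \<Omega>" and cyclic: "cyclic_vector X Y \<Omega>"
begin

lemma indep_alg: "monotone_indep_alg (alg0 X) (alg0 Y) \<Omega>"
  using indep by (simp add: monotone_indep_def)

definition stateX :: "(real \<Rightarrow> complex) \<Rightarrow> complex" where
  "stateX f = cinner \<Omega> (X.opr f \<Omega>)"

definition stateY :: "(real \<Rightarrow> complex) \<Rightarrow> complex" where
  "stateY h = cinner \<Omega> (Y.opr h \<Omega>)"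

lemma cinner_Omega: "cinner \<Omega> \<Omega> = 1"
  by (simp add: cinner_self unit)

text \<open>Write \<open>u\<close> for the left-hand side and \<open>w\<close> for \<open>f(X) g(X) \<Omega>\<close>.  The inner products \<open>\<langle>u, u\<rangle>\<close> and
  \<open>\<langle>w, u\<rangle>\<close> are expectations of the words \<open>ABABA\<close> and \<open>ABA\<close>, with \<open>f\<^sup>* f\<close> in the middle of the first, so
  they are \<open>\<bar>a\<bar>\<^sup>2 \<langle>w, w\<rangle>\<close> and \<open>a \<langle>w, w\<rangle>\<close> for \<open>a = \<langle>\<Omega>, h(Y) \<Omega>\<rangle>\<close>, which makes
  \<open>u - a w\<close> a vector of norm zero.\<close>

lemma factorize_vanishing:
  assumes f: "f \<in> bcontfun" "f 0 = 0" and h: "h \<in> bcontfun" "h 0 = 0" and g: "g \<in> bcontfun" "g 0 = 0"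
  shows "X.opr f (Y.opr h (X.opr g \<Omega>)) = stateY h *\<^sub>C X.opr f (X.opr g \<Omega>)"
proof (rule eq_scaleC_if_cinner_eq[where c = "cinner (X.opr f (X.opr g \<Omega>)) (X.opr f (X.opr g \<Omega>))"])
  note bc [simp] = bcontfun_mult bcontfun_cnj f(1) h(1) g(1)
  note bb [simp] = bounded_borel_bcontfun[OF f(1)] bounded_borel_bcontfun[OF h(1)] bounded_borel_bcontfun[OF g(1)]
    bounded_borel_mult bounded_borel_cnj
  let ?u = "X.opr f (Y.opr h (X.opr g \<Omega>))" and ?w = "X.opr f (X.opr g \<Omega>)"
  let ?gc = "\<lambda>t. cnj (g t)" and ?hc = "\<lambda>t. cnj (h t)" and ?ff = "\<lambda>t. cnj (f t) * f t"
  have adj: "cinner (X.opr f v) (X.opr f v') = cinner v (X.opr ?ff v')" for v v'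
    by (simp add: X.opr_adjoint X.opr_mult bb)
  have ww: "cinner ?w ?w = cinner \<Omega> (X.opr ?gc (X.opr ?ff (X.opr g \<Omega>)))"
    unfolding adj by (simp add: X.opr_adjoint)
  have "cinner ?u ?u = cinner \<Omega> (X.opr ?gc (Y.opr ?hc (X.opr ?ff (Y.opr h (X.opr g \<Omega>)))))"
    unfolding adj by (simp add: X.opr_adjoint Y.opr_adjoint bb)
  also have "\<dots> = cinner \<Omega> (X.opr ?gc (X.opr ?ff (X.opr g \<Omega>))) * (stateY ?hc * stateY h)"
    unfolding stateY_def
    by (rule monotone_ABABA[OF indep_alg]; (rule X.opr_in_alg0 Y.opr_in_alg0)?) (auto intro!: bc simp: f h g)
  also have "stateY ?hc = cnj (stateY h)"
    unfolding stateY_def using Y.opr_adjoint[OF bb(2), of \<Omega> \<Omega>] cinner_commute by metis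
  finally show "cinner ?u ?u = cinner ?w ?w * (cnj (stateY h) * stateY h)" by (simp only: ww)
  have "cinner ?w ?u = cinner \<Omega> (X.opr (\<lambda>t. cnj (g t) * (cnj (f t) * f t)) (Y.opr h (X.opr g \<Omega>)))"
    unfolding adj by (simp add: X.opr_adjoint X.opr_mult bb bounded_borel_mult)
  also have "\<dots> = cinner \<Omega> (X.opr (\<lambda>t. cnj (g t) * (cnj (f t) * f t)) (X.opr g \<Omega>)) * stateY h"
    unfolding stateY_def
    by (rule monotone_ABA[OF indep_alg]; (rule X.opr_in_alg0 Y.opr_in_alg0)?) (auto intro!: bc simp: f h g)
  also have "cinner \<Omega> (X.opr (\<lambda>t. cnj (g t) * (cnj (f t) * f t)) (X.opr g \<Omega>)) = cinner ?w ?w"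
    unfolding ww by (simp add: X.opr_mult mult.assoc)
  finally show "cinner ?w ?u = cinner ?w ?w * stateY h" .
qed simp

text \<open>The same computation without \<open>g\<close>, with the words \<open>BAB\<close> and \<open>AB\<close>.\<close>

lemma factorize_vanishing_vacuum:
  assumes f: "f \<in> bcontfun" "f 0 = 0" and h: "h \<in> bcontfun" "h 0 = 0"
  shows "X.opr f (Y.opr h \<Omega>) = stateY h *\<^sub>C X.opr f \<Omega>"
proof (rule eq_scaleC_if_cinner_eq[where c = "cinner (X.opr f \<Omega>) (X.opr f \<Omega>)"])
  note bc [simp] = bcontfun_mult bcontfun_cnj f(1) h(1)
  note bb [simp] = bounded_borel_bcontfun[OF f(1)] bounded_borel_bcontfun[OF h(1)]
    bounded_borel_mult bounded_borel_cnj
  let ?u = "X.opr f (Y.opr h \<Omega>)" and ?w = "X.opr f \<Omega>"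
  let ?hc = "\<lambda>t. cnj (h t)" and ?ff = "\<lambda>t. cnj (f t) * f t"
  have adj: "cinner (X.opr f v) (X.opr f v') = cinner v (X.opr ?ff v')" for v v'
    by (simp add: X.opr_adjoint X.opr_mult bb)
  have "cinner ?u ?u = cinner \<Omega> (Y.opr ?hc (X.opr ?ff (Y.opr h \<Omega>)))"
    unfolding adj by (simp add: Y.opr_adjoint bb)
  also have "\<dots> = cinner \<Omega> (X.opr ?ff \<Omega>) * (stateY ?hc * stateY h)"
    unfolding stateY_def
    by (rule monotone_BAB[OF indep_alg]; (rule X.opr_in_alg0 Y.opr_in_alg0)?) (auto intro!: bc simp: f h)
  also have "stateY ?hc = cnj (stateY h)"
    unfolding stateY_def using Y.opr_adjoint[OF bb(2), of \<Omega> \<Omega>] cinner_commute by metis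
  finally show "cinner ?u ?u = cinner ?w ?w * (cnj (stateY h) * stateY h)" by (simp only: adj)
  have "cinner ?w ?u = cinner \<Omega> (X.opr ?ff \<Omega>) * stateY h"
    unfolding stateY_def adj
    by (rule monotone_AB[OF indep_alg]; (rule X.opr_in_alg0 Y.opr_in_alg0)?) (auto intro!: bc simp: f h)
  then show "cinner ?w ?u = cinner ?w ?w * stateY h" by (simp only: adj)
qed simp

lemma stateY_diff_const: "h \<in> bcontfun \<Longrightarrow> stateY (\<lambda>t. h t - c) = stateY h - c"
  unfolding stateY_def
  by (simp add: Y.opr_diff bounded_borel_bcontfun bounded_borel_const Y.opr_const cinner_simps cinner_Omega)

lemma opr_split:
  assumes "g \<in> bcontfun"
  shows "X.opr g v = X.opr (\<lambda>t. g t - g 0) v + g 0 *\<^sub>C v" "Y.opr g v = Y.opr (\<lambda>t. g t - g 0) v + g 0 *\<^sub>C v"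
  using assms by (simp_all add: X.opr_diff Y.opr_diff bounded_borel_bcontfun bounded_borel_const X.opr_const Y.opr_const)

text \<open>Both sides are linear in \<open>h\<close> and in \<open>g\<close>.  For constant \<open>h\<close> they agree trivially and for constant \<open>g\<close> by the
  previous lemma, so the values of \<open>h\<close> and \<open>g\<close> at \<open>0\<close> can be split off.\<close>

lemma factorize:
  assumes f: "f \<in> bcontfun" "f 0 = 0" and h: "h \<in> bcontfun" and g: "g \<in> bcontfun"
  shows "X.opr f (Y.opr h (X.opr g \<Omega>)) = stateY h *\<^sub>C X.opr f (X.opr g \<Omega>)"
proof -
  let ?h = "\<lambda>t. h t - h 0" and ?g = "\<lambda>t. g t - g 0"
  note bc = bcontfun_diff_const[OF h] bcontfun_diff_const[OF g]
  note bb = bc[THEN bounded_borel_bcontfun] f(1)[THEN bounded_borel_bcontfun]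
  note lin = bounded_clinearD[OF X.clinear_opr[OF bb(3)]] bounded_clinearD[OF Y.clinear_opr[OF bb(1)]]
  have "X.opr f (Y.opr ?h (X.opr g \<Omega>)) = stateY ?h *\<^sub>C X.opr f (X.opr g \<Omega>)"
    unfolding opr_split(1)[OF g]
    using factorize_vanishing[OF f bc(1) _ bc(2)] factorize_vanishing_vacuum[OF f bc(1)]
    by (simp add: lin scaleC_simps mult.commute)
  then show ?thesis
    unfolding opr_split(2)[OF h] by (simp add: lin stateY_diff_const[OF h] scaleC_simps)
qed

text \<open>They play the role of the functions \<open>g(x) h(y)\<close> in \<open>L\<^sup>2(\<mu> \<otimes> \<nu>)\<close>.\<close>

definition elementary :: "'a set" where
  "elementary = {Y.opr h (X.opr g \<Omega>) | h g. h \<in> bcontfun \<and> g \<in> bcontfun}"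

lemma elementaryI: "h \<in> bcontfun \<Longrightarrow> g \<in> bcontfun \<Longrightarrow> Y.opr h (X.opr g \<Omega>) \<in> elementary"
  unfolding elementary_def by blast

lemma X_elementary: "g \<in> bcontfun \<Longrightarrow> X.opr g \<Omega> \<in> elementary"
  using elementaryI[OF bcontfun_const[of 1], of g] by (simp add: Y.opr_one)

text \<open>Let \<open>N\<close> be the orthogonal complement of the elementary vectors and \<open>D\<close> that of \<open>N\<close>.  Functions of \<open>X\<close> and
  of \<open>Y\<close> map elementary vectors to linear combinations of such, so their adjoints preserve \<open>N\<close> and
  they themselves preserve \<open>D\<close>.  Hence \<open>D\<close> contains the dense orbit of \<open>\<Omega>\<close>, and \<open>N\<close> is trivial.\<close>

lemma elementary_total:
  assumes v: "\<And>e. e \<in> elementary \<Longrightarrow> cinner e v = 0"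
  shows "v = 0"
proof -
  define N where "N = {v. \<forall>e\<in>elementary. cinner e v = 0}"
  define D where "D = {u. \<forall>v\<in>N. cinner u v = 0}"
  have D: "u \<in> D" if "u \<in> elementary" for u using that by (auto simp: D_def N_def)
  have Yinv: "Y.opr k u \<in> D" if k: "k \<in> bcontfun" and u: "u \<in> D" for k u
  proof -
    have "cinner (Y.opr k u) v = 0" if v: "v \<in> N" for v
    proof -
      note kc = bcontfun_cnj[OF k] and kb = bounded_borel_bcontfun[OF k]
      note kcb = bounded_borel_bcontfun[OF kc]
      have "cinner e (Y.opr (\<lambda>t. cnj (k t)) v) = 0" if el: "e \<in> elementary" for e
      proof -
        obtain h g where h: "h \<in> bcontfun" and g: "g \<in> bcontfun" and e: "e = Y.opr h (X.opr g \<Omega>)"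
          using el unfolding elementary_def by blast
        have "cinner e (Y.opr (\<lambda>t. cnj (k t)) v) = cinner (Y.opr k e) v"
          by (rule Y.opr_adjoint[OF kb, symmetric])
        also have "Y.opr k e = Y.opr (\<lambda>t. k t * h t) (X.opr g \<Omega>)"
          unfolding e by (rule Y.opr_bcont[OF k h])
        also have "cinner \<dots> v = 0"
          using v elementaryI[OF bcontfun_mult[OF k h] g] by (simp add: N_def)
        finally show ?thesis .
      qed
      then have "Y.opr (\<lambda>t. cnj (k t)) v \<in> N" by (simp add: N_def)
      then have "cinner u (Y.opr (\<lambda>t. cnj (k t)) v) = 0" using u by (simp add: D_def)
      then show ?thesis by (simp add: Y.opr_adjoint[OF kb])
    qed
    then show ?thesis by (simp add: D_def)
  qed
  have Xinv: "X.opr k u \<in> D" if k: "k \<in> bcontfun" and u: "u \<in> D" for k u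
  proof -
    have "cinner (X.opr k u) v = 0" if v: "v \<in> N" for v
    proof -
      note kc = bcontfun_cnj[OF k] and kb = bounded_borel_bcontfun[OF k]
      let ?k = "\<lambda>t. k t - k 0"
      note k0 = bcontfun_diff_const[OF k, of "k 0"]
      have "cinner e (X.opr (\<lambda>t. cnj (k t)) v) = 0" if el: "e \<in> elementary" for e
      proof -
        obtain h g where h: "h \<in> bcontfun" and g: "g \<in> bcontfun" and e: "e = Y.opr h (X.opr g \<Omega>)"
          using el unfolding elementary_def by blast
        have "cinner e (X.opr (\<lambda>t. cnj (k t)) v) = cinner (X.opr k e) v"
          by (rule X.opr_adjoint[OF kb, symmetric])
        also have "X.opr k e = stateY h *\<^sub>C X.opr (\<lambda>t. ?k t * g t) \<Omega> + k 0 *\<^sub>C e"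
          using opr_split(1)[OF k, of e] factorize[OF k0 _ h g] X.opr_bcont[OF k0 g, of \<Omega>]
          by (simp add: e)
        also have "cinner \<dots> v = 0"
          using v \<open>e \<in> elementary\<close> X_elementary[OF bcontfun_mult[OF k0 g]]
          by (simp add: N_def cinner_simps)
        finally show ?thesis .
      qed
      then have "X.opr (\<lambda>t. cnj (k t)) v \<in> N" by (simp add: N_def)
      then have "cinner u (X.opr (\<lambda>t. cnj (k t)) v) = 0" using u by (simp add: D_def)
      then show ?thesis by (simp add: X.opr_adjoint[OF kb])
    qed
    then show ?thesis by (simp add: D_def)
  qed
  have "\<forall>u\<in>D. S u \<in> D" if "S \<in> alg {T. \<exists>h\<in>bcontfun. T = fun_calc X h \<or> T = fun_calc Y h}" for S
    using that
  proof induction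
    case (generator T)
    then show ?case
      using Xinv Yinv by (auto simp: X.fun_calc_eq_opr Y.fun_calc_eq_opr bounded_borel_bcontfun)
  qed (auto simp: D_def cinner_simps)
  moreover have "\<Omega> \<in> D"
    using D[OF X_elementary[OF bcontfun_const[of 1]]] by (simp add: X.opr_one)
  moreover have "v \<in> N" using v by (simp add: N_def)
  ultimately show ?thesis
    using cyclic unfolding cyclic_vector_def by (elim orthogonal_dense_zero) (auto simp: D_def)
qed

lemma dense_if_elementary:
  assumes S: "complex_subspace S" and sub: "elementary \<subseteq> closure S"
  shows "closure S = UNIV"
proof (rule dense_if_orthogonal_trivial[OF S])
  fix v assume orth: "\<And>s. s \<in> S \<Longrightarrow> cinner s v = 0"
  have "cinner e v = 0" if e: "e \<in> elementary" for e
  proof -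
    have "e \<in> closure S" using e sub by blast
    then obtain f where f: "\<And>n::nat. f n \<in> S" "f \<longlonglongrightarrow> e" by (metis closure_sequential)
    have "(\<lambda>n. cinner (f n) v) \<longlonglongrightarrow> cinner e v" by (intro tendsto_cinner f tendsto_const)
    then show ?thesis using orth f(1) LIMSEQ_unique[of "\<lambda>n. 0" 0] by simp
  qed
  then show "v = 0" by (rule elementary_total)
qed

text \<open>In the model, \<open>X\<close> sends \<open>g(x) h(y)\<close> to \<open>x g(x) \<integral> h d\<nu>\<close>.\<close>

lemma factorized_in_graph:
  assumes h: "h \<in> bcontfun" and g: "g \<in> bcontfun" and k: "k \<in> bcontfun"
    and kg: "\<And>t. k t = complex_of_real t * g t"
  shows "(Y.opr h (X.opr g \<Omega>), stateY h *\<^sub>C X.opr k \<Omega>) \<in> X"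
proof (rule X.in_graphI)
  note bb = bounded_borel_bcontfun[OF g] bounded_borel_bcontfun[OF k] bounded_borel_bcontfun[OF cayley_part_bcontfun]
  have "\<i> * (cayley_part t * g t) = k t + cayley_part t * k t" for t
    unfolding kg by (rule cayley_part_identity)
  then have "X.opr (\<lambda>t. \<i> * (cayley_part t * g t)) \<Omega> = X.opr (\<lambda>t. k t + cayley_part t * k t) \<Omega>" by simp
  then have eq: "\<i> *\<^sub>C X.opr cayley_part (X.opr g \<Omega>) = X.opr k \<Omega> + X.opr cayley_part (X.opr k \<Omega>)"
    by (simp add: X.opr_mult X.opr_add X.opr_scale bounded_borel_mult bb)
  have "\<i> *\<^sub>C X.opr cayley_part (Y.opr h (X.opr g \<Omega>)) = stateY h *\<^sub>C (\<i> *\<^sub>C X.opr cayley_part (X.opr g \<Omega>))"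
    unfolding factorize[OF cayley_part_bcontfun cayley_part_0 h g] by (simp add: scaleC_scaleC mult.commute)
  then show "\<i> *\<^sub>C X.opr cayley_part (Y.opr h (X.opr g \<Omega>)) =
      stateY h *\<^sub>C X.opr k \<Omega> + X.opr cayley_part (stateY h *\<^sub>C X.opr k \<Omega>)"
    unfolding eq by (simp add: bounded_clinearD[OF X.clinear_opr[OF bb(3)]] scaleC_add_right)
qed

text \<open>Multiplying \<open>g\<close> and \<open>h\<close> by these functions puts \<open>h(Y) g(X) \<Omega>\<close> into the domains of \<open>X\<close> and \<open>Y\<close>.\<close>

definition cutoff :: "nat \<Rightarrow> real \<Rightarrow> complex" where
  "cutoff n t = complex_of_real ((1 + real n) / (1 + real n + t\<^sup>2))"

lemma cutoff_bcontfun: "cutoff n \<in> bcontfun" and cutoff_le: "cmod (cutoff n t) \<le> 1"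
  and cutoff_moment: "(\<lambda>t. complex_of_real t * cutoff n t) \<in> bcontfun"
proof -
  have pos: "1 + real n + t\<^sup>2 > 0" for t by (intro add_pos_nonneg) auto
  have cont: "continuous_on UNIV (cutoff n)"
    unfolding cutoff_def[abs_def] using pos by (intro continuous_intros) (auto simp: less_imp_neq[symmetric])
  have norm: "cmod (cutoff n t) = (1 + real n) / (1 + real n + t\<^sup>2)" for t
    unfolding cutoff_def norm_of_real using pos[of t] by (intro abs_of_nonneg) auto
  show le: "cmod (cutoff n t) \<le> 1" for t unfolding norm using pos[of t] by simp
  show "cutoff n \<in> bcontfun" by (rule bcontfunI[OF cont le])
  show "(\<lambda>t. complex_of_real t * cutoff n t) \<in> bcontfun"
  proof (rule bcontfunI[of _ "1 + real n"])
    show "continuous_on UNIV (\<lambda>t. complex_of_real t * cutoff n t)" by (intro continuous_intros cont)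
    fix t :: real
    have "\<bar>t\<bar> \<le> 1 + t\<^sup>2" using zero_le_power2[of "\<bar>t\<bar> - 1"] by (simp add: power2_eq_square algebra_simps)
    then have "\<bar>t\<bar> / (1 + real n + t\<^sup>2) \<le> 1" using pos[of t] by simp
    then have "(1 + real n) * (\<bar>t\<bar> / (1 + real n + t\<^sup>2)) \<le> (1 + real n) * 1" by (rule mult_left_mono) simp
    then show "cmod (complex_of_real t * cutoff n t) \<le> 1 + real n" by (simp add: norm_mult norm mult.commute)
  qed
qed

lemma cutoff_tendsto: "(\<lambda>n. cutoff n t) \<longlonglongrightarrow> 1"
proof -
  have "(\<lambda>n. (1 + real n) / (1 + real n + t\<^sup>2)) \<longlonglongrightarrow> 1" by real_asymp
  then have "(\<lambda>n. complex_of_real ((1 + real n) / (1 + real n + t\<^sup>2))) \<longlonglongrightarrow> complex_of_real 1"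
    by (rule tendsto_of_real)
  then show ?thesis by (simp add: cutoff_def)
qed

lemma cutoff_mult_tendsto:
  assumes "g \<in> bcontfun"
  shows "(\<lambda>n. X.opr (\<lambda>t. cutoff n t * g t) v) \<longlonglongrightarrow> X.opr g v"
    and "(\<lambda>n. Y.opr (\<lambda>t. cutoff n t * g t) v) \<longlonglongrightarrow> Y.opr g v"
proof -
  obtain C where C: "C \<ge> 0" "\<And>t. cmod (g t) \<le> C" using assms by (metis bcontfunE)
  have 1: "(\<lambda>t. cutoff n t * g t) \<in> borel_measurable borel" for n
    by (intro bounded_borel_measurable bounded_borel_bcontfun bcontfun_mult cutoff_bcontfun assms)
  have 2: "cmod (cutoff n t * g t) \<le> C" for n t
    using mult_mono[OF cutoff_le[of n t] C(2)[of t]] by (simp add: norm_mult)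
  have 3: "(\<lambda>n. cutoff n t * g t) \<longlonglongrightarrow> g t" for t
    using tendsto_mult_right[OF cutoff_tendsto[of t], of "g t"] by simp
  show "(\<lambda>n. X.opr (\<lambda>t. cutoff n t * g t) v) \<longlonglongrightarrow> X.opr g v"
    by (rule X.opr_tendsto[OF 1 2 3])
  show "(\<lambda>n. Y.opr (\<lambda>t. cutoff n t * g t) v) \<longlonglongrightarrow> Y.opr g v"
    by (rule Y.opr_tendsto[OF 1 2 3])
qed

lemma elementary_cutoff_in_Domain:
  assumes h: "h \<in> bcontfun" and g: "g \<in> bcontfun"
  shows "Y.opr (\<lambda>t. cutoff n t * h t) (X.opr (\<lambda>t. cutoff m t * g t) \<Omega>) \<in> Domain (op_sum X Y)"
proof -
  have X: "(Y.opr (\<lambda>t. cutoff n t * h t) (X.opr (\<lambda>t. cutoff m t * g t) \<Omega>),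
      stateY (\<lambda>t. cutoff n t * h t) *\<^sub>C X.opr (\<lambda>t. complex_of_real t * cutoff m t * g t) \<Omega>) \<in> X"
    by (rule factorized_in_graph) (auto intro!: bcontfun_mult[OF cutoff_moment] bcontfun_mult[OF cutoff_bcontfun] h g)
  have Y: "(Y.opr (\<lambda>t. cutoff n t * h t) (X.opr (\<lambda>t. cutoff m t * g t) \<Omega>),
      Y.opr (\<lambda>t. complex_of_real t * cutoff n t * h t) (X.opr (\<lambda>t. cutoff m t * g t) \<Omega>)) \<in> Y"
    by (rule Y.opr_in_graph) (auto intro!: bcontfun_mult[OF cutoff_moment] bcontfun_mult[OF cutoff_bcontfun] h g)
  show ?thesis using X Y unfolding op_sum_def by blast
qed

lemma linear_operator_op_sum: "linear_operator (op_sum X Y)"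
proof -
  note X = self_adjointD(1)[OF X.self_adjoint_T] and Y = self_adjointD(1)[OF Y.self_adjoint_T]
  show ?thesis
    unfolding linear_operator_def
  proof (intro conjI allI impI)
    show "single_valued (op_sum X Y)"
    proof (rule single_valuedI)
      fix x y y' assume "(x, y) \<in> op_sum X Y" "(x, y') \<in> op_sum X Y"
      then obtain a b a' b' where "(x, a) \<in> X" "(x, b) \<in> Y" "y = a + b" "(x, a') \<in> X" "(x, b') \<in> Y" "y' = a' + b'"
        unfolding op_sum_def by blast
      then show "y = y'" using linear_operatorD(1)[OF X, of x a a'] linear_operatorD(1)[OF Y, of x b b'] by simp
    qed
    show "(0, 0) \<in> op_sum X Y"
      using linear_operatorD(2)[OF X] linear_operatorD(2)[OF Y] unfolding op_sum_def by force
    fix x y x' y' assume "(x, y) \<in> op_sum X Y" "(x', y') \<in> op_sum X Y"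
    then obtain a b a' b' where ab: "(x, a) \<in> X" "(x, b) \<in> Y" "y = a + b" "(x', a') \<in> X" "(x', b') \<in> Y" "y' = a' + b'"
      unfolding op_sum_def by blast
    have "(x + x', a + a') \<in> X" "(x + x', b + b') \<in> Y" "y + y' = (a + a') + (b + b')"
      using linear_operatorD(3)[OF X ab(1,4)] linear_operatorD(3)[OF Y ab(2,5)] ab by auto
    then show "(x + x', y + y') \<in> op_sum X Y" unfolding op_sum_def by blast
  next
    fix c x y assume "(x, y) \<in> op_sum X Y"
    then obtain a b where ab: "(x, a) \<in> X" "(x, b) \<in> Y" "y = a + b" unfolding op_sum_def by blast
    have "c *\<^sub>C y = c *\<^sub>C a + c *\<^sub>C b" by (simp add: ab scaleC_add_right)
    then show "(c *\<^sub>C x, c *\<^sub>C y) \<in> op_sum X Y"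
      using linear_operatorD(4)[OF X ab(1), of c] linear_operatorD(4)[OF Y ab(2), of c] unfolding op_sum_def by blast
  qed
qed

text \<open>The cut-off elementary vectors lie in both domains and approximate all elementary vectors, so the sum
  is densely defined.\<close>

lemma symmetric_op_sum: "symmetric_op (op_sum X Y)"
proof -
  note lin = linear_operator_op_sum
  have "complex_subspace (Domain (op_sum X Y))"
    unfolding complex_subspace_def
    using linear_operatorD(2)[OF lin] linear_operatorD(3)[OF lin] linear_operatorD(4)[OF lin] by blast
  moreover have "elementary \<subseteq> closure (Domain (op_sum X Y))"
  proof
    fix e assume "e \<in> elementary"
    then obtain h g where h: "h \<in> bcontfun" and g: "g \<in> bcontfun" and e: "e = Y.opr h (X.opr g \<Omega>)"
      unfolding elementary_def by blast
    have "Y.opr h (X.opr (\<lambda>t. cutoff m t * g t) \<Omega>) \<in> closure (Domain (op_sum X Y))" for m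
      unfolding closure_sequential
      using elementary_cutoff_in_Domain[OF h g, of _ m] cutoff_mult_tendsto(2)[OF h]
      by (intro exI[of _ "\<lambda>n. Y.opr (\<lambda>t. cutoff n t * h t) (X.opr (\<lambda>t. cutoff m t * g t) \<Omega>)"]) simp
    moreover have "(\<lambda>m. Y.opr h (X.opr (\<lambda>t. cutoff m t * g t) \<Omega>)) \<longlonglongrightarrow> e"
      unfolding e by (intro bounded_clinear_tendsto[OF Y.clinear_opr] bounded_borel_bcontfun h cutoff_mult_tendsto(1) g)
    ultimately show "e \<in> closure (Domain (op_sum X Y))"
      by (rule closed_sequentially[OF closed_closure])
  qed
  ultimately have "closure (Domain (op_sum X Y)) = UNIV" by (rule dense_if_elementary)
  moreover have "op_sum X Y \<subseteq> adjoint_op (op_sum X Y)"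
  proof (rule subrelI, rule adjoint_opI)
    fix x y x' y' assume "(x, y) \<in> op_sum X Y" "(x', y') \<in> op_sum X Y"
    then obtain a b a' b' where ab: "(x, a) \<in> X" "(x, b) \<in> Y" "y = a + b" "(x', a') \<in> X" "(x', b') \<in> Y" "y' = a' + b'"
      unfolding op_sum_def by blast
    show "cinner x y' = cinner y x'"
      using self_adjoint_cinner[OF X.self_adjoint_T ab(1,4)] self_adjoint_cinner[OF Y.self_adjoint_T ab(2,5)]
      by (simp add: ab(3,6) cinner_simps)
  qed
  ultimately show ?thesis using lin unfolding symmetric_op_def densely_defined_def by blast
qed

context
  fixes z :: complex
  assumes z: "Im z \<noteq> 0"
begin

definition kernel :: "real \<Rightarrow> complex" where
  "kernel t = 1 / (z - complex_of_real t)"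

definition cauchyY :: complex where
  "cauchyY = stateY kernel"

text \<open>The function \<open>k\<close> that multiplies \<open>H g\<close> in \<open>X \<psi> = H k(X) g(X) \<Omega>\<close>, where \<open>\<psi>\<close> solves
  \<open>(z - X - Y) \<psi> = h(Y) g(X) \<Omega>\<close>.\<close>

definition feedback :: "real \<Rightarrow> complex" where
  "feedback t = complex_of_real t / (1 - cauchyY * complex_of_real t)"

lemma kernel_bcontfun: "kernel \<in> bcontfun"
  unfolding kernel_def[abs_def] by (rule Cauchy_kernel_bcontfun[OF z])

lemma opr_kernel: "Y.opr kernel v = resolvent_op Y z v"
  unfolding kernel_def[abs_def] by (rule Y.opr_Cauchy_kernel[OF z])

text \<open>With \<open>v = (z - Y)\<^sup>-\<^sup>1 \<Omega>\<close> the imaginary part of \<open>\<langle>\<Omega>, v\<rangle>\<close> is \<open>- Im z \<parallel>v\<parallel>\<^sup>2\<close>.\<close>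

lemma Im_cauchyY: "Im cauchyY \<noteq> 0"
proof
  assume 0: "Im cauchyY = 0"
  define v where "v = resolvent_op Y z \<Omega>"
  have in_Y: "(v, z *\<^sub>C v - \<Omega>) \<in> Y" unfolding v_def by (rule resolvent_op_in[OF Y.self_adjoint_T z])
  have "cinner v (z *\<^sub>C v - \<Omega>) = cinner (z *\<^sub>C v - \<Omega>) v"
    by (rule self_adjoint_cinner[OF Y.self_adjoint_T in_Y in_Y])
  then have eq: "z * cinner v v - cnj (cinner \<Omega> v) = cnj z * cinner v v - cinner \<Omega> v"
    using cinner_commute[of v \<Omega>] by (simp add: cinner_simps)
  have "cauchyY = cinner \<Omega> v" by (simp add: cauchyY_def stateY_def opr_kernel v_def)
  then have "Im z * (norm v)\<^sup>2 = 0"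
    using arg_cong[OF eq, of Im] 0 by (simp add: cinner_self)
  then have "v = 0" using z by simp
  then have "(0, - \<Omega>) \<in> Y" using in_Y by simp
  then have "- \<Omega> = 0"
    using linear_operatorD(1,2)[OF self_adjointD(1)[OF Y.self_adjoint_T]] by metis
  then show False using unit by simp
qed

lemma feedback_denominator: "1 - cauchyY * complex_of_real t \<noteq> 0"
proof
  assume eq: "1 - cauchyY * complex_of_real t = 0"
  then have "Im (cauchyY * complex_of_real t) = 0" by (metis diff_eq_diff_eq eq_iff_diff_eq_0 one_complex.simps(2))
  then have "t = 0" using Im_cauchyY by simp
  then show False using eq by simp
qed

lemma feedback_bcontfun: "feedback \<in> bcontfun"
proof (rule bcontfunI[of _ "1 / \<bar>Im cauchyY\<bar>"])
  show "continuous_on UNIV feedback"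
    unfolding feedback_def[abs_def] using feedback_denominator by (intro continuous_intros) auto
  fix t :: real
  have "\<bar>Im cauchyY\<bar> * \<bar>t\<bar> \<le> cmod (1 - cauchyY * complex_of_real t)"
    using abs_Im_le_cmod[of "1 - cauchyY * complex_of_real t"] by (simp add: abs_mult)
  then have "\<bar>t\<bar> \<le> (1 / \<bar>Im cauchyY\<bar>) * cmod (1 - cauchyY * complex_of_real t)"
    using Im_cauchyY by (simp add: field_simps)
  then show "cmod (feedback t) \<le> 1 / \<bar>Im cauchyY\<bar>"
    using feedback_denominator[of t] by (simp add: feedback_def norm_divide divide_le_eq)
qed

lemma feedback_0: "feedback 0 = 0"
  by (simp add: feedback_def)

definition resolvent_vector :: "(real \<Rightarrow> complex) \<Rightarrow> (real \<Rightarrow> complex) \<Rightarrow> 'a" where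
  "resolvent_vector h g = Y.opr kernel (Y.opr h (X.opr g \<Omega>))
     + stateY (\<lambda>t. kernel t * h t) *\<^sub>C Y.opr kernel (X.opr feedback (X.opr g \<Omega>))"

text \<open>The vector \<open>\<psi>\<close> is \<open>(z - Y)\<^sup>-\<^sup>1\<close> of \<open>h(Y) g(X) \<Omega> + \<eta>\<close> with \<open>\<eta> = H k(X) g(X) \<Omega>\<close>, so it remains to see
  \<open>X \<psi> = \<eta>\<close>.  By \<open>in_graphI\<close> and \<open>factorize\<close> this is the equation
  \<open>\<i> r (1 + G k) = k (1 + r)\<close> for \<open>r x = x / (\<i> - x)\<close>, and both sides are equal to
  \<open>\<i> x / ((\<i> - x) (1 - G x))\<close>.\<close>

lemma resolvent_vector_in_sum:
  assumes h: "h \<in> bcontfun" and g: "g \<in> bcontfun"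
  shows "(resolvent_vector h g, z *\<^sub>C resolvent_vector h g - Y.opr h (X.opr g \<Omega>)) \<in> op_sum X Y"
proof -
  define H where "H = stateY (\<lambda>t. kernel t * h t)"
  define \<psi> where "\<psi> = resolvent_vector h g"
  define \<eta> where "\<eta> = H *\<^sub>C X.opr feedback (X.opr g \<Omega>)"
  note bc = bcontfun_mult cayley_part_bcontfun feedback_bcontfun g
  note bb = bc[THEN bounded_borel_bcontfun]
  note kb = bounded_borel_bcontfun[OF kernel_bcontfun]
  have "\<psi> = Y.opr kernel (Y.opr h (X.opr g \<Omega>) + \<eta>)"
    by (simp add: \<psi>_def resolvent_vector_def \<eta>_def H_def bounded_clinearD[OF Y.clinear_opr[OF kb]])
  then have in_Y: "(\<psi>, z *\<^sub>C \<psi> - (Y.opr h (X.opr g \<Omega>) + \<eta>)) \<in> Y"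
    using resolvent_op_in[OF Y.self_adjoint_T z] by (simp add: opr_kernel)
  have in_X: "(\<psi>, \<eta>) \<in> X"
  proof (rule X.in_graphI)
    have r1: "X.opr cayley_part (Y.opr kernel (Y.opr h (X.opr g \<Omega>))) = H *\<^sub>C X.opr (\<lambda>t. cayley_part t * g t) \<Omega>"
      unfolding Y.opr_bcont[OF kernel_bcontfun h]
      by (simp add: factorize[OF cayley_part_bcontfun cayley_part_0 bcontfun_mult[OF kernel_bcontfun h] g]
          H_def X.opr_bcont[OF cayley_part_bcontfun g])
    have r2: "X.opr cayley_part (Y.opr kernel (X.opr feedback (X.opr g \<Omega>)))
        = cauchyY *\<^sub>C X.opr (\<lambda>t. cayley_part t * (feedback t * g t)) \<Omega>"
      unfolding X.opr_bcont[OF feedback_bcontfun g]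
      by (simp add: factorize[OF cayley_part_bcontfun cayley_part_0 kernel_bcontfun bcontfun_mult[OF feedback_bcontfun g]]
          cauchyY_def X.opr_bcont[OF cayley_part_bcontfun bcontfun_mult[OF feedback_bcontfun g]])
    have "\<i> * (cayley_part t * g t + cauchyY * (cayley_part t * (feedback t * g t)))
        = feedback t * g t + cayley_part t * (feedback t * g t)" for t
    proof -
      have "1 + cauchyY * feedback t = 1 / (1 - cauchyY * complex_of_real t)"
        using feedback_denominator[of t] by (simp add: feedback_def divide_simps)
      moreover have "1 + cayley_part t = \<i> / (\<i> - complex_of_real t)"
        using i_minus_nonzero[of t] by (simp add: cayley_part_def divide_simps)
      ultimately have "\<i> * cayley_part t * (1 + cauchyY * feedback t) = feedback t * (1 + cayley_part t)"
        by (simp add: cayley_part_def feedback_def mult.commute)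
      then have "\<i> * cayley_part t * (1 + cauchyY * feedback t) * g t = feedback t * (1 + cayley_part t) * g t" by simp
      then show ?thesis by (simp add: algebra_simps)
    qed
    then have "X.opr (\<lambda>t. \<i> * (cayley_part t * g t + cauchyY * (cayley_part t * (feedback t * g t)))) \<Omega>
        = X.opr (\<lambda>t. feedback t * g t + cayley_part t * (feedback t * g t)) \<Omega>" by simp
    then have eq: "\<i> *\<^sub>C (X.opr (\<lambda>t. cayley_part t * g t) \<Omega> + cauchyY *\<^sub>C X.opr (\<lambda>t. cayley_part t * (feedback t * g t)) \<Omega>)
        = X.opr (\<lambda>t. feedback t * g t) \<Omega> + X.opr (\<lambda>t. cayley_part t * (feedback t * g t)) \<Omega>"
      by (simp add: X.opr_scale X.opr_add bb bounded_borel_mult bounded_borel_scale bounded_borel_add)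
    have "\<i> *\<^sub>C X.opr cayley_part \<psi> = H *\<^sub>C (\<i> *\<^sub>C (X.opr (\<lambda>t. cayley_part t * g t) \<Omega> + cauchyY *\<^sub>C X.opr (\<lambda>t. cayley_part t * (feedback t * g t)) \<Omega>))"
      unfolding \<psi>_def resolvent_vector_def H_def[symmetric]
      by (simp add: bounded_clinearD[OF X.clinear_opr[OF bb(2)]] r1 r2 scaleC_simps mult_ac)
    also have "\<dots> = \<eta> + X.opr cayley_part \<eta>"
      unfolding eq \<eta>_def
      by (simp add: bounded_clinearD[OF X.clinear_opr[OF bb(2)]] X.opr_mult bb bounded_borel_mult scaleC_add_right)
    finally show "\<i> *\<^sub>C X.opr cayley_part \<psi> = \<eta> + X.opr cayley_part \<eta>" .
  qed
  have "z *\<^sub>C \<psi> - Y.opr h (X.opr g \<Omega>) = \<eta> + (z *\<^sub>C \<psi> - (Y.opr h (X.opr g \<Omega>) + \<eta>))" by simp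
  then show ?thesis using in_X in_Y unfolding op_sum_def \<psi>_def by blast
qed

lemma dense_shift_range_op_sum: "closure (shift_range (op_sum X Y) z) = UNIV"
proof (rule dense_if_elementary)
  show "complex_subspace (shift_range (op_sum X Y) z)"
    by (rule complex_subspace_shift_range[OF linear_operator_op_sum])
  have "elementary \<subseteq> shift_range (op_sum X Y) z"
    unfolding elementary_def shift_range_def using resolvent_vector_in_sum by blast
  then show "elementary \<subseteq> closure (shift_range (op_sum X Y) z)" using closure_subset by blast
qed

lemma vacuum_resolvent_vector:
  "cinner \<Omega> (resolvent_vector (\<lambda>t. 1) (\<lambda>t. 1)) = cauchyY + cauchyY * cauchyY * stateX feedback"
proof -
  let ?k = "\<lambda>t. kernel t - kernel 0"
  have "cinner \<Omega> (Y.opr ?k (X.opr feedback \<Omega>)) = stateX feedback * stateY ?k"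
    unfolding stateX_def stateY_def
    by (rule monotone_BA[OF indep_alg]; (rule X.opr_in_alg0 Y.opr_in_alg0)?)
      (auto intro: bcontfun_diff_const kernel_bcontfun feedback_bcontfun simp: feedback_0)
  then have "cinner \<Omega> (Y.opr kernel (X.opr feedback \<Omega>)) = stateX feedback * cauchyY"
    unfolding opr_split(2)[OF kernel_bcontfun]
    by (simp add: stateY_diff_const[OF kernel_bcontfun] cinner_simps stateX_def[symmetric] cauchyY_def algebra_simps)
  then show ?thesis
    unfolding resolvent_vector_def
    by (simp add: X.opr_one Y.opr_one cinner_simps cauchyY_def stateY_def)
qed

text \<open>The integrand is \<open>G (1 + G k(x)) = G / (1 - G x) = 1 / (1 / G - x)\<close>.\<close>

lemma cauchy_transform_identity:
  "cauchyY + cauchyY * cauchyY * stateX feedback = cauchy_transform (spectral_distribution X \<Omega>) (1 / cauchyY)"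
proof -
  have c0: "cauchyY \<noteq> 0" using Im_cauchyY by auto
  have "cauchyY + cauchyY * cauchyY * stateX feedback
      = cinner \<Omega> (X.opr (\<lambda>t. cauchyY * (1 + cauchyY * feedback t)) \<Omega>)"
    using bounded_borel_bcontfun[OF feedback_bcontfun]
    by (simp add: X.opr_scale X.opr_add X.opr_const X.opr_one bounded_borel_add bounded_borel_scale bounded_borel_const
        cinner_simps cinner_Omega stateX_def algebra_simps)
  also have "\<dots> = (\<integral>t. cauchyY * (1 + cauchyY * feedback t) \<partial>spectral_distribution X \<Omega>)"
    by (intro X.cinner_opr_diagonal bounded_borel_scale bounded_borel_add bounded_borel_const bounded_borel_bcontfun feedback_bcontfun)
  also have "(\<lambda>t. cauchyY * (1 + cauchyY * feedback t)) = (\<lambda>t. 1 / (1 / cauchyY - complex_of_real t))"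
  proof
    fix t
    have "1 / cauchyY - complex_of_real t = (1 - cauchyY * complex_of_real t) / cauchyY"
      using c0 by (simp add: divide_simps)
    moreover have "1 + cauchyY * feedback t = 1 / (1 - cauchyY * complex_of_real t)"
      using feedback_denominator[of t] by (simp add: feedback_def divide_simps)
    ultimately show "cauchyY * (1 + cauchyY * feedback t) = 1 / (1 / cauchyY - complex_of_real t)" by simp
  qed
  finally show ?thesis by (simp add: cauchy_transform_def)
qed

lemma cauchyY_eq: "cauchyY = cauchy_transform (spectral_distribution Y \<Omega>) z"
  unfolding cauchyY_def stateY_def cauchy_transform_def kernel_def[abs_def]
  by (rule Y.cinner_opr_diagonal) (rule bounded_borel_Cauchy_kernel[OF z])

end

lemma essentially_self_adjoint_op_sum: "essentially_self_adjoint (op_sum X Y)"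
  by (rule essentially_self_adjointI[OF symmetric_op_sum, of \<i>])
    (auto intro!: dense_shift_range_op_sum)

lemma distribution_op_sum:
  "distribution (closure (op_sum X Y)) \<Omega> = distribution X \<Omega> \<rhd> distribution Y \<Omega>"
proof -
  interpret Z: self_adjoint_operator "closure (op_sum X Y)"
    using essentially_self_adjoint_op_sum by unfold_locales (simp add: essentially_self_adjoint_def)
  show ?thesis
    unfolding X.distribution_eq(1)[OF unit] Y.distribution_eq(1)[OF unit] Z.distribution_eq(1)[OF unit]
  proof (rule monotone_convI[symmetric, OF Z.distribution_eq(2)[OF unit]])
    fix z :: complex assume "Im z > 0"
    then have z: "Im z \<noteq> 0" by simp
    have "(resolvent_vector z (\<lambda>t. 1) (\<lambda>t. 1), z *\<^sub>C resolvent_vector z (\<lambda>t. 1) (\<lambda>t. 1) - \<Omega>) \<in> closure (op_sum X Y)"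
      using resolvent_vector_in_sum[OF z bcontfun_const bcontfun_const, of 1 1] closure_subset
      by (auto simp: X.opr_one Y.opr_one)
    then have "resolvent_op (closure (op_sum X Y)) z \<Omega> = resolvent_vector z (\<lambda>t. 1) (\<lambda>t. 1)"
      by (rule resolvent_op_eqI[OF Z.self_adjoint_T z])
    then have "cauchy_transform (spectral_distribution (closure (op_sum X Y)) \<Omega>) z
        = cinner \<Omega> (resolvent_vector z (\<lambda>t. 1) (\<lambda>t. 1))"
      using spectral_distribution(3)[OF Z.self_adjoint_T z] by (simp add: cauchy_transform_def)
    also have "\<dots> = cauchy_transform (spectral_distribution X \<Omega>) (1 / cauchy_transform (spectral_distribution Y \<Omega>) z)"
      unfolding vacuum_resolvent_vector[OF z] unfolding cauchy_transform_identity[OF z] unfolding cauchyY_eq[OF z] ..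
    finally show "recip_cauchy_transform (spectral_distribution (closure (op_sum X Y)) \<Omega>) z =
        recip_cauchy_transform (spectral_distribution X \<Omega>) (recip_cauchy_transform (spectral_distribution Y \<Omega>) z)"
      by (simp add: recip_cauchy_transform_def)
  qed
qed

end

theorem theorem3p10:
  fixes X Y :: "('a::complex_hilbert_space \<times> 'a) set" and \<Omega> :: 'a
  assumes "self_adjoint X" and "self_adjoint Y"
    and "norm \<Omega> = 1"
    and "monotone_indep X Y \<Omega>"
    and "cyclic_vector X Y \<Omega>"
  shows "essentially_self_adjoint (op_sum X Y) \<and>
    distribution (closure (op_sum X Y)) \<Omega> = distribution X \<Omega> \<rhd> distribution Y \<Omega>"
proof -
  interpret monotone_pair X Y \<Omega> using assms by unfold_locales
  show ?thesis using essentially_self_adjoint_op_sum distribution_op_sum by blast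
qed

end
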